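(* Let $G$ be a locally Roelcke precompact (LRPC) group, and let $X$ and $Y$ be $G$-flows. (1) If $X\preceq_G Y$, then $\mathrm{tp}_G(X)\subseteq\mathrm{tp}_G(Y)$. In particular, if $X\sim_G Y$, then $\mathrm{tp}_G(X)=\mathrm{tp}_G(Y)$. (2) If $Y$ is Urysohn, $H\subseteq G$ is dense, $\mathcal{B}\subseteq\mathcal{N}_G^{\mathrm{RPC}}$ is a base at $e_G$, and $\zeta\colon\mathcal{B}\to\mathcal{B}$ is a non-expansive map such that $\zeta^*[\mathrm{tp}_{H,\mathcal{B}}(X)]\subseteq\mathrm{tp}_{H,\mathcal{B}}(Y)$, then $X\preceq_G Y$. In particular, if both $X$ and $Y$ are Urysohn, then $X\sim_G Y$ iff $\mathrm{tp}_G(X)=\mathrm{tp}_G(Y)$, and $\mathrm{tp}_G(Y)$ is completely determined by $\mathrm{tp}_{H,\mathcal{B}}(Y)$ (for $H\subseteq G$ dense and $\mathcal{B}\subseteq\mathcal{N}_G^{\mathrm{RPC}}$ a base at $e_G$).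
   Context: All groups and spaces are Hausdorff. $G$ is a topological group with identity $e_G$ and $\mathcal{N}(G)$ is a fixed base of symmetric open neighborhoods of $e_G$. A $G$-flow is a compact space with a continuous left $G$-action; a factor map is a surjective continuous $G$-equivariant map. Ultracopowers. For a $G$-space $X$, $\mathrm{C}_G(X)$ is the algebra of bounded continuous $p\colon X\to\mathbb{C}$ such that $g\mapsto pg$ is sup-norm continuous, where $(pg)(x)=p(gx)$; $\alpha_G(X)$ is its Gelfand space, a $G$-flow. For an infinite set $I$, $\mathcal{U}\in\beta I$ and a $G$-flow $Y$, the map $I\times Y\to\beta I$, $(i,y)\mapsto i$, extends continuously to $\pi_I\colon \alpha_G(I\times Y)\to\beta I$, and the ultracopower is the $G$-flow $\Sigma_{\mathcal{U}}^GY:=\pi_I^{-1}(\{\mathcal{U}\})$. $X\preceq_G Y$ (weak containment) iff $X$ is a factor of some ultracopower of $Y$; $X\sim_G Y$ iff $X\preceq_GY$ and $Y\preceq_GX$. LRPC groups. $S\subseteq G$ is Roelcke precompact (RPC) if for every $V\in\mathcal{N}(G)$ there is a finite $F\subseteq G$ with $S\subseteq VFV$. $G$ is LRPC if some $U\in\mathcal{N}(G)$ is RPC. $\mathcal{N}_G^{\mathrm{RPC}}$ is the set of RPC members of $\mathcal{N}(G)$. A semi-norm on $G$ is a bounded continuous $\sigma\colon G\to\mathbb{R}^{\ge0}$ with $\sigma(e_G)=0$, $\sigma(g^{-1})=\sigma(g)$, $\sigma(gh)\le\sigma(g)+\sigma(h)$; $\mathrm{SN}_{\mathrm{RPC}}(G)$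 is the set of semi-norms $\sigma$ such that $\{g:\sigma(g)<1\}$ is RPC. Urysohn flows. For a $G$-flow $X$ and $U\in\mathcal{N}(G)$, $R_U^X:=\overline{\{(x,gx):x\in X,g\in U\}}\subseteq X^2$. For $\sigma\in \mathrm{SN}_{\mathrm{RPC}}(G)$, $X$ is $(U,\sigma)$-Urysohn if whenever $K,L\subseteq X$ are non-empty closed with $(K\times L)\cap R_U^X=\emptyset$, then for every $0<c<1$ there is a continuous $p\colon X\to[0,1]$ with $\|pg-p\|\le\sigma(g)$ for all $g\in G$, $p|_K\equiv0$ and $p|_L\equiv c$. $X$ is Urysohn if for every $U\in\mathcal{N}_G^{\mathrm{RPC}}$ there is $\sigma\in\mathrm{SN}_{\mathrm{RPC}}(G)$ such that $X$ is $(U,\sigma)$-Urysohn. Weak types. For finite $F\subseteq G$ and finite $N\subseteq\mathcal{N}_G^{\mathrm{RPC}}$, $\mathcal{L}_{F,N}$ is the relational language $\{E_{g,U}:g\in F,U\in N\}\cup\{C_n:1\le n<\omega\}$ with $E_{g,U}$ binary and $C_n$ $n$-ary. $\mathrm{Str}(F,N)$ is the set of $\mathcal{L}_{F,N}$-structures with vertex set $n=\{0,\dots,n-1\}$ for some $n\in\mathbb{N}$; for $H\subseteq G$ and $\mathcal{B}\subseteq\mathcal{N}_G^{\mathrm{RPC}}$, $\mathrm{Str}(H,\mathcal{B})$ is the union of $\mathrm{Str}(F,N)$ over finite $F\subseteq H$, $N\subseteq\mathcal{B}$. For a $G$-flow $X$ and a finite set $\mathcal{O}$ of non-empty open subsets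 of $X$, $\mathbf{Str}(\mathcal{O},F,N)$ is the $\mathcal{L}_{F,N}$-structure with vertex set $\mathcal{O}$ in which $E_{g,U}(A,B)$ holds iff $(\overline{gA}\times\overline{B})\cap R_U^X=\emptyset$, and $C_n(A_0,\dots,A_{n-1})$ holds iff $\bigcup_{m<n}A_m=X$. $X$ realizes $\mathbf{M}\in\mathrm{Str}(F,N)$ if for some finite set $\mathcal{O}$ of non-empty open subsets of $X$ there is a bijection $e\colon\mathbf{M}\to\mathbf{Str}(\mathcal{O},F,N)$ such that images of related tuples are related. $\mathrm{tp}_{H,\mathcal{B}}(X)$ is the set of $\mathbf{M}\in\mathrm{Str}(H,\mathcal{B})$ realized by $X$, and $\mathrm{tp}_G(X):=\mathrm{tp}_{G,\mathcal{N}_G^{\mathrm{RPC}}}(X)$ is the weak type of $X$. A map $\zeta\colon\mathcal{B}\to\mathcal{N}_G^{\mathrm{RPC}}$ is non-expansive if $\zeta(U)\subseteq U$ for all $U$. For $\mathbf{M}\in\mathrm{Str}(F,N)$ with $N\subseteq\mathcal{B}$, $\zeta^*(\mathbf{M})\in\mathrm{Str}(F,\zeta[N])$ has the same vertex set and the same $C_n$ relations as $\mathbf{M}$, and its only other relations are $E_{g,\zeta(U)}(a,b)$ whenever $E_{g,U}(a,b)$ holds in $\mathbf{M}$. *)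

theory Defs
  imports "HOL-Analysis.Analysis"
begin

text \<open>
  The ambient group is a type of class \<open>{topological_group_add, t2_space}\<close>, the library's class of
  topological groups.  It is written additively but is \<^emph>\<open>not\<close> assumed to be commutative: \<open>g + h\<close> is
  the product \<open>gh\<close>, \<open>- g\<close> is the inverse and \<open>0\<close> is the identity.
  The fixed base of symmetric open identity neighbourhoods is a parameter \<open>\<N>\<close>.
\<close>

section \<open>Neighbourhood bases and Roelcke precompactness\<close>

definition base_at_identity :: "'g::{topological_group_add, t2_space} set set \<Rightarrow> bool" where
  "base_at_identity \<B> \<longleftrightarrow>
     (\<forall>U\<in>\<B>. open U \<and> 0 \<in> U) \<and> (\<forall>W. open W \<and> 0 \<in> W \<longrightarrow> (\<exists>U\<in>\<B>. U \<subseteq> W))"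

definition symmetric_base :: "'g::{topological_group_add, t2_space} set set \<Rightarrow> bool" where
  "symmetric_base \<N> \<longleftrightarrow> base_at_identity \<N> \<and> (\<forall>U\<in>\<N>. uminus ` U = U)"

definition RPC :: "'g::{topological_group_add, t2_space} set set \<Rightarrow> 'g set \<Rightarrow> bool" where
  "RPC \<N> S \<longleftrightarrow>
     (\<forall>V\<in>\<N>. \<exists>F. finite F \<and> S \<subseteq> {v + f + w | v f w. v \<in> V \<and> f \<in> F \<and> w \<in> V})"

definition RPC_nbhds :: "'g::{topological_group_add, t2_space} set set \<Rightarrow> 'g set set" where
  "RPC_nbhds \<N> = {U \<in> \<N>. RPC \<N> U}"

definition LRPC :: "'g::{topological_group_add, t2_space} set set \<Rightarrow> bool" where
  "LRPC \<N> \<longleftrightarrow> (\<exists>U\<in>\<N>. RPC \<N> U)"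

definition seminorm :: "('g::{topological_group_add, t2_space} \<Rightarrow> real) \<Rightarrow> bool" where
  "seminorm \<sigma> \<longleftrightarrow> continuous_on UNIV \<sigma> \<and> bounded (range \<sigma>) \<and> (\<forall>g. 0 \<le> \<sigma> g) \<and> \<sigma> 0 = 0
     \<and> (\<forall>g. \<sigma> (- g) = \<sigma> g) \<and> (\<forall>g h. \<sigma> (g + h) \<le> \<sigma> g + \<sigma> h)"

definition SN_RPC :: "'g::{topological_group_add, t2_space} set set \<Rightarrow> ('g \<Rightarrow> real) set" where
  "SN_RPC \<N> = {\<sigma>. seminorm \<sigma> \<and> RPC \<N> {g. \<sigma> g < 1}}"

section \<open>Spaces with an action, flows and factors\<close>

text \<open>The action is only meaningful at points of the underlying space \<open>topspace (gtop X)\<close>.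
  The empty space counts as a flow here; non-emptiness is assumed where it is needed.\<close>

record ('g, 'x) gspace =
  gtop :: "'x topology"
  gact :: "'g \<Rightarrow> 'x \<Rightarrow> 'x"

definition is_gspace :: "('g::{topological_group_add, t2_space}, 'x) gspace \<Rightarrow> bool" where
  "is_gspace X \<longleftrightarrow> Hausdorff_space (gtop X)
     \<and> continuous_map (prod_topology euclidean (gtop X)) (gtop X) (\<lambda>(g, x). gact X g x)
     \<and> (\<forall>x\<in>topspace (gtop X). gact X 0 x = x)
     \<and> (\<forall>g h. \<forall>x\<in>topspace (gtop X). gact X (g + h) x = gact X g (gact X h x))"

definition is_flow :: "('g::{topological_group_add, t2_space}, 'x) gspace \<Rightarrow> bool" where
  "is_flow X \<longleftrightarrow> is_gspace X \<and> compact_space (gtop X)"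

definition is_factor_map ::
  "('g, 'z) gspace \<Rightarrow> ('g, 'x) gspace \<Rightarrow> ('z \<Rightarrow> 'x) \<Rightarrow> bool" where
  "is_factor_map Z X f \<longleftrightarrow> continuous_map (gtop Z) (gtop X) f
     \<and> f ` topspace (gtop Z) = topspace (gtop X)
     \<and> (\<forall>g. \<forall>z\<in>topspace (gtop Z). f (gact Z g z) = gact X g (f z))"

definition is_factor_of :: "('g, 'x) gspace \<Rightarrow> ('g, 'z) gspace \<Rightarrow> bool" where
  "is_factor_of X Z \<longleftrightarrow> (\<exists>f. is_factor_map Z X f)"

section \<open>The algebra \<open>C_G(X)\<close> and its Gelfand space\<close>

text \<open>
  Functions on a space are represented by extensional functions on its carrier, so that equality
  of functions is equality on the space.
\<close>

definition translate :: "('g, 'x) gspace \<Rightarrow> ('x \<Rightarrow> complex) \<Rightarrow> 'g \<Rightarrow> 'x \<Rightarrow> complex" where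
  "translate X p g = (\<lambda>x\<in>topspace (gtop X). p (gact X g x))"

definition C_G :: "('g::{topological_group_add, t2_space}, 'x) gspace \<Rightarrow> ('x \<Rightarrow> complex) set" where
  "C_G X = {p \<in> extensional (topspace (gtop X)).
     continuous_map (gtop X) euclidean p \<and> bounded (p ` topspace (gtop X))
     \<and> (\<forall>g. uniform_limit (topspace (gtop X)) (translate X p) (translate X p g) (at g))}"

definition is_character ::
  "('g::{topological_group_add, t2_space}, 'x) gspace \<Rightarrow> (('x \<Rightarrow> complex) \<Rightarrow> complex) \<Rightarrow> bool" where
  "is_character X \<phi> \<longleftrightarrow>
     (\<forall>p\<in>C_G X. \<forall>q\<in>C_G X. \<phi> (\<lambda>x\<in>topspace (gtop X). p x + q x) = \<phi> p + \<phi> q)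
     \<and> (\<forall>p\<in>C_G X. \<forall>c. \<phi> (\<lambda>x\<in>topspace (gtop X). c * p x) = c * \<phi> p)
     \<and> (\<forall>p\<in>C_G X. \<forall>q\<in>C_G X. \<phi> (\<lambda>x\<in>topspace (gtop X). p x * q x) = \<phi> p * \<phi> q)
     \<and> (\<exists>p\<in>C_G X. \<phi> p \<noteq> 0)"

definition gelfand ::
  "('g::{topological_group_add, t2_space}, 'x) gspace \<Rightarrow> ('g, ('x \<Rightarrow> complex) \<Rightarrow> complex) gspace" where
  "gelfand X = \<lparr>
     gtop = subtopology (product_topology (\<lambda>_. euclidean) (C_G X))
              {\<phi> \<in> extensional (C_G X). is_character X \<phi>},
     gact = (\<lambda>g \<phi>. \<lambda>p\<in>C_G X. \<phi> (translate X p g)) \<rparr>"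

definition evaluation ::
  "('g::{topological_group_add, t2_space}, 'x) gspace \<Rightarrow> 'x \<Rightarrow> ('x \<Rightarrow> complex) \<Rightarrow> complex" where
  "evaluation X x = (\<lambda>p\<in>C_G X. p x)"

section \<open>Ultracopowers and weak containment\<close>

definition ultrafilters_on :: "'i set \<Rightarrow> 'i filter set" where
  "ultrafilters_on I = {\<U>. \<U> \<noteq> bot \<and> \<U> \<le> principal I
     \<and> (\<forall>P. eventually P \<U> \<or> eventually (\<lambda>i. \<not> P i) \<U>)}"

text \<open>The Stone--Cech compactification of the discrete space \<open>I\<close>; \<open>i\<close> is identified with
  \<open>principal {i}\<close>.\<close>

definition beta_top :: "'i set \<Rightarrow> 'i filter topology" where
  "beta_top I = topology_generated_by
     {{\<U> \<in> ultrafilters_on I. eventually (\<lambda>i. i \<in> A) \<U>} | A. A \<subseteq> I}"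

definition copies :: "'i set \<Rightarrow> ('g, 'y) gspace \<Rightarrow> ('g, 'i \<times> 'y) gspace" where
  "copies I Y = \<lparr> gtop = prod_topology (discrete_topology I) (gtop Y),
                  gact = (\<lambda>g (i, y). (i, gact Y g y)) \<rparr>"

text \<open>
  The continuous extension of the first projection; it is unique because the evaluations are dense
  in the Gelfand space and \<open>\<beta>I\<close> is Hausdorff (extensionality fixes the values off the
  Gelfand space).
\<close>

definition beta_proj ::
  "'i set \<Rightarrow> ('g::{topological_group_add, t2_space}, 'y) gspace
    \<Rightarrow> (('i \<times> 'y \<Rightarrow> complex) \<Rightarrow> complex) \<Rightarrow> 'i filter" where
  "beta_proj I Y = (THE \<pi>. \<pi> \<in> extensional (topspace (gtop (gelfand (copies I Y))))
     \<and> continuous_map (gtop (gelfand (copies I Y))) (beta_top I) \<pi>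
     \<and> (\<forall>i\<in>I. \<forall>y\<in>topspace (gtop Y). \<pi> (evaluation (copies I Y) (i, y)) = principal {i}))"

definition ultracopower ::
  "'i set \<Rightarrow> 'i filter \<Rightarrow> ('g::{topological_group_add, t2_space}, 'y) gspace
    \<Rightarrow> ('g, ('i \<times> 'y \<Rightarrow> complex) \<Rightarrow> complex) gspace" where
  "ultracopower I \<U> Y = \<lparr>
     gtop = subtopology (gtop (gelfand (copies I Y)))
              {\<phi> \<in> topspace (gtop (gelfand (copies I Y))). beta_proj I Y \<phi> = \<U>},
     gact = gact (gelfand (copies I Y)) \<rparr>"

text \<open>Weak containment witnessed by an index set in the type \<open>'i\<close>.\<close>

definition weakly_contained_over ::
  "'i itself \<Rightarrow> ('g::{topological_group_add, t2_space}, 'x) gspace \<Rightarrow> ('g, 'y) gspace \<Rightarrow> bool" where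
  "weakly_contained_over _ X Y \<longleftrightarrow>
     (\<exists>I :: 'i set. infinite I \<and> (\<exists>\<U> \<in> ultrafilters_on I. is_factor_of X (ultracopower I \<U> Y)))"

text \<open>
  The index set of an ultracopower may be any set, but HOL cannot quantify over types inside a
  formula.  Index sets in the type below suffice: if \<open>X\<close> is a factor of an ultracopower of \<open>Y\<close> over
  any index set, then \<open>C(X)\<close> embeds equivariantly in a quotient of \<open>C_G(I \<times> Y)\<close>, and choosing, for
  all finite sets of functions on \<open>X\<close>, finite subsets of the group and tolerances \<open>1/(n+1)\<close>, an
  index that respects them reindexes this ultracopower by a set of such triples.  Index types
  that are larger than necessary change nothing, since an ultrafilter can be pushed forward along
  an injection.
\<close>

type_synonym ('g, 'x) index = "('x \<Rightarrow> complex) set \<times> 'g set \<times> 'g set set \<times> nat"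

definition weakly_contained ::
  "('g::{topological_group_add, t2_space}, 'x) gspace \<Rightarrow> ('g, 'y) gspace \<Rightarrow> bool"
    (infix "\<preceq>\<^sub>G" 50) where
  "X \<preceq>\<^sub>G Y \<longleftrightarrow> weakly_contained_over TYPE(('g, 'x) index) X Y"

definition weakly_equivalent ::
  "('g::{topological_group_add, t2_space}, 'x) gspace \<Rightarrow> ('g, 'y) gspace \<Rightarrow> bool"
    (infix "\<sim>\<^sub>G" 50) where
  "X \<sim>\<^sub>G Y \<longleftrightarrow> X \<preceq>\<^sub>G Y \<and> Y \<preceq>\<^sub>G X"

section \<open>Urysohn flows\<close>

definition R_rel :: "('g, 'x) gspace \<Rightarrow> 'g set \<Rightarrow> ('x \<times> 'x) set" where
  "R_rel X U = prod_topology (gtop X) (gtop X) closure_of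
     {(x, gact X g x) | x g. x \<in> topspace (gtop X) \<and> g \<in> U}"

text \<open>The inequality \<open>\<parallel>pg - p\<parallel> \<le> \<sigma>(g)\<close> between a sup norm and a non-negative number is written
  pointwise.\<close>

definition Urysohn_for ::
  "'g set \<Rightarrow> ('g \<Rightarrow> real) \<Rightarrow> ('g, 'x) gspace \<Rightarrow> bool" where
  "Urysohn_for U \<sigma> X \<longleftrightarrow>
     (\<forall>K L. closedin (gtop X) K \<and> closedin (gtop X) L \<and> K \<noteq> {} \<and> L \<noteq> {}
        \<and> (K \<times> L) \<inter> R_rel X U = {} \<longrightarrow>
        (\<forall>c::real. 0 < c \<and> c < 1 \<longrightarrow>
          (\<exists>p. continuous_map (gtop X) (top_of_set {0..1}) p
             \<and> (\<forall>g. \<forall>x\<in>topspace (gtop X). \<bar>p (gact X g x) - p x\<bar> \<le> \<sigma> g)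
             \<and> (\<forall>x\<in>K. p x = 0) \<and> (\<forall>x\<in>L. p x = c))))"

definition Urysohn ::
  "'g::{topological_group_add, t2_space} set set \<Rightarrow> ('g, 'x) gspace \<Rightarrow> bool" where
  "Urysohn \<N> X \<longleftrightarrow> (\<forall>U\<in>RPC_nbhds \<N>. \<exists>\<sigma>\<in>SN_RPC \<N>. Urysohn_for U \<sigma> X)"

section \<open>Weak types\<close>

text \<open>
  A relational structure carries its language \<open>\<L>\<^bsub>F,N\<^esub>\<close>, given by \<open>F = lgrp M\<close> and \<open>N = lnbh M\<close>.
  \<open>relC M n\<close> is a set of \<open>n\<close>-tuples, as lists.  Relations whose symbol is not in the language are
  required to be empty, so that equality of records is equality of structures.
\<close>

record ('g, 'v) lstruct =
  verts :: "'v set"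
  lgrp :: "'g set"
  lnbh :: "'g set set"
  relE :: "'g \<Rightarrow> 'g set \<Rightarrow> ('v \<times> 'v) set"
  relC :: "nat \<Rightarrow> 'v list set"

definition is_lstruct :: "'g set \<Rightarrow> 'g set set \<Rightarrow> ('g, 'v) lstruct \<Rightarrow> bool" where
  "is_lstruct F N M \<longleftrightarrow> lgrp M = F \<and> lnbh M = N
     \<and> (\<forall>g U. relE M g U \<subseteq> verts M \<times> verts M)
     \<and> (\<forall>g U. g \<notin> F \<or> U \<notin> N \<longrightarrow> relE M g U = {})
     \<and> (\<forall>n. relC M n \<subseteq> {t. length t = n \<and> set t \<subseteq> verts M})
     \<and> relC M 0 = {}"

definition Str :: "'g set \<Rightarrow> 'g set set \<Rightarrow> ('g, nat) lstruct set" where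
  "Str F N = {M. is_lstruct F N M \<and> (\<exists>n. verts M = {..<n})}"

definition Str_over :: "'g set \<Rightarrow> 'g set set \<Rightarrow> ('g, nat) lstruct set" where
  "Str_over H \<B> = (\<Union>F\<in>{F. finite F \<and> F \<subseteq> H}. \<Union>N\<in>{N. finite N \<and> N \<subseteq> \<B>}. Str F N)"

definition open_struct ::
  "('g, 'x) gspace \<Rightarrow> 'x set set \<Rightarrow> 'g set \<Rightarrow> 'g set set \<Rightarrow> ('g, 'x set) lstruct" where
  "open_struct X \<O> F N = \<lparr>
     verts = \<O>, lgrp = F, lnbh = N,
     relE = (\<lambda>g U. {(A, B). g \<in> F \<and> U \<in> N \<and> A \<in> \<O> \<and> B \<in> \<O>
       \<and> ((gtop X closure_of (gact X g ` A)) \<times> (gtop X closure_of B)) \<inter> R_rel X U = {}}),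
     relC = (\<lambda>n. {t. 1 \<le> n \<and> length t = n \<and> set t \<subseteq> \<O> \<and> \<Union>(set t) = topspace (gtop X)}) \<rparr>"

definition bij_morphism ::
  "('v \<Rightarrow> 'w) \<Rightarrow> ('g, 'v) lstruct \<Rightarrow> ('g, 'w) lstruct \<Rightarrow> bool" where
  "bij_morphism e M M' \<longleftrightarrow> bij_betw e (verts M) (verts M')
     \<and> (\<forall>g U a b. (a, b) \<in> relE M g U \<longrightarrow> (e a, e b) \<in> relE M' g U)
     \<and> (\<forall>n. \<forall>t\<in>relC M n. map e t \<in> relC M' n)"

definition realizes :: "('g, 'x) gspace \<Rightarrow> ('g, nat) lstruct \<Rightarrow> bool" where
  "realizes X M \<longleftrightarrow> (\<exists>\<O>. finite \<O> \<and> (\<forall>A\<in>\<O>. openin (gtop X) A \<and> A \<noteq> {})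
     \<and> (\<exists>e. bij_morphism e M (open_struct X \<O> (lgrp M) (lnbh M))))"

definition tp_over :: "'g set \<Rightarrow> 'g set set \<Rightarrow> ('g, 'x) gspace \<Rightarrow> ('g, nat) lstruct set" where
  "tp_over H \<B> X = {M \<in> Str_over H \<B>. realizes X M}"

definition weak_type ::
  "'g::{topological_group_add, t2_space} set set \<Rightarrow> ('g, 'x) gspace \<Rightarrow> ('g, nat) lstruct set" where
  "weak_type \<N> X = tp_over UNIV (RPC_nbhds \<N>) X"

definition nonexpansive :: "'g set set \<Rightarrow> ('g set \<Rightarrow> 'g set) \<Rightarrow> bool" where
  "nonexpansive \<B> \<zeta> \<longleftrightarrow> (\<forall>U\<in>\<B>. \<zeta> U \<subseteq> U)"

definition push_struct :: "('g set \<Rightarrow> 'g set) \<Rightarrow> ('g, 'v) lstruct \<Rightarrow> ('g, 'v) lstruct" where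
  "push_struct \<zeta> M = \<lparr> verts = verts M, lgrp = lgrp M, lnbh = \<zeta> ` lnbh M,
     relE = (\<lambda>g V. \<Union>U\<in>{U \<in> lnbh M. \<zeta> U = V}. relE M g U),
     relC = relC M \<rparr>"

end

theory Submission
  imports Defs
begin

text \<open>
  (1) Points of an ultracopower \<open>Z\<close> of \<open>Y\<close> are limits, along the ultrafilter, of points \<open>y i\<close> of \<open>Y\<close>. Finitely
  many open subsets of a factor of \<open>Z\<close> are pulled back to \<open>Z\<close> and slightly shrunk to superlevel sets of functions
  in \<open>C_G(I \<times> Y)\<close>, which restrict to open subsets of the \<open>i\<close>-th copy of \<open>Y\<close>. For almost all \<open>i\<close> these
  realize the same structure: otherwise a limit of counterexamples \<open>(y i, h i y i)\<close> with \<open>h i \<in> U\<close> lies in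
  \<open>R_U\<close> of \<open>Z\<close>, because Roelcke precompactness of \<open>U\<close> allows the \<open>h i\<close> to be replaced by one element of \<open>U\<close>.

  (2) The indices are finite sets \<open>\<Phi>\<close> of continuous functions on \<open>X\<close>, \<open>F \<subseteq> H\<close> and \<open>N \<subseteq> \<B>\<close>. For each index,
  a finite cover of \<open>X\<close> by open sets \<open>A\<close> on which \<open>\<Phi>\<close> oscillates little is copied to open sets \<open>s i A\<close> of \<open>Y\<close>
  by the hypothesis on types. A point of the ultracopower that is a limit of points in \<open>s i (A i)\<close> is sent to the
  limit of the sets \<open>A i\<close>. This map is well defined and equivariant: if a point and its translate by \<open>g\<close> were
  sent to \<open>x\<close> and to \<open>x' \<noteq> g x\<close>, the Urysohn property would provide functions on the copies of \<open>Y\<close>, with a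
  common modulus \<open>\<sigma>\<close>, hence one element of \<open>C_G(I \<times> Y)\<close>, whose value at the translate would be both close to \<open>0\<close>
  and equal to \<open>1 / 2\<close>.
\<close>

section \<open>The algebra of uniformly continuous functions\<close>

abbreviation points :: "('g, 'x) gspace \<Rightarrow> 'x set" where
  "points X \<equiv> topspace (gtop X)"

lemma gact_continuous:
  assumes "is_gspace X"
  shows "continuous_map (gtop X) (gtop X) (gact X g)"
proof -
  have "continuous_map (gtop X) (prod_topology euclidean (gtop X)) (\<lambda>x. (g, x))"
    by (simp add: continuous_map_pairwise o_def)
  then have "continuous_map (gtop X) (gtop X) ((\<lambda>(g, x). gact X g x) \<circ> (\<lambda>x. (g, x)))"
    using assms unfolding is_gspace_def by (elim conjE continuous_map_compose)
  then show ?thesis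
    by (simp add: o_def)
qed

lemma gact_closed: "is_gspace X \<Longrightarrow> x \<in> points X \<Longrightarrow> gact X g x \<in> points X"
  using continuous_map_image_subset_topspace[OF gact_continuous] by blast

lemma gact_add: "is_gspace X \<Longrightarrow> x \<in> points X \<Longrightarrow> gact X (g + h) x = gact X g (gact X h x)"
  and gact_zero: "is_gspace X \<Longrightarrow> x \<in> points X \<Longrightarrow> gact X 0 x = x"
  unfolding is_gspace_def by blast+

lemma translate_apply [simp]: "x \<in> points X \<Longrightarrow> translate X p g x = p (gact X g x)"
  by (simp add: translate_def)

lemma C_G_ext: "p \<in> C_G X \<Longrightarrow> q \<in> C_G X \<Longrightarrow> (\<And>x. x \<in> points X \<Longrightarrow> p x = q x) \<Longrightarrow> p = q"
  by (rule extensionalityI[where A = "points X"]) (auto simp: C_G_def)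

lemma C_G_I:
  assumes "continuous_map (gtop X) euclidean p" "bounded (p ` points X)" "is_gspace X"
    and "\<And>g. uniform_limit (points X) (\<lambda>h x. p (gact X h x)) (\<lambda>x. p (gact X g x)) (at g)"
  shows "restrict p (points X) \<in> C_G X"
proof -
  have "uniform_limit (points X) (translate X (restrict p (points X)))
         (translate X (restrict p (points X)) g) (at g)" for g
    by (rule iffD1[OF uniform_limit_cong' assms(4)]) (auto simp: gact_closed[OF assms(3)])
  moreover have "continuous_map (gtop X) euclidean (restrict p (points X))"
    by (rule continuous_map_eq[OF assms(1)]) simp
  moreover have "bounded (restrict p (points X) ` points X)"
    using assms(2) by (simp cong: image_cong)
  ultimately show ?thesis
    by (simp add: C_G_def)
qed

lemma C_G_D:
  assumes "p \<in> C_G X"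
  shows "continuous_map (gtop X) euclidean p" "bounded (p ` points X)" "p \<in> extensional (points X)"
    "uniform_limit (points X) (\<lambda>h x. p (gact X h x)) (\<lambda>x. p (gact X g x)) (at g)"
proof -
  have "uniform_limit (points X) (translate X p) (translate X p g) (at g)"
    using assms by (simp add: C_G_def)
  then show "uniform_limit (points X) (\<lambda>h x. p (gact X h x)) (\<lambda>x. p (gact X g x)) (at g)"
    by (rule iffD1[OF uniform_limit_cong', rotated 2]) auto
qed (use assms in \<open>auto simp: C_G_def\<close>)

lemma C_G_const: "is_gspace X \<Longrightarrow> (\<lambda>x\<in>points X. c) \<in> C_G X"
  by (rule C_G_I) (simp_all add: uniform_limit_const image_constant_conv)

lemma C_G_add:
  assumes "is_gspace X" "p \<in> C_G X" "q \<in> C_G X"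
  shows "(\<lambda>x\<in>points X. p x + q x) \<in> C_G X"
proof (rule C_G_I[OF _ _ assms(1)])
  note p = C_G_D[OF assms(2)] and q = C_G_D[OF assms(3)]
  show "continuous_map (gtop X) euclidean (\<lambda>x. p x + q x)"
    by (rule continuous_map_add[OF p(1) q(1)])
  show "bounded ((\<lambda>x. p x + q x) ` points X)"
    by (rule bounded_plus_comp[OF p(2) q(2)])
  show "uniform_limit (points X) (\<lambda>h x. p (gact X h x) + q (gact X h x))
      (\<lambda>x. p (gact X g x) + q (gact X g x)) (at g)" for g
    by (rule uniform_limit_add[OF p(4) q(4)])
qed

lemma C_G_mult:
  assumes "is_gspace X" "p \<in> C_G X" "q \<in> C_G X"
  shows "(\<lambda>x\<in>points X. p x * q x) \<in> C_G X"
proof (rule C_G_I[OF _ _ assms(1)])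
  note p = C_G_D[OF assms(2)] and q = C_G_D[OF assms(3)]
  show "continuous_map (gtop X) euclidean (\<lambda>x. p x * q x)"
    using p(1) q(1) by (simp add: continuous_map_atin tendsto_mult)
  show "bounded ((\<lambda>x. p x * q x) ` points X)"
  proof -
    obtain a b where "\<And>x. x \<in> points X \<Longrightarrow> norm (p x) \<le> a" "\<And>x. x \<in> points X \<Longrightarrow> norm (q x) \<le> b"
      using p(2) q(2) by (auto simp: bounded_iff)
    then have "norm (p x * q x) \<le> a * b" if "x \<in> points X" for x
      using that unfolding norm_mult by (meson mult_mono norm_ge_zero order_trans)
    then show ?thesis
      by (auto simp: bounded_iff)
  qed
  have b: "bounded ((\<lambda>x. r (gact X g x)) ` points X)" if "r \<in> C_G X" for r g
    by (rule bounded_subset[OF C_G_D(2)[OF that]]) (auto simp: gact_closed[OF assms(1)])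
  show "uniform_limit (points X) (\<lambda>h x. p (gact X h x) * q (gact X h x))
      (\<lambda>x. p (gact X g x) * q (gact X g x)) (at g)" for g
    by (rule uniform_lim_mult[OF p(4) q(4) b b]) fact+
qed

lemma C_G_comp:
  fixes F :: "complex \<Rightarrow> complex"
  assumes "is_gspace X" "p \<in> C_G X" "continuous_on C F" "closed C" "p ` points X \<subseteq> C"
  shows "(\<lambda>x\<in>points X. F (p x)) \<in> C_G X"
proof (rule C_G_I[OF _ _ assms(1)])
  note p = C_G_D[OF assms(2)]
  obtain r where r: "p ` points X \<subseteq> cball 0 r"
    using p(2) by (auto simp: bounded_iff subset_iff)
  define B where "B = C \<inter> cball 0 r"
  have B: "compact B"
    using assms(4) by (simp add: B_def closed_Int_compact)
  have pB: "p x \<in> B" if "x \<in> points X" for x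
    using r assms(5) that by (auto simp: B_def)
  have FB: "continuous_on B F"
    using assms(3) by (rule continuous_on_subset) (simp add: B_def)
  have "continuous_map (gtop X) (top_of_set B) p"
    using p(1) pB by (simp add: continuous_map_in_subtopology image_subset_iff)
  moreover have "continuous_map (top_of_set B) euclidean F"
    using FB by simp
  ultimately have "continuous_map (gtop X) euclidean (F \<circ> p)"
    by (rule continuous_map_compose)
  then show "continuous_map (gtop X) euclidean (\<lambda>x. F (p x))"
    by (simp add: o_def)
  have "(\<lambda>x. F (p x)) ` points X \<subseteq> F ` B"
    using pB by blast
  then show "bounded ((\<lambda>x. F (p x)) ` points X)"
    using compact_continuous_image[OF FB B] by (metis bounded_subset compact_imp_bounded)
  show "uniform_limit (points X) (\<lambda>h x. F (p (gact X h x))) (\<lambda>x. F (p (gact X g x))) (at g)" for g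
    by (rule uniform_limit_compose_uniformly_continuous_on[OF p(4) compact_uniformly_continuous[OF FB B]])
       (auto simp: pB gact_closed[OF assms(1)] intro: compact_imp_closed[OF B])
qed

lemma tendsto_left_add_at:
  fixes k :: "'g::{topological_group_add, t2_space}"
  shows "filterlim (\<lambda>h. k + h) (at (k + g)) (at g)"
  unfolding filterlim_at
proof
  show "\<forall>\<^sub>F h in at g. k + h \<in> UNIV \<and> k + h \<noteq> k + g"
    by (simp add: eventually_at_filter)
qed (intro tendsto_intros)

lemma C_G_translate:
  assumes "is_gspace X" "p \<in> C_G X"
  shows "translate X p k \<in> C_G X"
proof -
  note p = C_G_D[OF assms(2)]
  have "restrict (\<lambda>x. p (gact X k x)) (points X) \<in> C_G X"
  proof (rule C_G_I[OF _ _ assms(1)])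
    show "continuous_map (gtop X) euclidean (\<lambda>x. p (gact X k x))"
      using continuous_map_compose[OF gact_continuous[OF assms(1)] p(1)] by (simp add: o_def)
    show "bounded ((\<lambda>x. p (gact X k x)) ` points X)"
      by (rule bounded_subset[OF p(2)]) (auto simp: gact_closed[OF assms(1)])
    fix g
    have "uniform_limit (points X) (\<lambda>h x. p (gact X (k + h) x)) (\<lambda>x. p (gact X (k + g) x)) (at g)"
      by (rule filterlim_compose[OF p(4) tendsto_left_add_at])
    then show "uniform_limit (points X) (\<lambda>h x. p (gact X k (gact X h x)))
       (\<lambda>x. p (gact X k (gact X g x))) (at g)"
      by (rule iffD1[OF uniform_limit_cong', rotated 2]) (auto simp: gact_add[OF assms(1)])
  qed
  then show ?thesis
    by (simp add: translate_def)
qed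

lemma C_G_modulus:
  assumes X: "is_gspace X" and p: "continuous_map (gtop X) euclidean p" "bounded (p ` points X)"
    and \<sigma>: "seminorm \<sigma>"
    and le: "\<And>g x. x \<in> points X \<Longrightarrow> dist (p (gact X g x)) (p x) \<le> \<sigma> g"
  shows "restrict p (points X) \<in> C_G X"
proof (rule C_G_I[OF p X])
  fix g
  show "uniform_limit (points X) (\<lambda>h x. p (gact X h x)) (\<lambda>x. p (gact X g x)) (at g)"
  proof (rule uniform_limitI)
    fix e :: real assume "e > 0"
    have "isCont \<sigma> 0"
      using \<sigma> by (simp add: seminorm_def continuous_on_eq_continuous_at)
    have "((\<lambda>h. h - g) \<longlongrightarrow> g - g) (at g)"
      by (intro tendsto_intros)
    then have "((\<lambda>h. h - g) \<longlongrightarrow> 0) (at g)"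
      by simp
    with \<open>isCont \<sigma> 0\<close> have "((\<lambda>h. \<sigma> (h - g)) \<longlongrightarrow> \<sigma> 0) (at g)"
      by (rule isCont_tendsto_compose)
    then have "\<forall>\<^sub>F h in at g. \<sigma> (h - g) < e"
      using \<sigma> \<open>e > 0\<close> by (auto simp: seminorm_def intro: order_tendstoD)
    then show "\<forall>\<^sub>F h in at g. \<forall>x\<in>points X. dist (p (gact X h x)) (p (gact X g x)) < e"
    proof eventually_elim
      case (elim h)
      show ?case
      proof
        fix x assume x: "x \<in> points X"
        have "gact X h x = gact X (h - g) (gact X g x)"
          using gact_add[OF X x, of "h - g" g] by simp
        then show "dist (p (gact X h x)) (p (gact X g x)) < e"
          using le[OF gact_closed[OF X x], of "h - g" g] elim by simp
      qed
    qed
  qed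
qed

section \<open>Characters\<close>

lemma points_gelfand: "points (gelfand X) = {\<phi> \<in> extensional (C_G X). is_character X \<phi>}"
  by (auto simp: gelfand_def topspace_subtopology PiE_def)

context
  fixes X :: "('g::{topological_group_add, t2_space}, 'x) gspace" and \<phi>
  assumes X: "is_gspace X" and ch: "is_character X \<phi>"
begin

lemma char_add: "p \<in> C_G X \<Longrightarrow> q \<in> C_G X \<Longrightarrow> \<phi> (\<lambda>x\<in>points X. p x + q x) = \<phi> p + \<phi> q"
  and char_scale: "p \<in> C_G X \<Longrightarrow> \<phi> (\<lambda>x\<in>points X. c * p x) = c * \<phi> p"
  and char_mult: "p \<in> C_G X \<Longrightarrow> q \<in> C_G X \<Longrightarrow> \<phi> (\<lambda>x\<in>points X. p x * q x) = \<phi> p * \<phi> q"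
  by (rule ch[unfolded is_character_def, THEN conjunct1, rule_format]
           ch[unfolded is_character_def, THEN conjunct2, THEN conjunct1, rule_format]
           ch[unfolded is_character_def, THEN conjunct2, THEN conjunct2, THEN conjunct1, rule_format]; assumption)+

lemma char_one: "\<phi> (\<lambda>x\<in>points X. 1) = 1"
proof -
  obtain p where p: "p \<in> C_G X" "\<phi> p \<noteq> 0"
    by (rule bexE[OF ch[unfolded is_character_def, THEN conjunct2, THEN conjunct2, THEN conjunct2]])
  have *: "(\<lambda>x\<in>points X. p x * (\<lambda>x\<in>points X. 1) x) = p"
    using C_G_D(3)[OF p(1)] by (intro extensionalityI[where A = "points X"]) auto
  have "\<phi> p = \<phi> p * \<phi> (\<lambda>x\<in>points X. 1)"
    using char_mult[OF p(1) C_G_const[OF X, of 1]] unfolding * .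
  then show ?thesis
    using p(2) by simp
qed

lemma char_const: "\<phi> (\<lambda>x\<in>points X. c) = c"
proof -
  have "(\<lambda>x\<in>points X. c * (\<lambda>x\<in>points X. 1) x) = (\<lambda>x\<in>points X. c)"
    by (rule restrict_ext) simp
  then show ?thesis
    using char_scale[OF C_G_const[OF X, of 1], of c] by (simp only: char_one mult_1_right)
qed

lemma char_zero_not_bounded_below:
  assumes "p \<in> C_G X" "\<phi> p = 0" "d > 0"
  shows "\<exists>x\<in>points X. norm (p x) < d"
proof (rule ccontr)
  assume "\<not> ?thesis"
  then have p: "p ` points X \<subseteq> {w. norm w \<ge> d}"
    by (auto simp: not_less)
  have "closed {w::complex. norm w \<ge> d}"
    by (intro closed_Collect_le continuous_intros)
  moreover have "continuous_on {w::complex. norm w \<ge> d} inverse"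
    using \<open>d > 0\<close> by (intro continuous_intros) auto
  ultimately have q: "(\<lambda>x\<in>points X. inverse (p x)) \<in> C_G X"
    by (intro C_G_comp[OF X assms(1) _ _ p])
  have *: "(\<lambda>x\<in>points X. p x * (\<lambda>x\<in>points X. inverse (p x)) x) = (\<lambda>x\<in>points X. 1)"
    using p \<open>d > 0\<close> by (intro restrict_ext) (auto simp: image_subset_iff intro!: right_inverse)
  show False
    using char_mult[OF assms(1) q] assms(2) unfolding * char_one by simp
qed

text \<open>The sum of the functions \<open>\<bar>p - \<phi> p\<bar>\<^sup>2\<close> is annihilated by \<open>\<phi>\<close>, hence takes small values.\<close>

lemma char_approx:
  assumes "finite J" "J \<subseteq> C_G X" "e > 0"
  shows "\<exists>x\<in>points X. \<forall>p\<in>J. dist (p x) (\<phi> p) < e"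
proof -
  have "\<exists>q\<in>C_G X. \<phi> q = 0 \<and> (\<forall>x\<in>points X. Im (q x) = 0 \<and> Re (q x) \<ge> 0 \<and>
            (\<forall>p\<in>J. (dist (p x) (\<phi> p))\<^sup>2 \<le> Re (q x)))"
    using assms(1,2)
  proof (induction J)
    case empty
    then show ?case
      using C_G_const[OF X, of 0] char_const[of 0]
      by (intro bexI[where x = "\<lambda>x\<in>points X. 0"]) (auto simp del: restrict_apply simp: restrict_apply')
  next
    case (insert p J)
    then obtain q where q: "q \<in> C_G X" "\<phi> q = 0" "\<And>x. x \<in> points X \<Longrightarrow> Im (q x) = 0 \<and> Re (q x) \<ge> 0 \<and>
            (\<forall>p\<in>J. (dist (p x) (\<phi> p))\<^sup>2 \<le> Re (q x))"
      by auto
    have p: "p \<in> C_G X"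
      using insert by simp
    define p1 where "p1 = (\<lambda>x\<in>points X. p x + (\<lambda>x\<in>points X. - \<phi> p) x)"
    have p1: "p1 \<in> C_G X" "\<phi> p1 = 0"
      using C_G_add[OF X p C_G_const[OF X]] char_add[OF p C_G_const[OF X]] char_const
      by (simp_all add: p1_def)
    define p2 where "p2 = (\<lambda>x\<in>points X. cnj (p1 x))"
    have p2: "p2 \<in> C_G X"
      unfolding p2_def by (rule C_G_comp[OF X p1(1), of UNIV]) (auto intro!: continuous_intros)
    define p3 where "p3 = (\<lambda>x\<in>points X. p1 x * p2 x)"
    have p3: "p3 \<in> C_G X" "\<phi> p3 = 0"
      using C_G_mult[OF X p1(1) p2] char_mult[OF p1(1) p2] p1(2) by (auto simp: p3_def)
    have p3x: "p3 x = complex_of_real ((dist (p x) (\<phi> p))\<^sup>2)" if "x \<in> points X" for x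
      using that complex_norm_square[of "p x - \<phi> p"] by (simp add: p3_def p2_def p1_def dist_norm)
    show ?case
    proof (intro bexI conjI ballI)
      show "(\<lambda>x\<in>points X. p3 x + q x) \<in> C_G X"
        by (rule C_G_add[OF X p3(1) q(1)])
      show "\<phi> (\<lambda>x\<in>points X. p3 x + q x) = 0"
        using char_add[OF p3(1) q(1)] p3(2) q(2) by simp
    qed (use q(3) in \<open>auto simp: p3x add_increasing add_increasing2\<close>)
  qed
  then obtain q where q: "q \<in> C_G X" "\<phi> q = 0" and qx: "\<And>x. x \<in> points X \<Longrightarrow> Im (q x) = 0 \<and> Re (q x) \<ge> 0 \<and>
            (\<forall>p\<in>J. (dist (p x) (\<phi> p))\<^sup>2 \<le> Re (q x))"
    by auto
  obtain x where x: "x \<in> points X" "norm (q x) < e\<^sup>2"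
    using char_zero_not_bounded_below[OF q, of "e\<^sup>2"] \<open>e > 0\<close> by auto
  have "dist (p x) (\<phi> p) < e" if "p \<in> J" for p
  proof -
    have "(dist (p x) (\<phi> p))\<^sup>2 < e\<^sup>2"
      using qx[OF x(1)] that x(2) complex_Re_le_cmod[of "q x"] by fastforce
    then show ?thesis
      using \<open>e > 0\<close> by (simp add: power2_less_imp_less)
  qed
  with x(1) show ?thesis
    by auto
qed

lemma char_comp:
  assumes "p \<in> C_G X" "continuous_on UNIV F"
  shows "\<phi> (\<lambda>x\<in>points X. F (p x)) = F (\<phi> p)"
proof -
  have Fp: "(\<lambda>x\<in>points X. F (p x)) \<in> C_G X"
    by (rule C_G_comp[OF X assms(1,2)]) auto
  have "dist (\<phi> (\<lambda>x\<in>points X. F (p x))) (F (\<phi> p)) \<le> e" if e: "e > 0" for e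
  proof -
    have "isCont F (\<phi> p)"
      using assms(2) by (simp add: continuous_on_eq_continuous_at)
    then obtain d where d: "d > 0" "\<And>w. dist w (\<phi> p) < d \<Longrightarrow> dist (F w) (F (\<phi> p)) < e / 2"
      using e unfolding continuous_at_eps_delta by (meson half_gt_zero)
    obtain x where x: "x \<in> points X" "\<forall>q\<in>{p, \<lambda>x\<in>points X. F (p x)}. dist (q x) (\<phi> q) < min d (e/2)"
      using char_approx[of "{p, \<lambda>x\<in>points X. F (p x)}" "min d (e/2)"] assms(1) Fp e d(1) by auto
    then have "dist (F (p x)) (F (\<phi> p)) < e / 2" "dist (F (p x)) (\<phi> (\<lambda>x\<in>points X. F (p x))) < e / 2"
      using d(2) by auto
    then show ?thesis
      by (smt (verit) dist_commute dist_triangle_half_r)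
  qed
  then show ?thesis
    by (metis dense_ge dist_le_zero_iff)
qed

end

section \<open>Ultrafilters and limits of evaluations\<close>

lemma ultrafilters_onD:
  assumes "\<U> \<in> ultrafilters_on I"
  shows "\<U> \<noteq> bot" "eventually (\<lambda>i. i \<in> I) \<U>"
    "\<not> eventually P \<U> \<longleftrightarrow> eventually (\<lambda>i. \<not> P i) \<U>"
proof -
  show "\<U> \<noteq> bot" "eventually (\<lambda>i. i \<in> I) \<U>"
    using assms by (simp_all add: ultrafilters_on_def le_principal)
  then show "\<not> eventually P \<U> \<longleftrightarrow> eventually (\<lambda>i. \<not> P i) \<U>"
    using assms eventually_conj[of P \<U> "\<lambda>i. \<not> P i"] eventually_False[of \<U>]
    by (auto simp: ultrafilters_on_def)
qed

lemma ultrafilters_on_eqI: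
  assumes "\<U> \<in> ultrafilters_on I" "\<V> \<in> ultrafilters_on I"
    and "\<And>P. eventually P \<U> \<Longrightarrow> eventually P \<V>"
  shows "\<U> = \<V>"
  unfolding filter_eq_iff using ultrafilters_onD(3)[OF assms(1)] ultrafilters_onD(3)[OF assms(2)] assms(3) by blast

lemma ultrafilter_finite_Bex:
  assumes "\<U> \<in> ultrafilters_on I" "finite F" "eventually (\<lambda>i. \<exists>x\<in>F. P x i) \<U>"
  shows "\<exists>x\<in>F. eventually (P x) \<U>"
proof (rule ccontr)
  assume "\<not> ?thesis"
  then have "\<forall>x\<in>F. eventually (\<lambda>i. \<not> P x i) \<U>"
    using ultrafilters_onD(3)[OF assms(1)] by blast
  then have "eventually (\<lambda>i. \<forall>x\<in>F. \<not> P x i) \<U>"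
    using assms(2) by (simp add: eventually_ball_finite)
  with assms(3) have "eventually (\<lambda>i. False) \<U>"
    by eventually_elim blast
  then show False
    using ultrafilters_onD(1)[OF assms(1)] by simp
qed

lemma ultrafilter_tendsto_compact:
  assumes "\<U> \<in> ultrafilters_on I" "compact K" "eventually (\<lambda>i. f i \<in> K) \<U>"
  shows "\<exists>l\<in>K. (f \<longlongrightarrow> l) \<U>"
proof -
  have "filtermap f \<U> \<noteq> bot" "eventually (\<lambda>x. x \<in> K) (filtermap f \<U>)"
    using assms(3) ultrafilters_onD(1)[OF assms(1)] by (auto simp: filtermap_bot_iff eventually_filtermap)
  then obtain l where l: "l \<in> K" "inf (nhds l) (filtermap f \<U>) \<noteq> bot"
    using assms(2) unfolding compact_filter by blast
  have "(f \<longlongrightarrow> l) \<U>"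
  proof (rule topological_tendstoI)
    fix S assume S: "open S" "l \<in> S"
    show "eventually (\<lambda>i. f i \<in> S) \<U>"
    proof (rule ccontr)
      assume "\<not> ?thesis"
      then have "eventually (\<lambda>i. f i \<notin> S) \<U>"
        by (simp add: ultrafilters_onD(3)[OF assms(1)])
      then have "eventually (\<lambda>x. x \<notin> S) (filtermap f \<U>)"
        by (simp add: eventually_filtermap)
      moreover have "eventually (\<lambda>x. x \<in> S) (nhds l)"
        using S by (simp add: eventually_nhds) blast
      ultimately have "eventually (\<lambda>x. False) (inf (nhds l) (filtermap f \<U>))"
        unfolding eventually_inf by blast
      then show False
        using l(2) by simp
    qed
  qed
  with l(1) show ?thesis
    by blast
qed

definition limit_char ::
  "'i filter \<Rightarrow> ('g::{topological_group_add, t2_space}, 'x) gspace \<Rightarrow> ('i \<Rightarrow> 'x)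
    \<Rightarrow> ('x \<Rightarrow> complex) \<Rightarrow> complex" where
  "limit_char \<U> X f = (\<lambda>p\<in>C_G X. Lim \<U> (\<lambda>i. p (f i)))"

lemma limit_char_eq:
  assumes "\<U> \<in> ultrafilters_on I" "p \<in> C_G X" "((\<lambda>i. p (f i)) \<longlongrightarrow> a) \<U>"
  shows "limit_char \<U> X f p = a"
  using assms(2) tendsto_Lim[OF ultrafilters_onD(1)[OF assms(1)] assms(3)] by (simp add: limit_char_def)

lemma tendsto_limit_char:
  assumes "\<U> \<in> ultrafilters_on I" "eventually (\<lambda>i. f i \<in> points X) \<U>" "p \<in> C_G X"
  shows "((\<lambda>i. p (f i)) \<longlongrightarrow> limit_char \<U> X f p) \<U>"
proof -
  obtain r where r: "\<And>x. x \<in> points X \<Longrightarrow> norm (p x) \<le> r"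
    using C_G_D(2)[OF assms(3)] by (auto simp: bounded_iff)
  have "eventually (\<lambda>i. p (f i) \<in> cball 0 r) \<U>"
    using assms(2) by eventually_elim (simp add: r)
  then obtain l where "((\<lambda>i. p (f i)) \<longlongrightarrow> l) \<U>"
    using ultrafilter_tendsto_compact[OF assms(1) compact_cball, of "\<lambda>i. p (f i)"] by blast
  then show ?thesis
    using limit_char_eq[OF assms(1,3)] by metis
qed

lemma limit_char_cong:
  assumes "\<U> \<in> ultrafilters_on I" "p \<in> C_G X"
    and "eventually (\<lambda>i. f i \<in> points X) \<U>" "eventually (\<lambda>i. p (f i) = F i) \<U>"
  shows "(F \<longlongrightarrow> limit_char \<U> X f p) \<U>"
  using tendsto_limit_char[OF assms(1,3,2)] assms(4) by (rule Lim_transform_eventually)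

lemma limit_char_gelfand:
  assumes X: "is_gspace X" and U: "\<U> \<in> ultrafilters_on I" and f: "eventually (\<lambda>i. f i \<in> points X) \<U>"
  shows "limit_char \<U> X f \<in> points (gelfand X)"
proof -
  have lim: "limit_char \<U> X f (restrict q (points X)) = a"
    if "restrict q (points X) \<in> C_G X" "((\<lambda>i. q (f i)) \<longlongrightarrow> a) \<U>" for q a
  proof (rule limit_char_eq[OF U that(1)])
    show "((\<lambda>i. restrict q (points X) (f i)) \<longlongrightarrow> a) \<U>"
      by (rule Lim_transform_eventually[OF that(2)]) (use f in eventually_elim, simp)
  qed
  note t = tendsto_limit_char[OF U f]
  have "is_character X (limit_char \<U> X f)"
    unfolding is_character_def
  proof (intro conjI ballI allI)
    fix p q assume p: "p \<in> C_G X" and q: "q \<in> C_G X"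
    show "limit_char \<U> X f (\<lambda>x\<in>points X. p x + q x) = limit_char \<U> X f p + limit_char \<U> X f q"
      by (rule lim[OF C_G_add[OF X p q] tendsto_add[OF t[OF p] t[OF q]]])
    show "limit_char \<U> X f (\<lambda>x\<in>points X. p x * q x) = limit_char \<U> X f p * limit_char \<U> X f q"
      by (rule lim[OF C_G_mult[OF X p q] tendsto_mult[OF t[OF p] t[OF q]]])
  next
    fix p c assume p: "p \<in> C_G X"
    have "(\<lambda>x\<in>points X. c * p x) \<in> C_G X"
      by (rule C_G_comp[OF X p, of UNIV "\<lambda>w. c * w"]) (auto intro!: continuous_intros)
    then show "limit_char \<U> X f (\<lambda>x\<in>points X. c * p x) = c * limit_char \<U> X f p"
      by (rule lim[OF _ tendsto_mult_left[OF t[OF p]]])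
  next
    show "\<exists>p\<in>C_G X. limit_char \<U> X f p \<noteq> 0"
      using lim[OF C_G_const[OF X] tendsto_const] C_G_const[OF X, of 1] by (intro bexI) auto
  qed
  then show ?thesis
    by (simp add: points_gelfand limit_char_def)
qed

section \<open>The Gelfand space\<close>

lemma gelfandD: "\<phi> \<in> points (gelfand X) \<Longrightarrow> is_character X \<phi>"
  by (simp add: points_gelfand)

lemma gact_gelfand: "p \<in> C_G X \<Longrightarrow> gact (gelfand X) g \<phi> p = \<phi> (translate X p g)"
  by (simp add: gelfand_def)

lemma gact_gelfand_closed:
  assumes X: "is_gspace X" and \<phi>: "\<phi> \<in> points (gelfand X)"
  shows "gact (gelfand X) g \<phi> \<in> points (gelfand X)"
proof -
  have ch: "is_character X \<phi>"
    by (rule gelfandD[OF \<phi>])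
  note g = gact_closed[OF X, of _ g] and T = C_G_translate[OF X, of _ g]
  have tr: "translate X (restrict q (points X)) g = (\<lambda>x\<in>points X. q (gact X g x))" for q
    unfolding translate_def by (rule restrict_ext) (simp add: g)
  have "is_character X (gact (gelfand X) g \<phi>)"
    unfolding is_character_def
  proof (intro conjI ballI allI)
    fix p q assume p: "p \<in> C_G X" and q: "q \<in> C_G X"
    have "translate X (\<lambda>x\<in>points X. p x + q x) g
        = (\<lambda>x\<in>points X. translate X p g x + translate X q g x)"
      unfolding tr by (rule restrict_ext) simp
    then show "gact (gelfand X) g \<phi> (\<lambda>x\<in>points X. p x + q x)
        = gact (gelfand X) g \<phi> p + gact (gelfand X) g \<phi> q"
      using char_add[OF X ch T[OF p] T[OF q]]
      by (simp only: gact_gelfand[OF C_G_add[OF X p q]] gact_gelfand[OF p] gact_gelfand[OF q])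
    have "translate X (\<lambda>x\<in>points X. p x * q x) g
        = (\<lambda>x\<in>points X. translate X p g x * translate X q g x)"
      unfolding tr by (rule restrict_ext) simp
    then show "gact (gelfand X) g \<phi> (\<lambda>x\<in>points X. p x * q x)
        = gact (gelfand X) g \<phi> p * gact (gelfand X) g \<phi> q"
      using char_mult[OF X ch T[OF p] T[OF q]]
      by (simp only: gact_gelfand[OF C_G_mult[OF X p q]] gact_gelfand[OF p] gact_gelfand[OF q])
  next
    fix p c assume p: "p \<in> C_G X"
    have cp: "(\<lambda>x\<in>points X. c * p x) \<in> C_G X"
      by (rule C_G_comp[OF X p, of UNIV "\<lambda>w. c * w"]) (auto intro!: continuous_intros)
    have "translate X (\<lambda>x\<in>points X. c * p x) g = (\<lambda>x\<in>points X. c * translate X p g x)"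
      unfolding tr by (rule restrict_ext) simp
    then show "gact (gelfand X) g \<phi> (\<lambda>x\<in>points X. c * p x) = c * gact (gelfand X) g \<phi> p"
      using char_scale[OF X ch T[OF p], of c]
      by (simp only: gact_gelfand[OF cp] gact_gelfand[OF p])
  next
    have "gact (gelfand X) g \<phi> (\<lambda>x\<in>points X. 1) = 1"
      unfolding gact_gelfand[OF C_G_const[OF X]] tr by (rule char_one[OF X ch])
    then show "\<exists>p\<in>C_G X. gact (gelfand X) g \<phi> p \<noteq> 0"
      using C_G_const[OF X, of 1] by (intro bexI) auto
  qed
  then show ?thesis
    by (simp add: points_gelfand gelfand_def)
qed

lemma gact_limit_char:
  assumes X: "is_gspace X" and U: "\<U> \<in> ultrafilters_on I" and f: "eventually (\<lambda>i. f i \<in> points X) \<U>"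
  shows "gact (gelfand X) g (limit_char \<U> X f) = limit_char \<U> X (\<lambda>i. gact X g (f i))"
proof (rule extensionalityI[where A = "C_G X"])
  fix p assume p: "p \<in> C_G X"
  have "((\<lambda>i. p (gact X g (f i))) \<longlongrightarrow> limit_char \<U> X f (translate X p g)) \<U>"
    by (rule limit_char_cong[OF U C_G_translate[OF X p] f]) (use f in eventually_elim, simp)
  then show "gact (gelfand X) g (limit_char \<U> X f) p = limit_char \<U> X (\<lambda>i. gact X g (f i)) p"
    using limit_char_eq[OF U p] by (simp add: gact_gelfand[OF p])
qed (simp_all add: gelfand_def limit_char_def)

lemma char_in_closed:
  assumes "is_gspace X" "is_character X \<phi>" "p \<in> C_G X" "closed C" "p ` points X \<subseteq> C"
  shows "\<phi> p \<in> C"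
proof -
  have "\<phi> p \<in> closure C"
    unfolding closure_approachable using char_approx[OF assms(1,2), of "{p}"] assms(3,5) by fastforce
  then show ?thesis
    using assms(4) by simp
qed

lemma continuous_map_gelfand_apply:
  "p \<in> C_G X \<Longrightarrow> continuous_map (gtop (gelfand X)) euclidean (\<lambda>\<phi>. \<phi> p)"
  unfolding gelfand_def
  using continuous_map_from_subtopology[OF continuous_map_product_projection] by force

lemma compact_gelfand:
  fixes X :: "('g::{topological_group_add, t2_space}, 'x) gspace"
  assumes X: "is_gspace X"
  shows "compact_space (gtop (gelfand X))"
proof -
  define T :: "(('x \<Rightarrow> complex) \<Rightarrow> complex) topology"
    where "T = product_topology (\<lambda>_. euclidean) (C_G X)"
  have topT: "topspace T = extensional (C_G X)"
    by (simp add: T_def PiE_def)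
  have cl: "closedin T {\<phi> \<in> topspace T. \<forall>k\<in>K. F k \<phi> = G k \<phi>}"
    if "\<And>k. k \<in> K \<Longrightarrow> continuous_map T euclidean (F k)" "\<And>k. k \<in> K \<Longrightarrow> continuous_map T euclidean (G k)"
    for F G :: "'k \<Rightarrow> _ \<Rightarrow> complex" and K
  proof -
    have "\<forall>k\<in>K. closedin T {\<phi> \<in> topspace T. F k \<phi> - G k \<phi> \<in> {0}}"
      by (intro ballI closedin_continuous_map_preimage[OF continuous_map_diff]) (use that in simp_all)
    then have "closedin T (\<Inter> (insert (topspace T) ((\<lambda>k. {\<phi> \<in> topspace T. F k \<phi> - G k \<phi> \<in> {0}}) ` K)))"
      by (intro closedin_Inter) (auto simp del: Diff_iff)
    moreover have "\<Inter> (insert (topspace T) ((\<lambda>k. {\<phi> \<in> topspace T. F k \<phi> - G k \<phi> \<in> {0}}) ` K))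
        = {\<phi> \<in> topspace T. \<forall>k\<in>K. F k \<phi> = G k \<phi>}"
      by auto
    ultimately show ?thesis
      by simp
  qed
  have pr: "continuous_map T euclidean (\<lambda>\<phi>. \<phi> p)" if "p \<in> C_G X" for p
    unfolding T_def using that by (rule continuous_map_product_projection)
  have cm: "continuous_map T euclidean (\<lambda>\<phi>. F \<phi> * G \<phi>)"
    if "continuous_map T euclidean F" "continuous_map T euclidean G" for F G :: "_ \<Rightarrow> complex"
    using that by (simp add: continuous_map_atin tendsto_mult)
  have sc: "(\<lambda>x\<in>points X. c * p x) \<in> C_G X" if "p \<in> C_G X" for p c
    by (rule C_G_comp[OF X that, of UNIV "\<lambda>w. c * w"]) (auto intro!: continuous_intros)
  let ?A = "{\<phi> \<in> topspace T. \<forall>k\<in>C_G X \<times> C_G X. \<phi> (\<lambda>x\<in>points X. fst k x + snd k x) = \<phi> (fst k) + \<phi> (snd k)}"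
  let ?B = "{\<phi> \<in> topspace T. \<forall>k\<in>C_G X \<times> UNIV. \<phi> (\<lambda>x\<in>points X. snd k * fst k x) = snd k * \<phi> (fst k)}"
  let ?C = "{\<phi> \<in> topspace T. \<forall>k\<in>C_G X \<times> C_G X. \<phi> (\<lambda>x\<in>points X. fst k x * snd k x) = \<phi> (fst k) * \<phi> (snd k)}"
  let ?D = "{\<phi> \<in> topspace T. \<forall>k\<in>{\<lambda>x\<in>points X. 1}. \<phi> k = 1}"
  have "closedin T (?A \<inter> ?B \<inter> ?C \<inter> ?D)"
  proof (intro closedin_Int)
    show "closedin T ?A"
    proof (rule cl)
      fix k assume "k \<in> C_G X \<times> C_G X"
      then have k: "fst k \<in> C_G X" "snd k \<in> C_G X"
        by auto
      show "continuous_map T euclidean (\<lambda>\<phi>. \<phi> (\<lambda>x\<in>points X. fst k x + snd k x))"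
        by (rule pr[OF C_G_add[OF X k]])
      show "continuous_map T euclidean (\<lambda>\<phi>. \<phi> (fst k) + \<phi> (snd k))"
        by (rule continuous_map_add[OF pr[OF k(1)] pr[OF k(2)]])
    qed
    show "closedin T ?B"
    proof (rule cl)
      fix k :: "('x \<Rightarrow> complex) \<times> complex" assume "k \<in> C_G X \<times> UNIV"
      then have k: "fst k \<in> C_G X"
        by auto
      show "continuous_map T euclidean (\<lambda>\<phi>. \<phi> (\<lambda>x\<in>points X. snd k * fst k x))"
        by (rule pr[OF sc[OF k]])
      show "continuous_map T euclidean (\<lambda>\<phi>. snd k * \<phi> (fst k))"
        by (rule cm[OF _ pr[OF k]]) simp
    qed
    show "closedin T ?C"
    proof (rule cl)
      fix k assume "k \<in> C_G X \<times> C_G X"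
      then have k: "fst k \<in> C_G X" "snd k \<in> C_G X"
        by auto
      show "continuous_map T euclidean (\<lambda>\<phi>. \<phi> (\<lambda>x\<in>points X. fst k x * snd k x))"
        by (rule pr[OF C_G_mult[OF X k]])
      show "continuous_map T euclidean (\<lambda>\<phi>. \<phi> (fst k) * \<phi> (snd k))"
        by (rule cm[OF pr[OF k(1)] pr[OF k(2)]])
    qed
    show "closedin T ?D"
    proof (rule cl)
      fix k assume "k \<in> {\<lambda>x\<in>points X. 1 :: complex}"
      then have k: "k \<in> C_G X"
        using C_G_const[OF X, of 1] by blast
      show "continuous_map T euclidean (\<lambda>\<phi>. \<phi> k)"
        by (rule pr[OF k])
    qed simp
  qed
  moreover have "points (gelfand X) = ?A \<inter> ?B \<inter> ?C \<inter> ?D"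
  proof (intro set_eqI iffI)
    fix \<phi> assume \<phi>: "\<phi> \<in> points (gelfand X)"
    have t: "\<phi> \<in> topspace T"
      using \<phi> by (simp add: points_gelfand topT)
    note c = gelfandD[OF \<phi>]
    show "\<phi> \<in> ?A \<inter> ?B \<inter> ?C \<inter> ?D"
      by (intro IntI CollectI conjI t ballI char_add[OF X c] char_scale[OF X c] char_mult[OF X c])
         (simp_all only: mem_Times_iff singleton_iff char_one[OF X c])
  next
    fix \<phi> assume \<phi>: "\<phi> \<in> ?A \<inter> ?B \<inter> ?C \<inter> ?D"
    then have abcd: "\<phi> \<in> ?A" "\<phi> \<in> ?B" "\<phi> \<in> ?C" "\<phi> \<in> ?D"
      by (simp_all only: Int_iff)
    note a = bspec[OF conjunct2[OF CollectD[OF abcd(1)]]] and b = bspec[OF conjunct2[OF CollectD[OF abcd(2)]]]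
      and c = bspec[OF conjunct2[OF CollectD[OF abcd(3)]]] and d = bspec[OF conjunct2[OF CollectD[OF abcd(4)]]]
    have 1: "\<phi> (\<lambda>x\<in>points X. 1) = 1"
      by (rule d) (rule singletonI)
    have "is_character X \<phi>"
      unfolding is_character_def
    proof (intro conjI ballI allI)
      fix p q assume pq: "p \<in> C_G X" "q \<in> C_G X"
      show "\<phi> (\<lambda>x\<in>points X. p x + q x) = \<phi> p + \<phi> q"
        using a[OF SigmaI[OF pq]] by (simp only: fst_conv snd_conv)
      show "\<phi> (\<lambda>x\<in>points X. p x * q x) = \<phi> p * \<phi> q"
        using c[OF SigmaI[OF pq]] by (simp only: fst_conv snd_conv)
    next
      fix p c assume p: "p \<in> C_G X"
      show "\<phi> (\<lambda>x\<in>points X. c * p x) = c * \<phi> p"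
        using b[OF SigmaI[OF p UNIV_I[of c]]] by (simp only: fst_conv snd_conv)
    next
      show "\<exists>p\<in>C_G X. \<phi> p \<noteq> 0"
        using 1 by (intro bexI[OF _ C_G_const[OF X, of 1]]) simp
    qed
    moreover have "\<phi> \<in> extensional (C_G X)"
      using conjunct1[OF CollectD[OF abcd(1)]] unfolding topT .
    ultimately show "\<phi> \<in> points (gelfand X)"
      unfolding points_gelfand by (intro CollectI conjI)
  qed
  ultimately have W: "closedin T (points (gelfand X))"
    by simp
  define r where "r p = (SOME r. \<forall>x\<in>points X. norm (p x) \<le> r)" for p :: "'x \<Rightarrow> complex"
  have r: "norm (p x) \<le> r p" if "p \<in> C_G X" "x \<in> points X" for p x
  proof -
    have "\<exists>r. \<forall>x\<in>points X. norm (p x) \<le> r"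
      using C_G_D(2)[OF that(1)] by (auto simp: bounded_iff)
    from someI_ex[OF this] show ?thesis
      using that(2) by (simp add: r_def)
  qed
  have "compactin T (PiE (C_G X) (\<lambda>p. cball 0 (r p)))"
    by (simp add: T_def compactin_PiE)
  moreover have "points (gelfand X) \<subseteq> PiE (C_G X) (\<lambda>p. cball 0 (r p))"
  proof
    fix \<phi> assume \<phi>: "\<phi> \<in> points (gelfand X)"
    have "\<phi> p \<in> cball 0 (r p)" if "p \<in> C_G X" for p
      by (rule char_in_closed[OF X gelfandD[OF \<phi>] that closed_cball]) (auto simp: r that)
    then show "\<phi> \<in> PiE (C_G X) (\<lambda>p. cball 0 (r p))"
      using \<phi> by (auto simp: points_gelfand PiE_def)
  qed
  ultimately have "compactin T (points (gelfand X))"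
    using W by (rule closed_compactin)
  then have "compact_space (subtopology T (points (gelfand X)))"
    by (rule compact_space_subtopology)
  moreover have "gtop (gelfand X) = subtopology T (points (gelfand X))"
    unfolding points_gelfand T_def by (simp add: gelfand_def)
  ultimately show ?thesis
    by simp
qed

lemma gelfand_nbhd:
  fixes X :: "('g::{topological_group_add, t2_space}, 'x) gspace"
  assumes X: "is_gspace X" and \<Omega>: "openin (gtop (gelfand X)) \<Omega>" and z: "z \<in> \<Omega>"
  shows "\<exists>s\<in>C_G X. z s = 1 \<and> s ` points X \<subseteq> complex_of_real ` {0..1}
     \<and> (\<forall>\<phi>\<in>points (gelfand X). \<phi> s \<noteq> 0 \<longrightarrow> \<phi> \<in> \<Omega>)"
proof -
  let ?T = "product_topology (\<lambda>_. euclidean) (C_G X) :: (('x \<Rightarrow> complex) \<Rightarrow> complex) topology"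
  have zW: "z \<in> points (gelfand X)"
    using openin_subset[OF \<Omega>] z by blast
  obtain S where S: "openin ?T S" "\<Omega> = S \<inter> points (gelfand X)"
    using \<Omega> unfolding points_gelfand by (auto simp: gelfand_def openin_subtopology)
  then obtain U where U: "finite {p \<in> C_G X. U p \<noteq> UNIV}" "\<And>p. p \<in> C_G X \<Longrightarrow> open (U p)"
      "z \<in> PiE (C_G X) U" "PiE (C_G X) U \<subseteq> S"
    using z unfolding openin_product_topology_alt by (auto simp: Ball_def)
  let ?J = "{p \<in> C_G X. U p \<noteq> UNIV}"
  have "\<exists>s\<in>C_G X. z s = 1 \<and> s ` points X \<subseteq> complex_of_real ` {0..1}
     \<and> (\<forall>\<phi>\<in>points (gelfand X). \<phi> s \<noteq> 0 \<longrightarrow> (\<forall>p\<in>J. \<phi> p \<in> U p))" if "finite J" "J \<subseteq> C_G X" for J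
    using that
  proof (induction J)
    case empty
    have "(\<lambda>x\<in>points X. 1) ` points X \<subseteq> complex_of_real ` {0..1}"
      by (auto intro: image_eqI[where x = 1])
    then show ?case
      using C_G_const[OF X, of 1] char_one[OF X gelfandD[OF zW]] by blast
  next
    case (insert p J)
    then obtain s where s: "s \<in> C_G X" "z s = 1" "s ` points X \<subseteq> complex_of_real ` {0..1}"
        "\<And>\<phi>. \<phi> \<in> points (gelfand X) \<Longrightarrow> \<phi> s \<noteq> 0 \<Longrightarrow> \<forall>p\<in>J. \<phi> p \<in> U p"
      by auto
    have p: "p \<in> C_G X"
      using insert by simp
    have "z p \<in> U p"
      using U(3) p by blast
    then obtain e where e: "e > 0" "ball (z p) e \<subseteq> U p"
      using U(2)[OF p] openE by blast
    define F where "F w = complex_of_real (max 0 (1 - dist (z p) w / e))" for w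
    have F: "continuous_on UNIV F"
      unfolding F_def using e(1) by (intro continuous_intros) auto
    have F01: "F w \<in> complex_of_real ` {0..1}" for w
      unfolding F_def using e(1) by (intro imageI) auto
    have FU: "w \<in> U p" if "F w \<noteq> 0" for w
    proof -
      have "dist (z p) w < e"
        using that e(1) by (simp add: F_def field_simps max_def split: if_splits)
      then show ?thesis
        using e(2) by auto
    qed
    let ?t = "\<lambda>x\<in>points X. F (p x)"
    have t: "?t \<in> C_G X"
      by (rule C_G_comp[OF X p F]) auto
    have m: "\<phi> (\<lambda>x\<in>points X. s x * ?t x) = \<phi> s * F (\<phi> p)" if "\<phi> \<in> points (gelfand X)" for \<phi>
      using char_mult[OF X gelfandD[OF that] s(1) t] char_comp[OF X gelfandD[OF that] p F] by (simp only:)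
    show ?case
    proof (intro bexI conjI ballI impI)
      show "(\<lambda>x\<in>points X. s x * ?t x) \<in> C_G X"
        by (rule C_G_mult[OF X s(1) t])
      show "z (\<lambda>x\<in>points X. s x * ?t x) = 1"
        unfolding m[OF zW] s(2) by (simp add: F_def)
      show "(\<lambda>x\<in>points X. s x * ?t x) ` points X \<subseteq> complex_of_real ` {0..1}"
      proof (rule image_subsetI)
        fix x assume x: "x \<in> points X"
        obtain a b where "s x = complex_of_real a" "a \<in> {0..1}" "F (p x) = complex_of_real b" "b \<in> {0..1}"
          using s(3) x F01[of "p x"] by (auto simp: image_subset_iff)
        then show "(\<lambda>x\<in>points X. s x * ?t x) x \<in> complex_of_real ` {0..1}"
          using x by (intro image_eqI[where x = "a * b"]) (auto simp: mult_le_one)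
      qed
      fix \<phi> q assume \<phi>: "\<phi> \<in> points (gelfand X)" "\<phi> (\<lambda>x\<in>points X. s x * ?t x) \<noteq> 0" "q \<in> insert p J"
      then have "\<phi> s \<noteq> 0" "F (\<phi> p) \<noteq> 0"
        using m[OF \<phi>(1)] by auto
      then show "\<phi> q \<in> U q"
        using s(4)[OF \<phi>(1)] FU \<phi>(3) by blast
    qed
  qed
  from this[OF U(1)] obtain s where "s \<in> C_G X" and "z s = 1 \<and> s ` points X \<subseteq> complex_of_real ` {0..1}
     \<and> (\<forall>\<phi>\<in>points (gelfand X). \<phi> s \<noteq> 0 \<longrightarrow> (\<forall>p\<in>?J. \<phi> p \<in> U p))"
    by (rule bexE) auto
  then have s: "s \<in> C_G X" "z s = 1" "s ` points X \<subseteq> complex_of_real ` {0..1}"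
      "\<And>\<phi>. \<phi> \<in> points (gelfand X) \<Longrightarrow> \<phi> s \<noteq> 0 \<Longrightarrow> \<forall>p\<in>?J. \<phi> p \<in> U p"
    by blast+
  have "\<phi> \<in> \<Omega>" if \<phi>: "\<phi> \<in> points (gelfand X)" "\<phi> s \<noteq> 0" for \<phi>
  proof -
    have "\<phi> \<in> PiE (C_G X) U"
      using s(4)[OF \<phi>] \<phi>(1) by (auto simp: points_gelfand PiE_def)
    then show ?thesis
      using U(4) S(2) \<phi>(1) by blast
  qed
  with s(1-3) show ?thesis
    by blast
qed

lemma evaluation_gelfand:
  assumes X: "is_gspace X" and x: "x \<in> points X"
  shows "evaluation X x \<in> points (gelfand X)"
proof -
  have ev: "evaluation X x (restrict q (points X)) = q x" if "restrict q (points X) \<in> C_G X" for q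
    using that x by (simp add: evaluation_def)
  have ev': "evaluation X x p = p x" if "p \<in> C_G X" for p
    using that by (simp add: evaluation_def)
  have "is_character X (evaluation X x)"
    unfolding is_character_def
  proof (intro conjI ballI allI)
    fix p q assume p: "p \<in> C_G X" and q: "q \<in> C_G X"
    show "evaluation X x (\<lambda>x\<in>points X. p x + q x) = evaluation X x p + evaluation X x q"
      unfolding ev[OF C_G_add[OF X p q]] ev'[OF p] ev'[OF q] ..
    show "evaluation X x (\<lambda>x\<in>points X. p x * q x) = evaluation X x p * evaluation X x q"
      unfolding ev[OF C_G_mult[OF X p q]] ev'[OF p] ev'[OF q] ..
  next
    fix p c assume p: "p \<in> C_G X"
    have "(\<lambda>x\<in>points X. c * p x) \<in> C_G X"
      by (rule C_G_comp[OF X p, of UNIV "\<lambda>w. c * w"]) (auto intro!: continuous_intros)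
    from ev[OF this] show "evaluation X x (\<lambda>x\<in>points X. c * p x) = c * evaluation X x p"
      unfolding ev'[OF p] .
  next
    show "\<exists>p\<in>C_G X. evaluation X x p \<noteq> 0"
      by (rule bexI[OF _ C_G_const[OF X, of 1]]) (simp add: ev[OF C_G_const[OF X]])
  qed
  then show ?thesis
    by (simp add: points_gelfand evaluation_def)
qed

section \<open>Ultracopowers\<close>

lemma points_copies [simp]: "points (copies I Y) = I \<times> points Y"
  by (simp add: copies_def)

lemma gact_copies [simp]: "gact (copies I Y) g (i, y) = (i, gact Y g y)"
  by (simp add: copies_def)

lemma is_gspace_copies:
  fixes Y :: "('g::{topological_group_add, t2_space}, 'y) gspace" and I :: "'i set"
  assumes Y: "is_gspace Y"
  shows "is_gspace (copies I Y)"
proof -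
  have "Hausdorff_space (gtop (copies I Y))"
    using Y by (simp add: copies_def is_gspace_def Hausdorff_space_prod_topology Hausdorff_space_discrete_topology)
  moreover have "continuous_map (prod_topology euclidean (gtop (copies I Y))) (gtop (copies I Y))
      (\<lambda>(g, x). gact (copies I Y) g x)"
  proof -
    let ?P = "prod_topology euclidean (prod_topology (discrete_topology I) (gtop Y)) :: ('g \<times> 'i \<times> 'y) topology"
    have 1: "continuous_map ?P (discrete_topology I) (fst \<circ> snd)"
      by (rule continuous_map_compose[OF continuous_map_snd continuous_map_fst])
    have 2: "continuous_map ?P (gtop Y) (snd \<circ> snd)"
      by (rule continuous_map_compose[OF continuous_map_snd continuous_map_snd])
    have "continuous_map ?P (prod_topology euclidean (gtop Y)) (\<lambda>z. (fst z, (snd \<circ> snd) z))"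
      using 2 continuous_map_fst by (simp add: continuous_map_pairwise o_def)
    moreover have "continuous_map (prod_topology euclidean (gtop Y)) (gtop Y) (\<lambda>(g, y). gact Y g y)"
      using Y by (simp add: is_gspace_def)
    ultimately have "continuous_map ?P (gtop Y) ((\<lambda>(g, y). gact Y g y) \<circ> (\<lambda>z. (fst z, (snd \<circ> snd) z)))"
      by (rule continuous_map_compose)
    with 1 show ?thesis
      by (simp add: copies_def continuous_map_pairwise o_def case_prod_unfold)
  qed
  moreover have "\<forall>z\<in>points (copies I Y). gact (copies I Y) 0 z = z"
    by (auto simp: gact_zero[OF Y])
  moreover have "\<forall>g h. \<forall>z\<in>points (copies I Y).
      gact (copies I Y) (g + h) z = gact (copies I Y) g (gact (copies I Y) h z)"
    by (auto simp: gact_add[OF Y])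
  ultimately show ?thesis
    unfolding is_gspace_def by blast
qed

definition copy_indicator :: "'i set \<Rightarrow> ('g, 'y) gspace \<Rightarrow> ('i \<Rightarrow> bool) \<Rightarrow> 'i \<times> 'y \<Rightarrow> complex" where
  "copy_indicator I Y P = (\<lambda>z\<in>points (copies I Y). if P (fst z) then 1 else 0)"

lemma seminorm_zero: "seminorm (\<lambda>_. 0)"
  by (simp add: seminorm_def)

lemma continuous_map_copies:
  "continuous_map (gtop (copies I Y)) T p \<longleftrightarrow> (\<forall>i\<in>I. continuous_map (gtop Y) T (\<lambda>y. p (i, y)))"
proof
  assume p: "continuous_map (gtop (copies I Y)) T p"
  show "\<forall>i\<in>I. continuous_map (gtop Y) T (\<lambda>y. p (i, y))"
  proof
    fix i assume "i \<in> I"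
    then have "continuous_map (gtop Y) (gtop (copies I Y)) (\<lambda>y. (i, y))"
      by (simp add: copies_def continuous_map_pairwise o_def)
    from continuous_map_compose[OF this p] show "continuous_map (gtop Y) T (\<lambda>y. p (i, y))"
      by (simp add: o_def)
  qed
next
  assume p: "\<forall>i\<in>I. continuous_map (gtop Y) T (\<lambda>y. p (i, y))"
  show "continuous_map (gtop (copies I Y)) T p"
    unfolding continuous_map_def
  proof (intro conjI allI impI)
    show "p \<in> points (copies I Y) \<rightarrow> topspace T"
      using p by (auto simp: continuous_map_def)
    fix U assume U: "openin T U"
    show "openin (gtop (copies I Y)) {z \<in> points (copies I Y). p z \<in> U}"
    proof (subst openin_subopen, intro ballI)
      fix z assume z: "z \<in> {z \<in> points (copies I Y). p z \<in> U}"
      then obtain i y where iy: "z = (i, y)" "i \<in> I" "y \<in> points Y" "p (i, y) \<in> U"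
        by auto
      have "openin (gtop Y) {y \<in> points Y. p (i, y) \<in> U}"
        using p iy(2) U by (simp add: continuous_map_def)
      then have "openin (gtop (copies I Y)) ({i} \<times> {y \<in> points Y. p (i, y) \<in> U})"
        using iy(2) by (simp add: copies_def openin_prod_Times_iff)
      then show "\<exists>T. openin (gtop (copies I Y)) T \<and> z \<in> T \<and> T \<subseteq> {z \<in> points (copies I Y). p z \<in> U}"
        using iy by (intro exI[of _ "{i} \<times> {y \<in> points Y. p (i, y) \<in> U}"]) auto
    qed
  qed
qed

lemma copy_indicator_C_G:
  assumes Y: "is_gspace Y"
  shows "copy_indicator I Y P \<in> C_G (copies I Y)"
  unfolding copy_indicator_def
proof (rule C_G_modulus[OF is_gspace_copies[OF Y] _ _ seminorm_zero])
  show "continuous_map (gtop (copies I Y)) euclidean (\<lambda>z. if P (fst z) then 1 else 0)"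
    by (simp add: continuous_map_copies)
  show "bounded ((\<lambda>z. if P (fst z) then 1 else 0 :: complex) ` points (copies I Y))"
    by (rule finite_imp_bounded, rule finite_subset[of _ "{0,1}"]) auto
qed auto

lemma copy_indicator_apply [simp]:
  "i \<in> I \<Longrightarrow> y \<in> points Y \<Longrightarrow> copy_indicator I Y P (i, y) = (if P i then 1 else 0)"
  by (simp add: copy_indicator_def)

context
  fixes I :: "'i set" and Y :: "('g::{topological_group_add, t2_space}, 'y) gspace" and \<phi>
  assumes Y: "is_gspace Y" and \<phi>: "\<phi> \<in> points (gelfand (copies I Y))"
begin

lemma char_copy_indicator_conj:
  "\<phi> (copy_indicator I Y (\<lambda>i. P i \<and> Q i)) = \<phi> (copy_indicator I Y P) * \<phi> (copy_indicator I Y Q)"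
proof -
  have "copy_indicator I Y (\<lambda>i. P i \<and> Q i)
      = (\<lambda>z\<in>points (copies I Y). copy_indicator I Y P z * copy_indicator I Y Q z)"
    unfolding copy_indicator_def by (rule restrict_ext) simp
  then show ?thesis
    using char_mult[OF is_gspace_copies[OF Y] gelfandD[OF \<phi>] copy_indicator_C_G[OF Y] copy_indicator_C_G[OF Y], of P Q]
    by (simp only:)
qed

lemma char_copy_indicator_not:
  "\<phi> (copy_indicator I Y P) + \<phi> (copy_indicator I Y (\<lambda>i. \<not> P i)) = 1"
proof -
  have "(\<lambda>z\<in>points (copies I Y). 1)
      = (\<lambda>z\<in>points (copies I Y). copy_indicator I Y P z + copy_indicator I Y (\<lambda>i. \<not> P i) z)"
    unfolding copy_indicator_def by (rule restrict_ext) simp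
  then show ?thesis
    using char_add[OF is_gspace_copies[OF Y] gelfandD[OF \<phi>] copy_indicator_C_G[OF Y] copy_indicator_C_G[OF Y], of P "\<lambda>i. \<not> P i"]
      char_one[OF is_gspace_copies[OF Y] gelfandD[OF \<phi>]] by (simp only:)
qed

lemma char_copy_indicator_True: "(\<And>i. i \<in> I \<Longrightarrow> P i) \<Longrightarrow> \<phi> (copy_indicator I Y P) = 1"
proof -
  assume P: "\<And>i. i \<in> I \<Longrightarrow> P i"
  have "copy_indicator I Y P = (\<lambda>z\<in>points (copies I Y). 1)"
    unfolding copy_indicator_def by (rule restrict_ext) (auto simp: P)
  then show ?thesis
    using char_one[OF is_gspace_copies[OF Y] gelfandD[OF \<phi>]] by (simp only:)
qed

lemma char_copy_indicator_cases: "\<phi> (copy_indicator I Y P) = 0 \<or> \<phi> (copy_indicator I Y P) = 1"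
proof -
  have "\<phi> (copy_indicator I Y P) = \<phi> (copy_indicator I Y P) * \<phi> (copy_indicator I Y P)"
    using char_copy_indicator_conj[of P P] unfolding conj_absorb .
  then show ?thesis
    by (metis mult_cancel_right1)
qed

lemma char_filter:
  "\<exists>\<V>\<in>ultrafilters_on I. \<forall>P. eventually P \<V> \<longleftrightarrow> \<phi> (copy_indicator I Y P) = 1"
proof (intro bexI[of _ "Abs_filter (\<lambda>P. \<phi> (copy_indicator I Y P) = 1)"] allI)
  let ?V = "Abs_filter (\<lambda>P. \<phi> (copy_indicator I Y P) = 1)"
  have "is_filter (\<lambda>P. \<phi> (copy_indicator I Y P) = 1)"
  proof
    show "\<phi> (copy_indicator I Y (\<lambda>x. True)) = 1"
      by (rule char_copy_indicator_True) simp
    fix P Q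
    show "\<phi> (copy_indicator I Y (\<lambda>i. P i \<and> Q i)) = 1"
      if "\<phi> (copy_indicator I Y P) = 1" "\<phi> (copy_indicator I Y Q) = 1"
      using that by (simp add: char_copy_indicator_conj)
    show "\<phi> (copy_indicator I Y Q) = 1"
      if "\<forall>i. P i \<longrightarrow> Q i" "\<phi> (copy_indicator I Y P) = 1"
    proof -
      have "(\<lambda>i. P i \<and> Q i) = P"
        using that(1) by auto
      then show ?thesis
        using char_copy_indicator_conj[of P Q] that(2) by (simp only: mult_1)
    qed
  qed
  then show ev: "eventually P ?V \<longleftrightarrow> \<phi> (copy_indicator I Y P) = 1" for P
    by (rule eventually_Abs_filter)
  have "\<phi> (copy_indicator I Y (\<lambda>i. False)) = 0"
    using char_copy_indicator_not[of "\<lambda>i. False"] char_copy_indicator_True[of "\<lambda>i. True"] by simp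
  then have "?V \<noteq> bot"
    using ev[of "\<lambda>i. False"] by (auto simp: trivial_limit_def)
  moreover have "?V \<le> principal I"
    by (simp add: le_principal ev char_copy_indicator_True)
  moreover have "eventually P ?V \<or> eventually (\<lambda>i. \<not> P i) ?V" for P
    using char_copy_indicator_cases[of P] char_copy_indicator_not[of P] by (auto simp: ev)
  ultimately show "?V \<in> ultrafilters_on I"
    by (simp add: ultrafilters_on_def)
qed

lemma char_approx_copies:
  assumes P: "\<phi> (copy_indicator I Y P) = 1" and J: "finite J" "J \<subseteq> C_G (copies I Y)" and "e > 0"
  shows "\<exists>i\<in>I. \<exists>y\<in>points Y. P i \<and> (\<forall>p\<in>J. dist (p (i, y)) (\<phi> p) < e)"
proof -
  have "insert (copy_indicator I Y P) J \<subseteq> C_G (copies I Y)"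
    using J(2) copy_indicator_C_G[OF Y] by blast
  from char_approx[OF is_gspace_copies[OF Y] gelfandD[OF \<phi>] finite.insertI[OF J(1)] this, of "min e 1"]
  have "\<exists>z\<in>points (copies I Y). \<forall>p\<in>insert (copy_indicator I Y P) J. dist (p z) (\<phi> p) < min e 1"
    using \<open>e > 0\<close> by (simp only: min_less_iff_conj zero_less_one simp_thms)
  then obtain z where z: "z \<in> points (copies I Y)"
      "\<forall>p\<in>insert (copy_indicator I Y P) J. dist (p z) (\<phi> p) < min e 1"
    by (rule bexE)
  then obtain i y where iy: "z = (i, y)" "i \<in> I" "y \<in> points Y"
    by auto
  have "P i"
    using z(2) iy P by (auto split: if_splits)
  with z(2) iy show ?thesis
    by auto
qed

end

lemma topspace_beta_top [simp]: "topspace (beta_top I) = ultrafilters_on I"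
  unfolding beta_top_def topology_generated_by_topspace
proof (intro equalityI subsetI)
  fix \<U> assume U: "\<U> \<in> ultrafilters_on I"
  show "\<U> \<in> \<Union> {{\<U> \<in> ultrafilters_on I. \<forall>\<^sub>F i in \<U>. i \<in> A} |A. A \<subseteq> I}"
  proof (rule UnionI)
    show "{\<U> \<in> ultrafilters_on I. \<forall>\<^sub>F i in \<U>. i \<in> I}
        \<in> {{\<U> \<in> ultrafilters_on I. \<forall>\<^sub>F i in \<U>. i \<in> A} |A. A \<subseteq> I}"
      by (intro CollectI exI[of _ I]) simp
  qed (simp add: U ultrafilters_onD(2)[OF U])
qed auto

lemma beta_proj_eq:
  assumes Y: "is_gspace Y" and \<phi>: "\<phi> \<in> points (gelfand (copies I Y))" and U: "\<U> \<in> ultrafilters_on I"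
  shows "beta_proj I Y \<phi> = \<U> \<longleftrightarrow> (\<forall>P. eventually P \<U> \<longrightarrow> \<phi> (copy_indicator I Y P) = 1)"
proof -
  let ?W = "points (gelfand (copies I Y))"
  note gs = is_gspace_copies[OF Y, of I] and ind = copy_indicator_C_G[OF Y, of I]
  obtain V where V: "\<And>\<phi>. \<phi> \<in> ?W \<Longrightarrow> V \<phi> \<in> ultrafilters_on I"
      "\<And>\<phi> P. \<phi> \<in> ?W \<Longrightarrow> eventually P (V \<phi>) \<longleftrightarrow> \<phi> (copy_indicator I Y P) = 1"
    using char_filter[OF Y] by metis
  have op: "openin (gtop (gelfand (copies I Y))) {\<psi> \<in> ?W. \<psi> (copy_indicator I Y P) = 1}" for P
  proof -
    have "{\<psi> \<in> ?W. \<psi> (copy_indicator I Y P) = 1} = {\<psi> \<in> ?W. \<psi> (copy_indicator I Y P) \<in> - {0}}"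
      using char_copy_indicator_cases[OF Y] by fastforce
    then show ?thesis
      using openin_continuous_map_preimage[OF continuous_map_gelfand_apply[OF ind[of P]], of "- {0}"]
      by (simp add: open_Compl)
  qed
  have "beta_proj I Y = restrict V ?W"
    unfolding beta_proj_def
  proof (rule the_equality, intro conjI ballI)
    show "restrict V ?W \<in> extensional ?W"
      by simp
    show "continuous_map (gtop (gelfand (copies I Y))) (beta_top I) (restrict V ?W)"
      unfolding beta_top_def
    proof (rule continuous_on_generated_topo)
      fix S assume "S \<in> {{\<U> \<in> ultrafilters_on I. \<forall>\<^sub>F i in \<U>. i \<in> A} |A. A \<subseteq> I}"
      then obtain A where S: "S = {\<U> \<in> ultrafilters_on I. \<forall>\<^sub>F i in \<U>. i \<in> A}"
        by blast
      have "restrict V ?W -` S \<inter> ?W = {\<psi> \<in> ?W. \<psi> (copy_indicator I Y (\<lambda>i. i \<in> A)) = 1}"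
        by (auto simp: S V)
      then show "openin (gtop (gelfand (copies I Y))) (restrict V ?W -` S \<inter> ?W)"
        using op by simp
    next
      show "restrict V ?W ` ?W \<subseteq> \<Union> {{\<U> \<in> ultrafilters_on I. \<forall>\<^sub>F i in \<U>. i \<in> A} |A. A \<subseteq> I}"
      proof (rule image_subsetI)
        fix \<psi> assume "\<psi> \<in> ?W"
        then have "restrict V ?W \<psi> \<in> topspace (beta_top I)"
          by (simp add: V(1))
        then show "restrict V ?W \<psi> \<in> \<Union> {{\<U> \<in> ultrafilters_on I. \<forall>\<^sub>F i in \<U>. i \<in> A} |A. A \<subseteq> I}"
          unfolding beta_top_def topology_generated_by_topspace .
      qed
    qed
    show "restrict V ?W (evaluation (copies I Y) (i, y)) = principal {i}"
      if iy: "i \<in> I" "y \<in> points Y" for i y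
    proof -
      have e: "evaluation (copies I Y) (i, y) \<in> ?W"
        by (rule evaluation_gelfand[OF gs]) (simp add: iy)
      have "eventually P (V (evaluation (copies I Y) (i, y))) \<longleftrightarrow> P i" for P
        unfolding V(2)[OF e] using iy ind[of P] by (simp add: evaluation_def)
      with e show ?thesis
        by (simp add: filter_eq_iff eventually_principal)
    qed
  next
    fix \<pi>
    assume "\<pi> \<in> extensional ?W \<and> continuous_map (gtop (gelfand (copies I Y))) (beta_top I) \<pi> \<and>
        (\<forall>i\<in>I. \<forall>y\<in>points Y. \<pi> (evaluation (copies I Y) (i, y)) = principal {i})"
    then have \<pi>: "\<pi> \<in> extensional ?W" "continuous_map (gtop (gelfand (copies I Y))) (beta_top I) \<pi>"
        "\<And>i y. i \<in> I \<Longrightarrow> y \<in> points Y \<Longrightarrow> \<pi> (evaluation (copies I Y) (i, y)) = principal {i}"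
      by auto
    show "\<pi> = restrict V ?W"
    proof (rule extensionalityI[OF \<pi>(1)])
      fix \<psi> assume \<psi>: "\<psi> \<in> ?W"
      have \<pi>u: "\<pi> \<psi> \<in> ultrafilters_on I"
        using continuous_map_image_subset_topspace[OF \<pi>(2)] \<psi> by auto
      have "V \<psi> = \<pi> \<psi>"
      proof (rule ultrafilters_on_eqI[OF V(1)[OF \<psi>] \<pi>u], rule ccontr)
        fix P assume P: "eventually P (V \<psi>)" "\<not> eventually P (\<pi> \<psi>)"
        let ?A = "{i \<in> I. \<not> P i}"
        let ?S = "{\<U> \<in> ultrafilters_on I. \<forall>\<^sub>F i in \<U>. i \<in> ?A}"
        let ?Op = "{\<eta> \<in> ?W. \<pi> \<eta> \<in> ?S}"
        have "\<forall>\<^sub>F i in \<pi> \<psi>. \<not> P i"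
          using P(2) ultrafilters_onD(3)[OF \<pi>u] by blast
        with ultrafilters_onD(2)[OF \<pi>u] have "\<forall>\<^sub>F i in \<pi> \<psi>. i \<in> ?A"
          by eventually_elim simp
        then have "\<psi> \<in> ?Op"
          using \<psi> \<pi>u by simp
        moreover have "openin (beta_top I) ?S"
          unfolding beta_top_def by (rule topology_generated_by_Basis) blast
        then have "openin (gtop (gelfand (copies I Y))) ?Op"
          by (rule openin_continuous_map_preimage[OF \<pi>(2)])
        ultimately obtain s where s: "s \<in> C_G (copies I Y)" "\<psi> s = 1"
            "\<And>\<eta>. \<eta> \<in> ?W \<Longrightarrow> \<eta> s \<noteq> 0 \<Longrightarrow> \<eta> \<in> ?Op"
          using gelfand_nbhd[OF gs, of ?Op \<psi>] by blast
        obtain i y where iy: "i \<in> I" "y \<in> points Y" "P i" "dist (s (i, y)) (\<psi> s) < 1"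
          using char_approx_copies[OF Y \<psi>, of P "{s}" 1] P(1) V(2)[OF \<psi>] s(1) by auto
        have e: "evaluation (copies I Y) (i, y) \<in> ?W"
          by (rule evaluation_gelfand[OF gs]) (simp add: iy)
        have "evaluation (copies I Y) (i, y) s \<noteq> 0"
          using iy(4) s(1,2) by (auto simp: evaluation_def)
        then have "principal {i} \<in> ?S"
          using s(3)[OF e] \<pi>(3)[OF iy(1,2)] by simp
        then show False
          using iy(3) by (simp add: eventually_principal)
      qed
      then show "\<pi> \<psi> = restrict V ?W \<psi>"
        using \<psi> by simp
    qed simp
  qed
  then have "beta_proj I Y \<phi> = V \<phi>"
    using \<phi> by simp
  then show ?thesis
    using ultrafilters_on_eqI[OF U V(1)[OF \<phi>]] V(2)[OF \<phi>] by metis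
qed

lemma points_ultracopower_subset: "points (ultracopower I \<U> Y) \<subseteq> points (gelfand (copies I Y))"
  by (auto simp: ultracopower_def topspace_subtopology)

lemma gact_ultracopower: "gact (ultracopower I \<U> Y) = gact (gelfand (copies I Y))"
  by (simp add: ultracopower_def)

lemma mem_ultracopower_iff:
  assumes "is_gspace Y" "\<U> \<in> ultrafilters_on I"
  shows "\<phi> \<in> points (ultracopower I \<U> Y) \<longleftrightarrow> \<phi> \<in> points (gelfand (copies I Y))
     \<and> (\<forall>P. eventually P \<U> \<longrightarrow> \<phi> (copy_indicator I Y P) = 1)"
  using beta_proj_eq[OF assms(1) _ assms(2)] by (auto simp: ultracopower_def topspace_subtopology)

lemma gtop_ultracopower:
  "gtop (ultracopower I \<U> Y) = subtopology (gtop (gelfand (copies I Y))) (points (ultracopower I \<U> Y))"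
  by (simp add: ultracopower_def topspace_subtopology Int_def)

lemma compact_ultracopower:
  assumes Y: "is_gspace Y" and U: "\<U> \<in> ultrafilters_on I"
  shows "compact_space (gtop (ultracopower I \<U> Y))"
proof -
  let ?T = "gtop (gelfand (copies I Y))"
  have "closedin ?T {\<phi> \<in> topspace ?T. \<phi> (copy_indicator I Y P) \<in> {1}}" for P
    by (rule closedin_continuous_map_preimage[OF continuous_map_gelfand_apply[OF copy_indicator_C_G[OF Y]]]) simp
  then have "closedin ?T (\<Inter>P\<in>{P. eventually P \<U>}. {\<phi> \<in> topspace ?T. \<phi> (copy_indicator I Y P) \<in> {1}})"
    by (intro closedin_INT) (auto intro!: exI[of _ "\<lambda>i. True"])
  moreover have "(\<Inter>P\<in>{P. eventually P \<U>}. {\<phi> \<in> topspace ?T. \<phi> (copy_indicator I Y P) \<in> {1}})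
      = points (ultracopower I \<U> Y)"
    using mem_ultracopower_iff[OF Y U] eventually_True[of \<U>] by blast
  ultimately have "closedin ?T (points (ultracopower I \<U> Y))"
    by simp
  with compact_gelfand[OF is_gspace_copies[OF Y]] have "compactin ?T (points (ultracopower I \<U> Y))"
    by (rule closedin_compact_space)
  then show ?thesis
    by (subst gtop_ultracopower) (rule compact_space_subtopology)
qed

lemma gact_ultracopower_closed:
  assumes Y: "is_gspace Y" and U: "\<U> \<in> ultrafilters_on I" and \<phi>: "\<phi> \<in> points (ultracopower I \<U> Y)"
  shows "gact (ultracopower I \<U> Y) g \<phi> \<in> points (ultracopower I \<U> Y)"
proof -
  have "translate (copies I Y) (copy_indicator I Y P) g = copy_indicator I Y P" for P
    unfolding translate_def copy_indicator_def[of I Y P]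
    by (rule restrict_ext) (auto simp: gact_closed[OF Y])
  then have "gact (gelfand (copies I Y)) g \<phi> (copy_indicator I Y P) = \<phi> (copy_indicator I Y P)" for P
    by (simp add: gact_gelfand copy_indicator_C_G[OF Y])
  moreover have "gact (gelfand (copies I Y)) g \<phi> \<in> points (gelfand (copies I Y))"
    using gact_gelfand_closed[OF is_gspace_copies[OF Y]] \<phi> points_ultracopower_subset by blast
  ultimately show ?thesis
    using \<phi> by (simp add: mem_ultracopower_iff[OF Y U] gact_ultracopower)
qed

lemma ultracopower_approx:
  assumes Y: "is_gspace Y" and U: "\<U> \<in> ultrafilters_on I" and \<phi>: "\<phi> \<in> points (ultracopower I \<U> Y)"
    and J: "finite J" "J \<subseteq> C_G (copies I Y)" and "e > 0"
  shows "eventually (\<lambda>i. \<exists>y\<in>points Y. \<forall>p\<in>J. dist (p (i, y)) (\<phi> p) < e) \<U>"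
proof (rule ccontr)
  let ?P = "\<lambda>i. \<not> (\<exists>y\<in>points Y. \<forall>p\<in>J. dist (p (i, y)) (\<phi> p) < e)"
  assume "\<not> ?thesis"
  then have "eventually ?P \<U>"
    by (simp only: ultrafilters_onD(3)[OF U])
  then have "\<phi> (copy_indicator I Y ?P) = 1" "\<phi> \<in> points (gelfand (copies I Y))"
    using \<phi> unfolding mem_ultracopower_iff[OF Y U] by blast+
  from char_approx_copies[OF Y this(2,1) J \<open>e > 0\<close>] show False
    by blast
qed

lemma limit_char_ultracopower:
  assumes Y: "is_gspace Y" and U: "\<U> \<in> ultrafilters_on I" and y: "eventually (\<lambda>i. y i \<in> points Y) \<U>"
  shows "limit_char \<U> (copies I Y) (\<lambda>i. (i, y i)) \<in> points (ultracopower I \<U> Y)"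
proof -
  have ev: "eventually (\<lambda>i. (i, y i) \<in> points (copies I Y)) \<U>"
    using y ultrafilters_onD(2)[OF U] by eventually_elim simp
  have "limit_char \<U> (copies I Y) (\<lambda>i. (i, y i)) (copy_indicator I Y P) = 1" if "eventually P \<U>" for P
  proof (rule limit_char_eq[OF U copy_indicator_C_G[OF Y]])
    have "eventually (\<lambda>i. 1 = copy_indicator I Y P (i, y i)) \<U>"
      using ev that by eventually_elim simp
    with tendsto_const show "((\<lambda>i. copy_indicator I Y P (i, y i)) \<longlongrightarrow> 1) \<U>"
      by (rule Lim_transform_eventually)
  qed
  then show ?thesis
    using limit_char_gelfand[OF is_gspace_copies[OF Y] U ev] by (simp add: mem_ultracopower_iff[OF Y U])
qed

section \<open>Weak types of factors of ultracopowers\<close>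

lemma C_G_uniform:
  assumes X: "is_gspace X" and p: "p \<in> C_G X" and "e > 0" and N: "base_at_identity \<N>"
  shows "\<exists>V\<in>\<N>. \<forall>v\<in>V. \<forall>x\<in>points X. dist (p (gact X v x)) (p x) < e"
proof -
  have "\<forall>\<^sub>F h in at 0. \<forall>x\<in>points X. dist (p (gact X h x)) (p (gact X 0 x)) < e"
    by (rule uniform_limitD[OF C_G_D(4)[OF p] \<open>e > 0\<close>])
  then obtain S where S: "open S" "0 \<in> S"
      "\<And>h x. h \<in> S \<Longrightarrow> h \<noteq> 0 \<Longrightarrow> x \<in> points X \<Longrightarrow> dist (p (gact X h x)) (p (gact X 0 x)) < e"
    by (auto simp: eventually_at_topological)
  obtain V where V: "V \<in> \<N>" "V \<subseteq> S"
    using N S(1,2) unfolding base_at_identity_def by blast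
  have "dist (p (gact X v x)) (p x) < e" if "v \<in> V" "x \<in> points X" for v x
  proof (cases "v = 0")
    case True
    then show ?thesis
      using gact_zero[OF X that(2)] \<open>e > 0\<close> by simp
  next
    case False
    then show ?thesis
      using S(3)[of v x] V(2) gact_zero[OF X that(2)] that by auto
  qed
  with V(1) show ?thesis
    by blast
qed

lemma realizes_factor:
  assumes f: "is_factor_map Z X f"
    and Z: "\<And>g z. z \<in> points Z \<Longrightarrow> gact Z g z \<in> points Z"
    and M: "realizes X M"
  shows "realizes Z M"
proof -
  have cf: "continuous_map (gtop Z) (gtop X) f" and sf: "f ` points Z = points X"
    and ef: "\<And>g z. z \<in> points Z \<Longrightarrow> f (gact Z g z) = gact X g (f z)"
    using f by (auto simp: is_factor_map_def)
  obtain \<O> e where O: "finite \<O>" "\<And>A. A \<in> \<O> \<Longrightarrow> openin (gtop X) A" "\<And>A. A \<in> \<O> \<Longrightarrow> A \<noteq> {}"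
      and e: "bij_morphism e M (open_struct X \<O> (lgrp M) (lnbh M))"
    using M unfolding realizes_def by blast
  define pull where "pull A = {z \<in> points Z. f z \<in> A}" for A
  have OX: "A \<subseteq> points X" if "A \<in> \<O>" for A
    using openin_subset[OF O(2)[OF that]] .
  have fpull: "f ` pull A = A" if "A \<in> \<O>" for A
    using OX[OF that] sf by (auto simp: pull_def)
  have inj: "inj_on pull \<O>"
    by (rule inj_onI) (metis fpull)
  have cl: "f z \<in> gtop X closure_of T" if "z \<in> gtop Z closure_of S" "f ` S \<subseteq> T" for z S T
    using continuous_map_image_closure_subset[OF cf, of S] closure_of_mono[OF that(2), of "gtop X"] that(1) by blast
  have R: "(f z, f z') \<in> R_rel X U" if "(z, z') \<in> R_rel Z U" for z z' U
  proof -
    let ?ff = "\<lambda>(z, z'). (f z, f z')"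
    let ?S = "{(x, gact Z g x) | x g. x \<in> points Z \<and> g \<in> U}"
    let ?T = "{(x, gact X g x) | x g. x \<in> points X \<and> g \<in> U}"
    have "continuous_map (prod_topology (gtop Z) (gtop Z)) (prod_topology (gtop X) (gtop X)) ?ff"
      using continuous_map_compose[OF continuous_map_fst[of "gtop Z" "gtop Z"] cf]
        continuous_map_compose[OF continuous_map_snd[of "gtop Z" "gtop Z"] cf]
      by (simp add: continuous_map_pairwise o_def case_prod_unfold)
    from continuous_map_image_closure_subset[OF this, of ?S]
    have 1: "?ff (z, z') \<in> prod_topology (gtop X) (gtop X) closure_of (?ff ` ?S)"
      using that unfolding R_rel_def by blast
    have 2: "?ff ` ?S \<subseteq> ?T"
      using sf ef by fastforce
    show ?thesis
      unfolding R_rel_def using subsetD[OF closure_of_mono[OF 2] 1] unfolding prod.case .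
  qed
  have "bij_morphism (pull \<circ> e) M (open_struct Z (pull ` \<O>) (lgrp M) (lnbh M))"
    unfolding bij_morphism_def
  proof (intro conjI allI impI ballI)
    have "bij_betw e (verts M) \<O>"
      using e by (simp add: bij_morphism_def open_struct_def)
    then show "bij_betw (pull \<circ> e) (verts M) (verts (open_struct Z (pull ` \<O>) (lgrp M) (lnbh M)))"
      using bij_betw_trans[OF _ inj_on_imp_bij_betw[OF inj]] by (simp add: open_struct_def)
  next
    fix g U a b assume "(a, b) \<in> relE M g U"
    then have "(e a, e b) \<in> relE (open_struct X \<O> (lgrp M) (lnbh M)) g U"
      using e unfolding bij_morphism_def by blast
    then have *: "g \<in> lgrp M" "U \<in> lnbh M" "e a \<in> \<O>" "e b \<in> \<O>"
      "(gtop X closure_of (gact X g ` e a)) \<times> (gtop X closure_of (e b)) \<inter> R_rel X U = {}"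
      by (auto simp: open_struct_def)
    have "f ` gact Z g ` pull (e a) \<subseteq> gact X g ` e a"
      by (auto simp: pull_def ef)
    note cl1 = cl[OF _ this]
    have "f ` pull (e b) \<subseteq> e b"
      by (auto simp: pull_def)
    note cl2 = cl[OF _ this]
    have "(gtop Z closure_of (gact Z g ` pull (e a))) \<times> (gtop Z closure_of (pull (e b))) \<inter> R_rel Z U = {}"
    proof (intro equals0I, elim IntE SigmaE)
      fix p z z'
      assume z: "p \<in> R_rel Z U" "z \<in> gtop Z closure_of (gact Z g ` pull (e a))"
        "z' \<in> gtop Z closure_of (pull (e b))" "p = (z, z')"
      have "(f z, f z') \<in> (gtop X closure_of (gact X g ` e a)) \<times> (gtop X closure_of (e b)) \<inter> R_rel X U"
        using R z(1,4) by (intro IntI SigmaI cl1[OF z(2)] cl2[OF z(3)]) simp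
      then show False
        unfolding *(5) by simp
    qed
    with * show "((pull \<circ> e) a, (pull \<circ> e) b) \<in> relE (open_struct Z (pull ` \<O>) (lgrp M) (lnbh M)) g U"
      by (simp add: open_struct_def)
  next
    fix n t assume "t \<in> relC M n"
    then have "map e t \<in> relC (open_struct X \<O> (lgrp M) (lnbh M)) n"
      using e unfolding bij_morphism_def by blast
    then have *: "1 \<le> n" "length t = n" "e ` set t \<subseteq> \<O>" "\<Union> (e ` set t) = points X"
      by (auto simp: open_struct_def)
    have "\<Union> (pull ` e ` set t) = {z \<in> points Z. f z \<in> \<Union> (e ` set t)}"
      by (auto simp: pull_def)
    also have "\<dots> = points Z"
      unfolding *(4) using sf by blast
    finally show "map (pull \<circ> e) t \<in> relC (open_struct Z (pull ` \<O>) (lgrp M) (lnbh M)) n"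
      using *(1-3) by (auto simp: open_struct_def image_comp)
  qed
  moreover have "openin (gtop Z) B \<and> B \<noteq> {}" if B: "B \<in> pull ` \<O>" for B
  proof -
    obtain A where A: "A \<in> \<O>" "B = pull A"
      using B by blast
    have "openin (gtop Z) (pull A)"
      unfolding pull_def by (rule openin_continuous_map_preimage[OF cf O(2)[OF A(1)]])
    then show ?thesis
      using A fpull[OF A(1)] O(3)[OF A(1)] by auto
  qed
  ultimately show ?thesis
    unfolding realizes_def using O(1) by (intro exI[of _ "pull ` \<O>"]) auto
qed

lemma ultracopower_nbhd:
  assumes Y: "is_gspace Y" and A: "openin (gtop (ultracopower I \<U> Y)) A" and z: "z \<in> A"
  shows "\<exists>s\<in>C_G (copies I Y). z s = 1 \<and> s ` points (copies I Y) \<subseteq> complex_of_real ` {0..1}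
     \<and> (\<forall>\<phi>\<in>points (ultracopower I \<U> Y). \<phi> s \<noteq> 0 \<longrightarrow> \<phi> \<in> A)"
proof -
  obtain \<Omega> where "openin (gtop (gelfand (copies I Y))) \<Omega>" "A = \<Omega> \<inter> points (ultracopower I \<U> Y)"
    using A by (subst (asm) gtop_ultracopower) (auto simp: openin_subtopology)
  with gelfand_nbhd[OF is_gspace_copies[OF Y] this(1), of z] z
  show ?thesis
    using points_ultracopower_subset[of I \<U> Y] by (meson IntD1 IntI subsetD)
qed

lemma C_G_sum:
  assumes X: "is_gspace X" and "finite J" "\<And>j. j \<in> J \<Longrightarrow> s j \<in> C_G X"
  shows "\<exists>r\<in>C_G X. (\<forall>x\<in>points X. r x = (\<Sum>j\<in>J. s j x))
     \<and> (\<forall>\<phi>\<in>points (gelfand X). \<phi> r = (\<Sum>j\<in>J. \<phi> (s j)))"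
  using assms(2,3)
proof (induction J)
  case empty
  have "(\<lambda>x\<in>points X. 0) \<in> C_G X" "\<phi> (\<lambda>x\<in>points X. 0) = 0" if "\<phi> \<in> points (gelfand X)" for \<phi>
    using C_G_const[OF X] char_const[OF X gelfandD[OF that], of 0] by auto
  with C_G_const[OF X, of 0] show ?case
    by (intro bexI[of _ "\<lambda>x\<in>points X. 0"] conjI ballI) (simp_all only: sum.empty restrict_apply')
next
  case (insert j J)
  then obtain r where r: "r \<in> C_G X" "\<And>x. x \<in> points X \<Longrightarrow> r x = (\<Sum>j\<in>J. s j x)"
     "\<And>\<phi>. \<phi> \<in> points (gelfand X) \<Longrightarrow> \<phi> r = (\<Sum>j\<in>J. \<phi> (s j))"
    by auto
  have sj: "s j \<in> C_G X"
    using insert by simp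
  show ?case
  proof (intro bexI conjI ballI)
    show "(\<lambda>x\<in>points X. s j x + r x) \<in> C_G X"
      by (rule C_G_add[OF X sj r(1)])
    show "\<phi> (\<lambda>x\<in>points X. s j x + r x) = (\<Sum>j\<in>insert j J. \<phi> (s j))" if "\<phi> \<in> points (gelfand X)" for \<phi>
      using char_add[OF X gelfandD[OF that] sj r(1)] r(3)[OF that] insert by simp
  qed (use insert r in auto)
qed

text \<open>The functions \<open>r A\<close> shrink the finitely many open sets \<open>A\<close> to \<open>{\<phi>. \<phi> (r A) > 1 / 2}\<close> without losing
  any of the covers.\<close>

lemma ultracopower_shrink:
  fixes I :: "'i set" and Y :: "('g::{topological_group_add, t2_space}, 'y) gspace"
  assumes Y: "is_gspace Y" and U: "\<U> \<in> ultrafilters_on I"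
    and O: "finite \<O>" "\<forall>A\<in>\<O>. openin (gtop (ultracopower I \<U> Y)) A"
    and D: "finite D" "D \<subseteq> points (ultracopower I \<U> Y)"
  shows "\<exists>r. (\<forall>A\<in>\<O>. r A \<in> C_G (copies I Y)
        \<and> (\<forall>\<phi>\<in>points (ultracopower I \<U> Y). \<phi> (r A) \<noteq> 0 \<longrightarrow> \<phi> \<in> A) \<and> (\<forall>\<phi>\<in>D. \<phi> \<in> A \<longrightarrow> 1 / 2 < Re (\<phi> (r A))))
      \<and> (\<forall>\<S>. \<S> \<subseteq> \<O> \<longrightarrow> \<Union>\<S> = points (ultracopower I \<U> Y) \<longrightarrow>
           (\<forall>\<phi>\<in>points (ultracopower I \<U> Y). \<exists>A\<in>\<S>. 1 / 2 < Re (\<phi> (r A))))"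
proof -
  let ?Z = "ultracopower I \<U> Y" and ?Y = "copies I Y"
  note gs = is_gspace_copies[OF Y, of I]
  define s where "s A z = (SOME s. s \<in> C_G ?Y \<and> z s = 1 \<and> s ` points ?Y \<subseteq> complex_of_real ` {0..1}
     \<and> (\<forall>\<phi>\<in>points ?Z. \<phi> s \<noteq> 0 \<longrightarrow> \<phi> \<in> A))"
    for A and z :: "('i \<times> 'y \<Rightarrow> complex) \<Rightarrow> complex"
  have s0: "s A z \<in> C_G ?Y \<and> z (s A z) = 1 \<and> s A z ` points ?Y \<subseteq> complex_of_real ` {0..1}
     \<and> (\<forall>\<phi>\<in>points ?Z. \<phi> (s A z) \<noteq> 0 \<longrightarrow> \<phi> \<in> A)" if "A \<in> \<O>" "z \<in> A" for A z
    unfolding s_def by (rule someI_ex[OF ultracopower_nbhd[OF Y O(2)[rule_format, OF that(1)] that(2), unfolded Bex_def]])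
  have s: "\<And>A z. A \<in> \<O> \<Longrightarrow> z \<in> A \<Longrightarrow> s A z \<in> C_G ?Y"
      "\<And>A z. A \<in> \<O> \<Longrightarrow> z \<in> A \<Longrightarrow> z (s A z) = 1"
      "\<And>A z. A \<in> \<O> \<Longrightarrow> z \<in> A \<Longrightarrow> s A z ` points ?Y \<subseteq> complex_of_real ` {0..1}"
      "\<And>A z \<phi>. A \<in> \<O> \<Longrightarrow> z \<in> A \<Longrightarrow> \<phi> \<in> points ?Z \<Longrightarrow> \<phi> (s A z) \<noteq> 0 \<Longrightarrow> \<phi> \<in> A"
    using s0 by blast+
  have snn: "0 \<le> Re (\<phi> (s A z))" if "A \<in> \<O>" "z \<in> A" "\<phi> \<in> points ?Z" for A z \<phi>
  proof -
    have "compact (complex_of_real ` {0..1})"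
      by (intro compact_continuous_image continuous_intros) auto
    then have "\<phi> (s A z) \<in> complex_of_real ` {0..1}"
      using that points_ultracopower_subset[of I \<U> Y]
      by (intro char_in_closed[OF gs gelfandD s(1) _ s(3)]) (auto intro: compact_imp_closed)
    then show ?thesis
      by auto
  qed
  define W where "W z = points ?Z \<inter> (\<Inter>A\<in>{A \<in> \<O>. z \<in> A}. {\<phi> \<in> points ?Z. \<phi> (s A z) \<in> {w. 1 / 2 < Re w}})" for z
  have cont: "continuous_map (gtop ?Z) euclidean (\<lambda>\<phi>. \<phi> p)" if "p \<in> C_G ?Y" for p
    by (subst gtop_ultracopower) (rule continuous_map_from_subtopology[OF continuous_map_gelfand_apply[OF that]])
  have "openin (gtop ?Z) (W z)" for z
  proof (cases "{A \<in> \<O>. z \<in> A} = {}")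
    case True
    then have "W z = points ?Z"
      unfolding W_def by (simp only: INF_empty) simp
    then show ?thesis
      by simp
  next
    case False
    have "openin (gtop ?Z) {\<phi> \<in> points ?Z. \<phi> (s A z) \<in> {w. 1 / 2 < Re w}}" if "A \<in> \<O>" "z \<in> A" for A
      by (rule openin_continuous_map_preimage[OF cont[OF s(1)[OF that]]]) (simp only: open_openin[symmetric] open_halfspace_Re_gt)
    then show ?thesis
      unfolding W_def using False O(1) by (intro openin_Int openin_INT) auto
  qed
  then have oW: "\<forall>S\<in>W ` points ?Z. openin (gtop ?Z) S"
    by blast
  have "points ?Z \<subseteq> \<Union> (W ` points ?Z)"
  proof
    fix z assume "z \<in> points ?Z"
    moreover from this have "z \<in> W z"
      by (simp add: W_def s(2))
    ultimately show "z \<in> \<Union> (W ` points ?Z)"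
      by (rule UN_I[where B = W])
  qed
  with oW obtain \<F> where F: "finite \<F>" "\<F> \<subseteq> W ` points ?Z" "points ?Z \<subseteq> \<Union>\<F>"
    using compact_ultracopower[OF Y U] unfolding compact_space_alt by meson
  obtain E where E: "E \<subseteq> points ?Z" "finite E" "\<F> = W ` E"
    using finite_subset_image[OF F(1,2)] by blast
  note E = E(2,1) F(3)[unfolded E(3)]
  have "\<forall>A\<in>\<O>. \<exists>r. r \<in> C_G ?Y \<and> (\<forall>\<phi>\<in>points (gelfand ?Y). \<phi> r = (\<Sum>z\<in>{z \<in> D \<union> E. z \<in> A}. \<phi> (s A z)))"
  proof
    fix A assume "A \<in> \<O>"
    then show "\<exists>r. r \<in> C_G ?Y \<and> (\<forall>\<phi>\<in>points (gelfand ?Y). \<phi> r = (\<Sum>z\<in>{z \<in> D \<union> E. z \<in> A}. \<phi> (s A z)))"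
      using C_G_sum[OF gs, of "{z \<in> D \<union> E. z \<in> A}" "s A"] D(1) E(1) s(1) by auto
  qed
  from bchoice[OF this] obtain r where r: "\<And>A. A \<in> \<O> \<Longrightarrow> r A \<in> C_G ?Y"
     "\<And>A \<phi>. A \<in> \<O> \<Longrightarrow> \<phi> \<in> points (gelfand ?Y) \<Longrightarrow> \<phi> (r A) = (\<Sum>z\<in>{z \<in> D \<union> E. z \<in> A}. \<phi> (s A z))"
    by blast
  note r2 = r(2)[OF _ subsetD[OF points_ultracopower_subset]]
  have ge: "Re (\<phi> (s A z)) \<le> Re (\<phi> (r A))" if "A \<in> \<O>" "z \<in> D \<union> E" "z \<in> A" "\<phi> \<in> points ?Z" for A z \<phi>
    unfolding r2[OF that(1,4)] Re_sum
    by (rule member_le_sum) (use that snn D(1) E(1) in auto)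
  show ?thesis
  proof (intro exI[of _ r] conjI ballI allI impI)
    show "r A \<in> C_G ?Y" if "A \<in> \<O>" for A
      by (rule r(1)[OF that])
    show "\<phi> \<in> A" if "A \<in> \<O>" "\<phi> \<in> points ?Z" "\<phi> (r A) \<noteq> 0" for A \<phi>
    proof -
      have "\<exists>z\<in>{z \<in> D \<union> E. z \<in> A}. \<phi> (s A z) \<noteq> 0"
        using that(3) unfolding r2[OF that(1,2)] by (meson sum.neutral)
      then show ?thesis
        using s(4)[OF that(1)] that(2) by blast
    qed
    show "1 / 2 < Re (\<phi> (r A))" if "A \<in> \<O>" "\<phi> \<in> D" "\<phi> \<in> A" for A \<phi>
      using ge[OF that(1) _ that(3)] that(2) D(2) s(2)[OF that(1,3)] by fastforce
    show "\<exists>A\<in>\<S>. 1 / 2 < Re (\<phi> (r A))"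
      if S: "\<S> \<subseteq> \<O>" "\<Union>\<S> = points ?Z" and \<phi>: "\<phi> \<in> points ?Z" for \<S> \<phi>
    proof -
      obtain z where z: "z \<in> E" "\<phi> \<in> W z"
        using E(3) \<phi> by blast
      then obtain A where A: "A \<in> \<S>" "z \<in> A"
        using E(2) S(2) by blast
      then have "1 / 2 < Re (\<phi> (s A z))"
        using z(2) S(1) by (auto simp: W_def)
      then show ?thesis
        using ge[of A z \<phi>] A S(1) z(1) \<phi> by force
    qed
  qed
qed

text \<open>Roelcke precompactness lets the elements \<open>h i\<close>, which depend on \<open>i\<close>, be replaced by a single one: up to a
  small error on the left and on the right, only finitely many of them are different.\<close>

lemma R_rel_limit_char:
  assumes N: "symmetric_base \<N>" and Y: "is_gspace Y" and U: "\<U> \<in> ultrafilters_on I" and W: "W \<in> RPC_nbhds \<N>"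
    and y: "eventually (\<lambda>i. y i \<in> points Y) \<U>" and h: "eventually (\<lambda>i. h i \<in> W) \<U>"
  shows "(limit_char \<U> (copies I Y) (\<lambda>i. (i, y i)), limit_char \<U> (copies I Y) (\<lambda>i. (i, gact Y (h i) (y i))))
    \<in> R_rel (ultracopower I \<U> Y) W" (is "(?x, ?x') \<in> _")
proof -
  let ?Z = "ultracopower I \<U> Y" and ?Y = "copies I Y"
  note gs = is_gspace_copies[OF Y, of I]
  have NB: "base_at_identity \<N>"
    using N by (simp add: symmetric_base_def)
  have iI: "eventually (\<lambda>i. i \<in> I) \<U>"
    by (rule ultrafilters_onD(2)[OF U])
  have hy: "eventually (\<lambda>i. gact Y (h i) (y i) \<in> points Y) \<U>"
    using y by eventually_elim (rule gact_closed[OF Y])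
  have xZ: "?x \<in> points ?Z" "?x' \<in> points ?Z"
    by (rule limit_char_ultracopower[OF Y U], fact)+
  show ?thesis
    unfolding R_rel_def in_closure_of
  proof (intro conjI allI impI)
    fix T assume T: "(?x, ?x') \<in> T \<and> openin (prod_topology (gtop ?Z) (gtop ?Z)) T"
    obtain A B where AB: "openin (gtop ?Z) A" "openin (gtop ?Z) B" "?x \<in> A" "?x' \<in> B" "A \<times> B \<subseteq> T"
      using T[THEN conjunct2, unfolded openin_prod_topology_alt, rule_format, OF T[THEN conjunct1]]
      by (elim exE conjE) (rule that)
    obtain s where s: "s \<in> C_G ?Y" "?x s = 1" "\<And>\<phi>. \<phi> \<in> points ?Z \<Longrightarrow> \<phi> s \<noteq> 0 \<Longrightarrow> \<phi> \<in> A"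
      using ultracopower_nbhd[OF Y AB(1,3)] by blast
    obtain t where t: "t \<in> C_G ?Y" "?x' t = 1" "\<And>\<phi>. \<phi> \<in> points ?Z \<Longrightarrow> \<phi> t \<noteq> 0 \<Longrightarrow> \<phi> \<in> B"
      using ultracopower_nbhd[OF Y AB(2,4)] by blast
    obtain V1 where V1: "V1 \<in> \<N>" "\<forall>v\<in>V1. \<forall>z\<in>points ?Y. dist (s (gact ?Y v z)) (s z) < 1/4"
      by (rule bexE[OF C_G_uniform[OF gs s(1) _ NB, of "1/4"]]) simp
    obtain V2 where V2: "V2 \<in> \<N>" "\<forall>v\<in>V2. \<forall>z\<in>points ?Y. dist (t (gact ?Y v z)) (t z) < 1/4"
      by (rule bexE[OF C_G_uniform[OF gs t(1) _ NB, of "1/4"]]) simp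
    from V1(1) V2(1) have "open (V1 \<inter> V2)" "0 \<in> V1 \<inter> V2"
      using NB unfolding base_at_identity_def by auto
    then obtain V where V: "V \<in> \<N>" "V \<subseteq> V1" "V \<subseteq> V2"
      using NB unfolding base_at_identity_def by (meson Int_subset_iff)
    have Vs: "- v \<in> V" if "v \<in> V" for v
      using N V(1) that unfolding symmetric_base_def by blast
    have sV: "dist (s (i, gact Y v w)) (s (i, w)) < 1/4" and tV: "dist (t (i, gact Y v w)) (t (i, w)) < 1/4"
      if "v \<in> V" "i \<in> I" "w \<in> points Y" for v i w
      using V1(2)[rule_format, of v "(i, w)"] V2(2)[rule_format, of v "(i, w)"] that V(2,3) by auto
    have sV2: "dist (s (i, gact Y (u + v) w)) (s (i, w)) < 1/2"
      and tV2: "dist (t (i, gact Y (u + v) w)) (t (i, w)) < 1/2"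
      if "u \<in> V" "v \<in> V" "i \<in> I" "w \<in> points Y" for u v i w
      using sV[OF that(1,3) gact_closed[OF Y that(4)], of v] sV[OF that(2-4)]
        tV[OF that(1,3) gact_closed[OF Y that(4)], of v] tV[OF that(2-4)]
        dist_triangle[of "s (i, gact Y (u + v) w)" "s (i, w)" "s (i, gact Y v w)"]
        dist_triangle[of "t (i, gact Y (u + v) w)" "t (i, w)" "t (i, gact Y v w)"]
      unfolding gact_add[OF Y that(4)] by linarith+
    obtain F where F: "finite F" "W \<subseteq> {v + f + w | v f w. v \<in> V \<and> f \<in> F \<and> w \<in> V}"
      using W V(1) unfolding RPC_nbhds_def RPC_def by blast
    have "eventually (\<lambda>i. \<exists>f\<in>F. \<exists>v\<in>V. \<exists>w\<in>V. h i = v + f + w) \<U>"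
      using h by eventually_elim (use F(2) in blast)
    from ultrafilter_finite_Bex[OF U F(1) this] obtain f
      where f: "eventually (\<lambda>i. \<exists>v\<in>V. \<exists>w\<in>V. h i = v + f + w) \<U>"
      by blast
    then have "eventually (\<lambda>i. \<exists>v w. v \<in> V \<and> w \<in> V \<and> h i = v + f + w) \<U>"
      by eventually_elim blast
    then obtain v w where vw: "eventually (\<lambda>i. v i \<in> V \<and> w i \<in> V \<and> h i = v i + f + w i) \<U>"
      unfolding eventually_ex by (elim exE) (rule that)
    obtain k where k: "v k \<in> V" "w k \<in> V" "h k = v k + f + w k" "h k \<in> W"
      using eventually_happens'[OF ultrafilters_onD(1)[OF U] eventually_conj[OF vw h]] by blast
    let ?c = "\<lambda>i. gact Y (- w k + w i) (y i)"
    let ?\<phi> = "limit_char \<U> ?Y (\<lambda>i. (i, ?c i))"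
    have c: "eventually (\<lambda>i. ?c i \<in> points Y) \<U>"
      using y by eventually_elim (rule gact_closed[OF Y])
    have kc: "eventually (\<lambda>i. gact Y (h k) (?c i) \<in> points Y) \<U>"
      using c by eventually_elim (rule gact_closed[OF Y])
    have \<phi>Z: "?\<phi> \<in> points ?Z"
      by (rule limit_char_ultracopower[OF Y U c])
    have pc: "eventually (\<lambda>i. (i, a i) \<in> points ?Y) \<U>" if "eventually (\<lambda>i. a i \<in> points Y) \<U>" for a
      using iI that by eventually_elim simp
    have act: "gact ?Z (h k) ?\<phi> = limit_char \<U> ?Y (\<lambda>i. (i, gact Y (h k) (?c i)))"
      unfolding gact_ultracopower using gact_limit_char[OF gs U pc[OF c], of "h k"] by simp
    have close: "dist (limit_char \<U> ?Y (\<lambda>i. (i, a i)) q) (limit_char \<U> ?Y (\<lambda>i. (i, b i)) q) \<le> 1/2"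
      if q: "q \<in> C_G ?Y" and "eventually (\<lambda>i. a i \<in> points Y) \<U>" "eventually (\<lambda>i. b i \<in> points Y) \<U>"
        "eventually (\<lambda>i. dist (q (i, a i)) (q (i, b i)) < 1/2) \<U>" for q a b
    proof (rule tendsto_upperbound)
      show "((\<lambda>i. dist (q (i, a i)) (q (i, b i)))
           \<longlongrightarrow> dist (limit_char \<U> ?Y (\<lambda>i. (i, a i)) q) (limit_char \<U> ?Y (\<lambda>i. (i, b i)) q)) \<U>"
        by (intro tendsto_dist tendsto_limit_char[OF U _ q] pc that)
      show "\<forall>\<^sub>F i in \<U>. dist (q (i, a i)) (q (i, b i)) \<le> 1/2"
        using that(4) by eventually_elim simp
      show "\<U> \<noteq> bot"
        by (rule ultrafilters_onD(1)[OF U])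
    qed
    have "eventually (\<lambda>i. dist (s (i, ?c i)) (s (i, y i)) < 1/2) \<U>"
      using vw iI y by eventually_elim (rule sV2, use Vs k(2) in auto)
    from close[OF s(1) c y this] have "?\<phi> s \<noteq> 0"
      unfolding s(2) by auto
    then have "?\<phi> \<in> A"
      by (rule s(3)[OF \<phi>Z])
    have "eventually (\<lambda>i. dist (t (i, gact Y (h k) (?c i))) (t (i, gact Y (h i) (y i))) < 1/2) \<U>"
      using vw iI y
    proof eventually_elim
      case (elim i)
      have "h k + (- w k + w i) = v k + - v i + h i"
        using elim k(3) by (simp only: add.assoc minus_add_cancel add_minus_cancel)
      then have "gact Y (h k) (?c i) = gact Y (v k + - v i) (gact Y (h i) (y i))"
        using elim(3) by (metis gact_add[OF Y])
      with elim show ?case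
        using tV2[OF k(1) Vs, of "v i" i "gact Y (h i) (y i)"] gact_closed[OF Y elim(3)] by simp
    qed
    from close[OF t(1) kc hy this] have "gact ?Z (h k) ?\<phi> t \<noteq> 0"
      unfolding t(2) act by auto
    then have "gact ?Z (h k) ?\<phi> \<in> B"
      by (rule t(3)[OF gact_ultracopower_closed[OF Y U \<phi>Z]])
    with \<open>?\<phi> \<in> A\<close> AB(5) \<phi>Z k(4)
    show "\<exists>p. p \<in> {(x, gact ?Z g x) |x g. x \<in> points ?Z \<and> g \<in> W} \<and> p \<in> T"
      by (intro exI[of _ "(?\<phi>, gact ?Z (h k) ?\<phi>)"]) blast
  qed (use xZ in auto)
qed

lemma R_rel_meets_superlevel_sets:
  assumes Y: "is_gspace Y"
    and p: "continuous_map (gtop Y) euclideanreal p" and q: "continuous_map (gtop Y) euclideanreal q"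
    and ne: "(gtop Y closure_of (gact Y g ` {y \<in> points Y. d < p y}))
      \<times> (gtop Y closure_of {y \<in> points Y. d < q y}) \<inter> R_rel Y W \<noteq> {}" and "c < d"
  shows "\<exists>w\<in>points Y. \<exists>h\<in>W. c < p w \<and> c < q (gact Y h (gact Y g w))"
proof -
  obtain a b where ab: "a \<in> gtop Y closure_of (gact Y g ` {y \<in> points Y. d < p y})"
      "b \<in> gtop Y closure_of {y \<in> points Y. d < q y}" "(a, b) \<in> R_rel Y W"
    using ne by blast
  have inv: "gact Y (- g) (gact Y g y) = y" if "y \<in> points Y" for y
    using gact_add[OF Y that, of "- g" g] gact_zero[OF Y that] by simp
  have inv': "gact Y g (gact Y (- g) y) = y" if "y \<in> points Y" for y
    using gact_add[OF Y that, of g "- g"] gact_zero[OF Y that] by simp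
  have pg: "continuous_map (gtop Y) euclideanreal (\<lambda>y. p (gact Y (- g) y))"
    using continuous_map_compose[OF gact_continuous[OF Y] p] by (simp add: o_def)
  have level: "y \<in> {y \<in> points Y. r y \<in> {c<..}}"
    if "continuous_map (gtop Y) euclideanreal r" "y \<in> gtop Y closure_of S" "S \<subseteq> {y \<in> points Y. r y \<in> {d..}}" for r y S
  proof -
    have "closedin (gtop Y) {y \<in> points Y. r y \<in> {d..}}"
      by (rule closedin_continuous_map_preimage[OF that(1)]) simp
    from closure_of_minimal[OF that(3) this] that(2) \<open>c < d\<close> show ?thesis
      by auto
  qed
  let ?P = "{y \<in> points Y. p (gact Y (- g) y) \<in> {c<..}}" and ?Q = "{y \<in> points Y. q y \<in> {c<..}}"
  have "a \<in> ?P"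
    by (rule level[OF pg ab(1)]) (auto simp: inv gact_closed[OF Y])
  moreover have "b \<in> ?Q"
    by (rule level[OF q ab(2)]) auto
  moreover have "openin (gtop Y) ?P" "openin (gtop Y) ?Q"
    by (rule openin_continuous_map_preimage[OF pg] openin_continuous_map_preimage[OF q], simp)+
  ultimately have "openin (prod_topology (gtop Y) (gtop Y)) (?P \<times> ?Q)" "(a, b) \<in> ?P \<times> ?Q"
    by (auto simp: openin_prod_Times_iff)
  then have PQ: "(a, b) \<in> ?P \<times> ?Q \<and> openin (prod_topology (gtop Y) (gtop Y)) (?P \<times> ?Q)"
    by simp
  obtain y h where "y \<in> points Y" "h \<in> W" "(y, gact Y h y) \<in> ?P \<times> ?Q"
    using ab(3)[unfolded R_rel_def in_closure_of, THEN conjunct2, rule_format, OF PQ]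
    by (elim bexE exE conjE CollectE) (simp only:)
  then show ?thesis
    by (intro bexI[of _ "gact Y (- g) y"] bexI[of _ h]) (auto simp: inv' gact_closed[OF Y])
qed

lemma ultracopower_R_disjoint:
  assumes N: "symmetric_base \<N>" and Y: "is_gspace Y" and U: "\<U> \<in> ultrafilters_on I" and W: "W \<in> RPC_nbhds \<N>"
    and A: "A \<subseteq> points (ultracopower I \<U> Y)" and B: "B \<subseteq> points (ultracopower I \<U> Y)"
    and p: "p \<in> C_G (copies I Y)" "\<And>\<phi>. \<phi> \<in> points (ultracopower I \<U> Y) \<Longrightarrow> \<phi> p \<noteq> 0 \<Longrightarrow> \<phi> \<in> A"
    and q: "q \<in> C_G (copies I Y)" "\<And>\<phi>. \<phi> \<in> points (ultracopower I \<U> Y) \<Longrightarrow> \<phi> q \<noteq> 0 \<Longrightarrow> \<phi> \<in> B"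
    and disj: "(gtop (ultracopower I \<U> Y) closure_of (gact (ultracopower I \<U> Y) g ` A))
      \<times> (gtop (ultracopower I \<U> Y) closure_of B) \<inter> R_rel (ultracopower I \<U> Y) W = {}"
  shows "eventually (\<lambda>i. (gtop Y closure_of (gact Y g ` {y \<in> points Y. 1 / 2 < Re (p (i, y))}))
      \<times> (gtop Y closure_of {y \<in> points Y. 1 / 2 < Re (q (i, y))}) \<inter> R_rel Y W = {}) \<U>"
proof (rule ccontr)
  let ?Z = "ultracopower I \<U> Y" and ?Y = "copies I Y"
  note gs = is_gspace_copies[OF Y, of I]
  assume "\<not> ?thesis"
  then have "eventually (\<lambda>i. (gtop Y closure_of (gact Y g ` {y \<in> points Y. 1 / 2 < Re (p (i, y))}))
      \<times> (gtop Y closure_of {y \<in> points Y. 1 / 2 < Re (q (i, y))}) \<inter> R_rel Y W \<noteq> {}) \<U>"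
    unfolding ultrafilters_onD(3)[OF U] .
  with ultrafilters_onD(2)[OF U]
  have "eventually (\<lambda>i. (\<exists>w\<in>points Y. \<exists>h\<in>W. 1 / 4 < Re (p (i, w)) \<and> 1 / 4 < Re (q (i, gact Y h (gact Y g w))))) \<U>"
  proof eventually_elim
    case (elim i)
    have "continuous_map (gtop Y) euclideanreal (\<lambda>y. Re (r (i, y)))" if "r \<in> C_G ?Y" for r
    proof -
      have "continuous_map (gtop Y) euclidean (\<lambda>y. r (i, y))"
        using C_G_D(1)[OF that] elim(1) unfolding continuous_map_copies by blast
      from continuous_map_compose[OF this, of euclideanreal Re] show ?thesis
        by (simp add: o_def continuous_on_Re)
    qed
    from R_rel_meets_superlevel_sets[OF Y this[OF p(1)] this[OF q(1)] elim(2), of "1/4"] elim(1)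
    show ?case
      by simp
  qed
  then have "eventually (\<lambda>i. \<exists>w h. w \<in> points Y \<and> h \<in> W \<and> 1 / 4 < Re (p (i, w))
      \<and> 1 / 4 < Re (q (i, gact Y h (gact Y g w)))) \<U>"
    by eventually_elim blast
  then obtain w h where wh: "eventually (\<lambda>i. w i \<in> points Y \<and> h i \<in> W \<and> 1 / 4 < Re (p (i, w i))
      \<and> 1 / 4 < Re (q (i, gact Y (h i) (gact Y g (w i))))) \<U>"
    unfolding eventually_ex by (elim exE) (rule that)
  have w: "eventually (\<lambda>i. w i \<in> points Y) \<U>" and h: "eventually (\<lambda>i. h i \<in> W) \<U>"
    and pw: "eventually (\<lambda>i. 1 / 4 \<le> Re (p (i, w i))) \<U>"
    and qw: "eventually (\<lambda>i. 1 / 4 \<le> Re (q (i, gact Y (h i) (gact Y g (w i))))) \<U>"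
    using wh by (auto elim!: eventually_mono)
  have gw: "eventually (\<lambda>i. gact Y g (w i) \<in> points Y) \<U>"
    using w by eventually_elim (rule gact_closed[OF Y])
  have hgw: "eventually (\<lambda>i. gact Y (h i) (gact Y g (w i)) \<in> points Y) \<U>"
    using gw by eventually_elim (rule gact_closed[OF Y])
  let ?L = "\<lambda>w. limit_char \<U> ?Y (\<lambda>i. (i, w i))"
  have pc: "eventually (\<lambda>i. (i, a i) \<in> points ?Y) \<U>" if "eventually (\<lambda>i. a i \<in> points Y) \<U>" for a
    using ultrafilters_onD(2)[OF U] that by eventually_elim simp
  have mem: "?L a \<in> C" if "eventually (\<lambda>i. a i \<in> points Y) \<U>" "r \<in> C_G ?Y"
      "\<And>\<phi>. \<phi> \<in> points ?Z \<Longrightarrow> \<phi> r \<noteq> 0 \<Longrightarrow> \<phi> \<in> C" "eventually (\<lambda>i. 1 / 4 \<le> Re (r (i, a i))) \<U>" for a r C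
  proof (rule that(3)[OF limit_char_ultracopower[OF Y U that(1)]])
    have "1 / 4 \<le> Re (?L a r)"
      by (rule tendsto_lowerbound[OF tendsto_Re[OF tendsto_limit_char[OF U pc[OF that(1)] that(2)]] that(4)])
         (rule ultrafilters_onD(1)[OF U])
    then show "?L a r \<noteq> 0"
      by auto
  qed
  have "?L w \<in> A"
    by (rule mem[OF w p pw])
  moreover have "gact ?Z g (?L w) = ?L (\<lambda>i. gact Y g (w i))"
    unfolding gact_ultracopower using gact_limit_char[OF gs U pc[OF w], of g] by simp
  ultimately have "?L (\<lambda>i. gact Y g (w i)) \<in> gact ?Z g ` A"
    by (intro image_eqI[where f = "gact ?Z g" and x = "?L w"]) simp_all
  moreover have "gact ?Z g ` A \<subseteq> points ?Z"
    using A gact_ultracopower_closed[OF Y U] by blast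
  ultimately have 1: "?L (\<lambda>i. gact Y g (w i)) \<in> gtop ?Z closure_of (gact ?Z g ` A)"
    using subsetD[OF closure_of_subset] by simp
  have 2: "?L (\<lambda>i. gact Y (h i) (gact Y g (w i))) \<in> gtop ?Z closure_of B"
    by (rule subsetD[OF closure_of_subset[OF B] mem[OF hgw q qw]])
  have 3: "(?L (\<lambda>i. gact Y g (w i)), ?L (\<lambda>i. gact Y (h i) (gact Y g (w i)))) \<in> R_rel ?Z W"
    by (rule R_rel_limit_char[OF N Y U W gw h])
  have "(?L (\<lambda>i. gact Y g (w i)), ?L (\<lambda>i. gact Y (h i) (gact Y g (w i))))
      \<in> (gtop ?Z closure_of (gact ?Z g ` A)) \<times> (gtop ?Z closure_of B) \<inter> R_rel ?Z W"
    by (intro IntI SigmaI 1 2 3)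
  then show False
    unfolding disj by (rule emptyE)
qed

lemma realizes_if_ultracopower_realizes:
  assumes N: "symmetric_base \<N>" and Y: "is_gspace Y" and U: "\<U> \<in> ultrafilters_on I"
    and M: "realizes (ultracopower I \<U> Y) M"
    and fin: "finite (lgrp M)" "finite (lnbh M)" and nbh: "lnbh M \<subseteq> RPC_nbhds \<N>"
  shows "realizes Y M"
proof -
  let ?Z = "ultracopower I \<U> Y" and ?Y = "copies I Y"
  obtain \<O> e where O: "finite \<O>" "\<And>A. A \<in> \<O> \<Longrightarrow> openin (gtop ?Z) A" "\<And>A. A \<in> \<O> \<Longrightarrow> A \<noteq> {}"
      and e: "bij_morphism e M (open_struct ?Z \<O> (lgrp M) (lnbh M))"
    using M unfolding realizes_def by blast
  have OZ: "A \<subseteq> points ?Z" if "A \<in> \<O>" for A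
    using openin_subset[OF O(2)[OF that]] .
  define D where "D = (\<lambda>(A, B). SOME z. z \<in> A - B) ` {(A, B). A \<in> \<O> \<and> B \<in> insert {} \<O> \<and> \<not> A \<subseteq> B}"
  have D: "\<exists>z\<in>D. z \<in> A \<and> z \<notin> B" if "A \<in> \<O>" "B \<in> insert {} \<O>" "\<not> A \<subseteq> B" for A B
  proof -
    have "(SOME z. z \<in> A - B) \<in> A - B"
      using that(3) unfolding some_in_eq by blast
    moreover have "(SOME z. z \<in> A - B) \<in> D"
      unfolding D_def using that by (intro image_eqI[where x = "(A, B)"]) auto
    ultimately show ?thesis
      by (intro bexI[of _ "SOME z. z \<in> A - B"]) simp_all
  qed
  have "{(A, B). A \<in> \<O> \<and> B \<in> insert {} \<O> \<and> \<not> A \<subseteq> B} \<subseteq> \<O> \<times> insert {} \<O>"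
    by blast
  from finite_subset[OF this] have "finite D"
    unfolding D_def using O(1) by simp
  have DZ: "D \<subseteq> points ?Z"
  proof
    fix z assume "z \<in> D"
    then obtain A B where AB: "z = (SOME z. z \<in> A - B)" "A \<in> \<O>" "\<not> A \<subseteq> B"
      by (auto simp: D_def)
    have "(SOME z. z \<in> A - B) \<in> A - B"
      using AB(3) unfolding some_in_eq by blast
    then show "z \<in> points ?Z"
      using AB(1) OZ[OF AB(2)] by blast
  qed
  have opO: "\<forall>A\<in>\<O>. openin (gtop ?Z) A"
    by (rule ballI[OF O(2)])
  obtain r where r_props: "(\<forall>A\<in>\<O>. r A \<in> C_G ?Y
        \<and> (\<forall>\<phi>\<in>points ?Z. \<phi> (r A) \<noteq> 0 \<longrightarrow> \<phi> \<in> A) \<and> (\<forall>\<phi>\<in>D. \<phi> \<in> A \<longrightarrow> 1 / 2 < Re (\<phi> (r A))))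
      \<and> (\<forall>\<S>. \<S> \<subseteq> \<O> \<longrightarrow> \<Union>\<S> = points ?Z \<longrightarrow> (\<forall>\<phi>\<in>points ?Z. \<exists>A\<in>\<S>. 1 / 2 < Re (\<phi> (r A))))"
    using ultracopower_shrink[OF Y U O(1) opO \<open>finite D\<close> DZ] by (elim exE) (rule that)
  have r: "\<And>A. A \<in> \<O> \<Longrightarrow> r A \<in> C_G ?Y"
     "\<And>A \<phi>. A \<in> \<O> \<Longrightarrow> \<phi> \<in> points ?Z \<Longrightarrow> \<phi> (r A) \<noteq> 0 \<Longrightarrow> \<phi> \<in> A"
     "\<And>A \<phi>. A \<in> \<O> \<Longrightarrow> \<phi> \<in> D \<Longrightarrow> \<phi> \<in> A \<Longrightarrow> 1 / 2 < Re (\<phi> (r A))"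
     "\<And>\<S> \<phi>. \<S> \<subseteq> \<O> \<Longrightarrow> \<Union>\<S> = points ?Z \<Longrightarrow> \<phi> \<in> points ?Z \<Longrightarrow> \<exists>A\<in>\<S>. 1 / 2 < Re (\<phi> (r A))"
    using r_props by simp_all
  define Q where "Q i A = {y \<in> points Y. 1 / 2 < Re (r A (i, y))}" for i A
  have Re_close: "c < Re a" if "dist a b < Re b - c" for a b :: complex and c
    using that complex_Re_le_cmod[of "b - a"] by (simp add: dist_norm norm_minus_commute)
  have Re_close': "Re a < c" if "dist a b < c - Re b" for a b :: complex and c
    using that complex_Re_le_cmod[of "a - b"] by (simp add: dist_norm)
  have ev1: "eventually (\<lambda>i. Q i A \<noteq> {}) \<U>" if A: "A \<in> \<O>" for A
  proof -
    obtain z where z: "z \<in> D" "z \<in> A"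
      using D[OF A, of "{}"] O(3)[OF A] by auto
    have "eventually (\<lambda>i. \<exists>y\<in>points Y. \<forall>p\<in>{r A}. dist (p (i, y)) (z p) < Re (z (r A)) - 1 / 2) \<U>"
      using z r(1)[OF A] r(3)[OF A z] DZ by (intro ultracopower_approx[OF Y U]) auto
    then show ?thesis
      by eventually_elim (auto simp: Q_def dest!: Re_close)
  qed
  have ev2: "eventually (\<lambda>i. \<not> Q i A \<subseteq> Q i B) \<U>" if AB: "A \<in> \<O>" "B \<in> \<O>" "\<not> A \<subseteq> B" for A B
  proof -
    obtain z where z: "z \<in> D" "z \<in> A" "z \<notin> B"
      using D[OF AB(1) _ AB(3)] AB(2) by auto
    then have zB: "z (r B) = 0"
      using r(2)[OF AB(2)] DZ by blast
    have "eventually (\<lambda>i. \<exists>y\<in>points Y. \<forall>p\<in>{r A, r B}. dist (p (i, y)) (z p) < min (1 / 2) (Re (z (r A)) - 1 / 2)) \<U>"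
      using z r(1) AB(1,2) r(3)[OF AB(1) z(1,2)] DZ by (intro ultracopower_approx[OF Y U]) auto
    then show ?thesis
    proof eventually_elim
      case (elim i)
      then obtain y where y: "y \<in> points Y" "dist (r A (i, y)) (z (r A)) < Re (z (r A)) - 1 / 2"
          "dist (r B (i, y)) (z (r B)) < 1 / 2 - Re (z (r B))"
        by (auto simp: zB)
      with Re_close[OF y(2)] Re_close'[OF y(3)] have "y \<in> Q i A" "y \<notin> Q i B"
        by (simp_all add: Q_def)
      then show ?case
        by blast
    qed
  qed
  have ev3: "eventually (\<lambda>i. \<Union> (Q i ` \<S>) = points Y) \<U>" if S: "\<S> \<subseteq> \<O>" "\<Union>\<S> = points ?Z" for \<S>
  proof (rule ccontr)
    assume "\<not> ?thesis"
    then have "eventually (\<lambda>i. \<Union> (Q i ` \<S>) \<noteq> points Y) \<U>"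
      unfolding ultrafilters_onD(3)[OF U] .
    then have "eventually (\<lambda>i. \<exists>y. y \<in> points Y \<and> (\<forall>A\<in>\<S>. Re (r A (i, y)) \<le> 1 / 2)) \<U>"
      by eventually_elim (fastforce simp: Q_def not_less)
    then obtain y where y: "eventually (\<lambda>i. y i \<in> points Y \<and> (\<forall>A\<in>\<S>. Re (r A (i, y i)) \<le> 1 / 2)) \<U>"
      unfolding eventually_ex by (elim exE) (rule that)
    let ?\<phi> = "limit_char \<U> ?Y (\<lambda>i. (i, y i))"
    have y1: "eventually (\<lambda>i. y i \<in> points Y) \<U>"
      using y by eventually_elim simp
    have y2: "eventually (\<lambda>i. (i, y i) \<in> points ?Y) \<U>"
      using y1 ultrafilters_onD(2)[OF U] by eventually_elim simp
    obtain A where A: "A \<in> \<S>" "1 / 2 < Re (?\<phi> (r A))"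
      using r(4)[OF S limit_char_ultracopower[OF Y U y1]] by blast
    have "Re (?\<phi> (r A)) \<le> 1 / 2"
    proof (rule tendsto_upperbound[OF tendsto_Re[OF tendsto_limit_char[OF U y2 r(1)]]])
      show "eventually (\<lambda>i. Re (r A (i, y i)) \<le> 1 / 2) \<U>"
        using y by eventually_elim (use A(1) in blast)
    qed (use A(1) S(1) ultrafilters_onD(1)[OF U] in auto)
    with A(2) show False
      by simp
  qed
  define sep where "sep g W A B i \<longleftrightarrow>
      (gtop Y closure_of (gact Y g ` Q i A)) \<times> (gtop Y closure_of (Q i B)) \<inter> R_rel Y W = {}" for g W A B i
  define sepZ where "sepZ g W A B \<longleftrightarrow>
      (gtop ?Z closure_of (gact ?Z g ` A)) \<times> (gtop ?Z closure_of B) \<inter> R_rel ?Z W = {}" for g W A B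
  have ev4: "eventually (sep g W A B) \<U>" if "W \<in> lnbh M" "A \<in> \<O>" "B \<in> \<O>" "sepZ g W A B" for g W A B
    unfolding sep_def Q_def
    by (rule ultracopower_R_disjoint[OF N Y U _ OZ[OF that(2)] OZ[OF that(3)] r(1)[OF that(2)] r(2)[OF that(2)]
          r(1)[OF that(3)] r(2)[OF that(3)] that(4)[unfolded sepZ_def]]) (use that(1) nbh in auto)
  have imp: "eventually (\<lambda>i. c \<longrightarrow> P i) \<U>" if "c \<Longrightarrow> eventually P \<U>" for c P
    using that by (cases c) simp_all
  have "eventually (\<lambda>i. \<forall>A\<in>\<O>. Q i A \<noteq> {}) \<U>"
    using ev1 by (intro eventually_ball_finite O(1) ballI)
  moreover have "eventually (\<lambda>i. \<forall>A\<in>\<O>. \<forall>B\<in>\<O>. \<not> A \<subseteq> B \<longrightarrow> \<not> Q i A \<subseteq> Q i B) \<U>"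
    using ev2 by (intro eventually_ball_finite O(1) ballI imp)
  moreover have "eventually (\<lambda>i. \<forall>\<S>\<in>Pow \<O>. \<Union>\<S> = points ?Z \<longrightarrow> \<Union> (Q i ` \<S>) = points Y) \<U>"
    by (intro eventually_ball_finite finite_Pow_iff[THEN iffD2] O(1) ballI imp ev3) simp
  moreover have "eventually (\<lambda>i. \<forall>g\<in>lgrp M. \<forall>W\<in>lnbh M. \<forall>A\<in>\<O>. \<forall>B\<in>\<O>. sepZ g W A B \<longrightarrow> sep g W A B i) \<U>"
    using ev4 by (intro eventually_ball_finite O(1) fin ballI imp)
  ultimately have "eventually (\<lambda>i. i \<in> I \<and> (\<forall>A\<in>\<O>. Q i A \<noteq> {})
      \<and> (\<forall>A\<in>\<O>. \<forall>B\<in>\<O>. \<not> A \<subseteq> B \<longrightarrow> \<not> Q i A \<subseteq> Q i B)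
      \<and> (\<forall>\<S>\<in>Pow \<O>. \<Union>\<S> = points ?Z \<longrightarrow> \<Union> (Q i ` \<S>) = points Y)
      \<and> (\<forall>g\<in>lgrp M. \<forall>W\<in>lnbh M. \<forall>A\<in>\<O>. \<forall>B\<in>\<O>. sepZ g W A B \<longrightarrow> sep g W A B i)) \<U>"
    using ultrafilters_onD(2)[OF U] by (intro eventually_conj)
  from eventually_happens'[OF ultrafilters_onD(1)[OF U] this]
  obtain i where i: "i \<in> I"
    and is1: "\<forall>A\<in>\<O>. Q i A \<noteq> {}"
    and is2: "\<forall>A\<in>\<O>. \<forall>B\<in>\<O>. \<not> A \<subseteq> B \<longrightarrow> \<not> Q i A \<subseteq> Q i B"
    and is3: "\<forall>\<S>\<in>Pow \<O>. \<Union>\<S> = points ?Z \<longrightarrow> \<Union> (Q i ` \<S>) = points Y"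
    and is4: "\<forall>g\<in>lgrp M. \<forall>W\<in>lnbh M. \<forall>A\<in>\<O>. \<forall>B\<in>\<O>. sepZ g W A B \<longrightarrow> sep g W A B i"
    by (elim exE conjE) (rule that)
  note i1 = is1[rule_format] and i2 = is2[rule_format] and i3 = is3[rule_format, OF PowI] and i4 = is4[rule_format]
  have inj: "inj_on (Q i) \<O>"
    by (rule inj_onI) (metis i2 subset_antisym subset_refl)
  have op: "openin (gtop Y) (Q i A)" if "A \<in> \<O>" for A
  proof -
    have "continuous_map (gtop Y) euclidean (\<lambda>y. r A (i, y))"
      using C_G_D(1)[OF r(1)[OF that]] i unfolding continuous_map_copies by blast
    from openin_continuous_map_preimage[OF this, of "{w. 1 / 2 < Re w}"] show ?thesis
      unfolding Q_def by (simp only: open_openin[symmetric] open_halfspace_Re_gt mem_Collect_eq simp_thms)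
  qed
  have "bij_morphism (Q i \<circ> e) M (open_struct Y (Q i ` \<O>) (lgrp M) (lnbh M))"
    unfolding bij_morphism_def
  proof (intro conjI allI impI ballI)
    have "bij_betw e (verts M) \<O>"
      using e by (simp add: bij_morphism_def open_struct_def)
    then show "bij_betw (Q i \<circ> e) (verts M) (verts (open_struct Y (Q i ` \<O>) (lgrp M) (lnbh M)))"
      using bij_betw_trans[OF _ inj_on_imp_bij_betw[OF inj]] by (simp add: open_struct_def)
  next
    fix g W a b assume "(a, b) \<in> relE M g W"
    then have "(e a, e b) \<in> relE (open_struct ?Z \<O> (lgrp M) (lnbh M)) g W"
      using e unfolding bij_morphism_def by blast
    then have *: "g \<in> lgrp M" "W \<in> lnbh M" "e a \<in> \<O>" "e b \<in> \<O>" "sepZ g W (e a) (e b)"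
      by (auto simp: open_struct_def sepZ_def)
    from i4[OF this] * show "((Q i \<circ> e) a, (Q i \<circ> e) b) \<in> relE (open_struct Y (Q i ` \<O>) (lgrp M) (lnbh M)) g W"
      by (simp add: open_struct_def sep_def)
  next
    fix n t assume "t \<in> relC M n"
    then have "map e t \<in> relC (open_struct ?Z \<O> (lgrp M) (lnbh M)) n"
      using e unfolding bij_morphism_def by blast
    then have *: "1 \<le> n" "length t = n" "e ` set t \<subseteq> \<O>" "\<Union> (e ` set t) = points ?Z"
      by (auto simp: open_struct_def)
    from i3[OF *(3,4)] *(1-3) show "map (Q i \<circ> e) t \<in> relC (open_struct Y (Q i ` \<O>) (lgrp M) (lnbh M)) n"
      by (auto simp: open_struct_def image_comp)
  qed
  then show ?thesis
    unfolding realizes_def using O(1) op i1 by (intro exI[of _ "Q i ` \<O>"]) auto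
qed

theorem weak_type_mono:
  assumes N: "symmetric_base \<N>" and Y: "is_flow Y" and XY: "weakly_contained_over TYPE('i) X Y"
  shows "weak_type \<N> X \<subseteq> weak_type \<N> Y"
proof
  have Y: "is_gspace Y"
    using Y by (simp add: is_flow_def)
  obtain I :: "'i set" and \<U> f where U: "\<U> \<in> ultrafilters_on I" and f: "is_factor_map (ultracopower I \<U> Y) X f"
    using XY unfolding weakly_contained_over_def is_factor_of_def by blast
  fix M assume M: "M \<in> weak_type \<N> X"
  then have "realizes X M"
    by (simp add: weak_type_def tp_over_def)
  with f gact_ultracopower_closed[OF Y U] have "realizes (ultracopower I \<U> Y) M"
    by (rule realizes_factor)
  moreover have "finite (lgrp M)" "finite (lnbh M)" "lnbh M \<subseteq> RPC_nbhds \<N>"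
    using M by (auto simp: weak_type_def tp_over_def Str_over_def Str_def is_lstruct_def)
  ultimately have "realizes Y M"
    by (rule realizes_if_ultracopower_realizes[OF N Y U])
  with M show "M \<in> weak_type \<N> Y"
    by (simp add: weak_type_def tp_over_def)
qed

section \<open>Ultrafilters on directed sets and covers by small sets\<close>

lemma ultrafilter_below:
  assumes "F \<noteq> bot" "F \<le> principal I"
  shows "\<exists>\<U>\<in>ultrafilters_on I. \<U> \<le> F"
proof -
  define A where "A = {G. G \<noteq> bot \<and> G \<le> F}"
  have "\<exists>m\<in>A. \<forall>G\<in>A. G \<le> m \<longrightarrow> G = m"
  proof (rule predicate_Zorn)
    show "partial_order_on A (relation_of (\<lambda>G H. H \<le> G) A)"
      by (rule partial_order_on_relation_ofI) auto
    fix C assume C: "C \<in> Chains (relation_of (\<lambda>G H. H \<le> G) A)"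
    then have CA: "C \<subseteq> A"
      by (auto simp: Chains_def relation_of_def)
    have ch: "G \<le> H \<or> H \<le> G" if "G \<in> insert F C" "H \<in> insert F C" for G H
      using that C CA by (auto simp: Chains_def relation_of_def A_def)
    have "eventually P (Inf (insert F C)) \<longleftrightarrow> (\<exists>b\<in>insert F C. eventually P b)" for P
      by (rule eventually_Inf_base) (use ch in \<open>auto simp: le_inf_iff\<close>)
    from this[of "\<lambda>_. False"] have "Inf (insert F C) \<noteq> bot"
      using CA assms(1) by (auto simp: A_def eventually_False simp flip: trivial_limit_def)
    moreover have "Inf (insert F C) \<le> G" if "G \<in> insert F C" for G
      using that by (rule Inf_lower)
    ultimately show "\<exists>u\<in>A. \<forall>a\<in>C. u \<le> a"
      by (intro bexI[of _ "Inf (insert F C)"]) (auto simp: A_def)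
  qed
  then obtain m where m: "m \<noteq> bot" "m \<le> F" and max: "\<And>G. G \<noteq> bot \<Longrightarrow> G \<le> m \<Longrightarrow> G = m"
    unfolding A_def by (auto intro: order_trans)
  have "eventually P m \<or> eventually (\<lambda>i. \<not> P i) m" for P
  proof (rule disjCI)
    assume *: "\<not> eventually (\<lambda>i. \<not> P i) m"
    have "inf m (principal {i. P i}) = m"
    proof (rule max)
      show "inf m (principal {i. P i}) \<noteq> bot"
        using * by (auto simp: trivial_limit_def eventually_inf_principal)
    qed simp
    moreover have "eventually P (inf m (principal {i. P i}))"
      by (simp add: eventually_inf_principal)
    ultimately show "eventually P m"
      by simp
  qed
  with m assms(2) show ?thesis
    by (intro bexI[of _ m]) (auto simp: ultrafilters_on_def)
qed

lemma ultrafilter_directed: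
  assumes ne: "I \<noteq> {}" and dir: "\<And>i j. i \<in> I \<Longrightarrow> j \<in> I \<Longrightarrow> \<exists>k\<in>I. \<forall>l. R k l \<longrightarrow> R i l \<and> R j l"
    and refl: "\<And>i. R i i"
  shows "\<exists>\<U>\<in>ultrafilters_on I. \<forall>i\<in>I. eventually (R i) \<U>"
proof -
  define B where "B = (\<lambda>i. principal {j \<in> I. R i j}) ` I"
  have ev: "eventually P (Inf B) \<longleftrightarrow> (\<exists>b\<in>B. eventually P b)" for P
  proof (rule eventually_Inf_base)
    show "B \<noteq> {}"
      using ne by (simp add: B_def)
    fix F G assume "F \<in> B" "G \<in> B"
    then obtain i j where ij: "i \<in> I" "F = principal {l \<in> I. R i l}" "j \<in> I" "G = principal {l \<in> I. R j l}"
      by (auto simp: B_def)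
    obtain k where k: "k \<in> I" "\<forall>l. R k l \<longrightarrow> R i l \<and> R j l"
      using dir[OF ij(1,3)] by blast
    then have "principal {l \<in> I. R k l} \<le> inf F G"
      unfolding ij by (auto simp: le_inf_iff)
    then show "\<exists>x\<in>B. x \<le> inf F G"
      using k(1) by (auto simp: B_def)
  qed
  have "Inf B \<noteq> bot"
    using ev[of "\<lambda>_. False"] refl by (auto simp: trivial_limit_def B_def eventually_principal)
  moreover have "Inf B \<le> principal I"
  proof -
    obtain i where "i \<in> I"
      using ne by blast
    then have "Inf B \<le> principal {j \<in> I. R i j}"
      by (intro Inf_lower) (simp add: B_def)
    then show ?thesis
      by (rule order_trans) auto
  qed
  ultimately obtain \<U> where U: "\<U> \<in> ultrafilters_on I" "\<U> \<le> Inf B"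
    using ultrafilter_below by blast
  have "eventually (R i) \<U>" if "i \<in> I" for i
  proof -
    have "eventually (R i) (Inf B)"
      unfolding ev using that by (auto simp: B_def eventually_principal)
    with U(2) show ?thesis
      by (simp add: le_filter_def)
  qed
  with U(1) show ?thesis
    by blast
qed

lemma flow_uniform:
  fixes p :: "'x \<Rightarrow> 'a::metric_space" and X :: "('g::{topological_group_add, t2_space}, 'x) gspace"
  assumes X: "is_flow X" and p: "continuous_map (gtop X) euclidean p" and "e > 0"
  shows "\<exists>V. open V \<and> 0 \<in> V \<and> (\<forall>v\<in>V. \<forall>x\<in>points X. dist (p (gact X v x)) (p x) < e)"
proof -
  let ?P = "prod_topology euclidean (gtop X) :: ('g \<times> 'x) topology"
  have gs: "is_gspace X" and K: "compactin (gtop X) (points X)"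
    using X by (auto simp: is_flow_def compact_space_def)
  have "continuous_map ?P (gtop X) (\<lambda>z. gact X (fst z) (snd z))"
    using gs by (simp add: is_gspace_def case_prod_unfold)
  from continuous_map_compose[OF this p] have 1: "continuous_map ?P euclidean (\<lambda>z. p (gact X (fst z) (snd z)))"
    by (simp add: o_def)
  have 2: "continuous_map ?P euclidean (\<lambda>z. p (snd z))"
    using continuous_map_compose[OF continuous_map_snd p] by (simp add: o_def)
  have "continuous_map ?P euclideanreal (\<lambda>z. dist (p (gact X (fst z) (snd z))) (p (snd z)))"
    using 1 2 by (simp add: continuous_map_atin tendsto_dist)
  then have W: "openin ?P {z \<in> topspace ?P. dist (p (gact X (fst z) (snd z))) (p (snd z)) \<in> {..<e}}"
    by (rule openin_continuous_map_preimage) simp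
  have sub: "{0} \<times> points X \<subseteq> {z \<in> topspace ?P. dist (p (gact X (fst z) (snd z))) (p (snd z)) \<in> {..<e}}"
    using \<open>e > 0\<close> by (auto simp: gact_zero[OF gs])
  obtain V S where VS: "open V" "0 \<in> V" "points X \<subseteq> S"
      "V \<times> S \<subseteq> {z \<in> topspace ?P. dist (p (gact X (fst z) (snd z))) (p (snd z)) \<in> {..<e}}"
    using tube_lemma_right[OF W K _ sub] by auto
  then show ?thesis
    by (intro exI[of _ V]) (auto simp: subset_iff)
qed

lemma finite_cover_small_oscillation:
  fixes \<Phi> :: "('x \<Rightarrow> 'a::metric_space) set"
  assumes X: "compact_space T" and \<Phi>: "finite \<Phi>" "\<And>p. p \<in> \<Phi> \<Longrightarrow> continuous_map T euclidean p" and "e > 0"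
  shows "\<exists>\<O>. finite \<O> \<and> (\<forall>A\<in>\<O>. openin T A \<and> A \<noteq> {}) \<and> \<Union>\<O> = topspace T
    \<and> (\<forall>A\<in>\<O>. \<forall>p\<in>\<Phi>. \<forall>a\<in>A. \<forall>b\<in>A. dist (p a) (p b) < e)"
proof -
  define N where "N x = topspace T \<inter> (\<Inter>p\<in>\<Phi>. {y \<in> topspace T. p y \<in> ball (p x) (e / 2)})" for x
  have "openin T (N x)" for x
  proof (cases "\<Phi> = {}")
    case False
    have "openin T {y \<in> topspace T. p y \<in> ball (p x) (e / 2)}" if "p \<in> \<Phi>" for p
      by (rule openin_continuous_map_preimage[OF \<Phi>(2)[OF that]]) simp
    then show ?thesis
      unfolding N_def using False \<Phi>(1) by (intro openin_Int openin_INT) auto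
  qed (simp add: N_def)
  then have "\<forall>S\<in>N ` topspace T. openin T S"
    by blast
  moreover have xN: "x \<in> N x" if "x \<in> topspace T" for x
    using that \<open>e > 0\<close> by (simp add: N_def)
  then have "topspace T \<subseteq> \<Union> (N ` topspace T)"
    by blast
  ultimately obtain \<F> where F: "finite \<F>" "\<F> \<subseteq> N ` topspace T" "topspace T \<subseteq> \<Union>\<F>"
    using X unfolding compact_space_alt by meson
  have "dist (p a) (p b) < e" if "p \<in> \<Phi>" "a \<in> N x" "b \<in> N x" for p a b x
  proof -
    have "dist (p x) (p a) < e / 2" "dist (p x) (p b) < e / 2"
      using that by (auto simp: N_def)
    then show ?thesis
      by (rule dist_triangle_half_r)
  qed
  moreover have "openin T A \<and> A \<noteq> {}" if "A \<in> \<F>" for A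
    using F(2) that xN \<open>\<And>x. openin T (N x)\<close> by blast
  moreover have "\<Union>\<F> = topspace T"
    using F(2,3) by (auto simp: N_def)
  ultimately show ?thesis
    using F(1,2) by (intro exI[of _ \<F>]) blast
qed

definition separated :: "('g, 'x) gspace \<Rightarrow> 'g set \<Rightarrow> 'g \<Rightarrow> 'x set \<Rightarrow> 'x set \<Rightarrow> bool" where
  "separated X U g A B \<longleftrightarrow>
     (gtop X closure_of (gact X g ` A)) \<times> (gtop X closure_of B) \<inter> R_rel X U = {}"

lemma tp_over_transfer:
  fixes X :: "('g::{topological_group_add, t2_space}, 'x) gspace" and Y :: "('g, 'y) gspace"
  assumes sub: "push_struct \<zeta> ` tp_over H \<B> X \<subseteq> tp_over H \<B> Y"
    and O: "finite \<O>" "\<forall>A\<in>\<O>. openin (gtop X) A \<and> A \<noteq> {}"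
    and F: "finite F" "F \<subseteq> H" and N: "finite N" "N \<subseteq> \<B>"
  shows "\<exists>s. (\<forall>A\<in>\<O>. openin (gtop Y) (s A) \<and> s A \<noteq> {})
    \<and> (\<forall>\<S>\<subseteq>\<O>. \<S> \<noteq> {} \<longrightarrow> \<Union>\<S> = points X \<longrightarrow> \<Union> (s ` \<S>) = points Y)
    \<and> (\<forall>g\<in>F. \<forall>U\<in>N. \<forall>A\<in>\<O>. \<forall>B\<in>\<O>. separated X U g A B \<longrightarrow> separated Y (\<zeta> U) g (s A) (s B))"
proof -
  obtain b where b0: "bij_betw b {0..<card \<O>} \<O>"
    using ex_bij_betw_nat_finite[OF O(1)] by blast
  define n where "n = card \<O>"
  have b: "bij_betw b {..<n} \<O>"
    using b0 by (simp add: n_def atLeast0LessThan)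
  let ?S = "open_struct X \<O> F N"
  define M :: "('g, nat) lstruct" where "M = \<lparr> verts = {..<n}, lgrp = F, lnbh = N,
     relE = (\<lambda>g U. {(a, c). a < n \<and> c < n \<and> (b a, b c) \<in> relE ?S g U}),
     relC = (\<lambda>k. {t. set t \<subseteq> {..<n} \<and> map b t \<in> relC ?S k}) \<rparr>"
  have "M \<in> Str F N"
    by (auto simp: Str_def is_lstruct_def M_def open_struct_def)
  moreover have "realizes X M"
    unfolding realizes_def
  proof (intro exI conjI)
    show "bij_morphism b M (open_struct X \<O> (lgrp M) (lnbh M))"
      using b unfolding bij_morphism_def by (auto simp: M_def open_struct_def)
  qed (use O in auto)
  ultimately have "M \<in> tp_over H \<B> X"
    using F N by (auto simp: tp_over_def Str_over_def)
  then have "realizes Y (push_struct \<zeta> M)"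
    using sub by (auto simp: tp_over_def)
  then obtain \<O>' e where O': "\<And>A. A \<in> \<O>' \<Longrightarrow> openin (gtop Y) A \<and> A \<noteq> {}"
      and e: "bij_morphism e (push_struct \<zeta> M) (open_struct Y \<O>' F (\<zeta> ` N))"
    unfolding realizes_def by (auto simp: push_struct_def M_def)
  have eb: "bij_betw e {..<n} \<O>'"
    using e by (simp add: bij_morphism_def push_struct_def M_def open_struct_def)
  define b' where "b' = inv_into {..<n} b"
  have b': "b' A < n" "b (b' A) = A" if "A \<in> \<O>" for A
    using that bij_betw_inv_into_right[OF b that] inv_into_into[of A b "{..<n}"] bij_betw_imp_surj_on[OF b]
    by (auto simp: b'_def)
  define s where "s A = e (b' A)" for A
  have sO: "s A \<in> \<O>'" if "A \<in> \<O>" for A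
    using bij_betwE[OF eb] b'(1)[OF that] by (simp add: s_def)
  show ?thesis
  proof (intro exI[of _ s] conjI ballI allI impI)
    show "openin (gtop Y) (s A)" "s A \<noteq> {}" if "A \<in> \<O>" for A
      using O'[OF sO[OF that]] by auto
    show "\<Union> (s ` \<S>) = points Y" if S: "\<S> \<subseteq> \<O>" "\<S> \<noteq> {}" "\<Union>\<S> = points X" for \<S>
    proof -
      have "finite (b' ` \<S>)"
        using finite_subset[OF S(1) O(1)] by simp
      then obtain t where t: "set t = b' ` \<S>"
        using finite_list by blast
      have "b ` b' ` \<S> = \<S>"
        using b'(2) S(1) by force
      then have "t \<in> relC M (length t)"
        using t S b'(1) by (cases t) (auto simp: M_def open_struct_def)
      then have "map e t \<in> relC (open_struct Y \<O>' F (\<zeta> ` N)) (length t)"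
        using e unfolding bij_morphism_def by (simp add: push_struct_def)
      then have "\<Union> (e ` set t) = points Y"
        by (simp add: open_struct_def)
      then show ?thesis
        by (simp add: t s_def image_comp o_def)
    qed
    show "separated Y (\<zeta> U) g (s A) (s B)"
      if *: "g \<in> F" "U \<in> N" "A \<in> \<O>" "B \<in> \<O>" "separated X U g A B" for g U A B
    proof -
      have "(b' A, b' B) \<in> relE M g U"
        using * b' by (simp add: M_def open_struct_def separated_def)
      then have "(b' A, b' B) \<in> relE (push_struct \<zeta> M) g (\<zeta> U)"
        using *(2) by (auto simp: push_struct_def M_def)
      then have "(s A, s B) \<in> relE (open_struct Y \<O>' F (\<zeta> ` N)) g (\<zeta> U)"
        using e unfolding bij_morphism_def s_def by blast
      then show ?thesis
        by (simp add: open_struct_def separated_def)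
    qed
  qed
qed

section \<open>A factor map from compatible covers\<close>

text \<open>A point \<open>x\<close> is related to \<open>\<phi>\<close> when, for every neighbourhood \<open>D\<close> of \<open>x\<close>, \<open>\<phi>\<close> lies in the closure of the
  copies of the sets \<open>s i A\<close> with \<open>A\<close> meeting \<open>D\<close>; the condition is stated by means of the ideal of functions
  that vanish on these copies.\<close>

locale compatible_covers =
  fixes I :: "'i set" and \<U> :: "'i filter"
    and X :: "('g::{topological_group_add, t2_space}, 'x) gspace" and Y :: "('g, 'y) gspace"
    and \<O> :: "'i \<Rightarrow> 'x set set" and s :: "'i \<Rightarrow> 'x set \<Rightarrow> 'y set"
  assumes X: "is_flow X" and Y: "is_flow Y" and U: "\<U> \<in> ultrafilters_on I"
    and finite_cover: "i \<in> I \<Longrightarrow> finite (\<O> i)"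
    and cover: "i \<in> I \<Longrightarrow> \<Union> (\<O> i) = points X"
    and cover': "i \<in> I \<Longrightarrow> \<Union> (s i ` \<O> i) = points Y"
    and nonempty: "i \<in> I \<Longrightarrow> A \<in> \<O> i \<Longrightarrow> A \<noteq> {} \<and> s i A \<noteq> {}"
begin

lemma gspace: "is_gspace X" "is_gspace Y" "is_gspace (copies I Y)"
  using X Y by (auto simp: is_flow_def intro: is_gspace_copies)

definition trace :: "'x set \<Rightarrow> ('i \<times> 'y) set" where
  "trace D = {(i, y). i \<in> I \<and> (\<exists>A\<in>\<O> i. A \<inter> D \<noteq> {} \<and> y \<in> s i A)}"

definition related :: "'x \<Rightarrow> (('i \<times> 'y \<Rightarrow> complex) \<Rightarrow> complex) \<Rightarrow> bool" where
  "related x \<phi> \<longleftrightarrow> x \<in> points X \<and> (\<forall>D. openin (gtop X) D \<and> x \<in> D \<longrightarrow>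
     (\<forall>q\<in>C_G (copies I Y). (\<forall>z\<in>trace D. q z = 0) \<longrightarrow> \<phi> q = 0))"

lemma trace_points: "trace D \<subseteq> points (copies I Y)"
  using cover' by (auto simp: trace_def)

lemma related_closed:
  assumes \<phi>: "\<phi> \<in> points (ultracopower I \<U> Y)" and x: "related x \<phi>" and D: "openin (gtop X) D" "x \<in> D"
    and p: "p \<in> C_G (copies I Y)" and C: "closed C" "C \<noteq> {}"
    and ev: "eventually (\<lambda>i. \<forall>y. (i, y) \<in> trace D \<longrightarrow> p (i, y) \<in> C) \<U>"
  shows "\<phi> p \<in> C"
proof -
  define P where "P i \<longleftrightarrow> (\<forall>y. (i, y) \<in> trace D \<longrightarrow> p (i, y) \<in> C)" for i
  define F where "F w = complex_of_real (infdist w C)" for w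
  have F: "continuous_on UNIV F"
    unfolding F_def by (intro continuous_intros)
  have W: "\<phi> \<in> points (gelfand (copies I Y))"
    using \<phi> points_ultracopower_subset by blast
  note ch = gelfandD[OF W]
  have Fp: "(\<lambda>z\<in>points (copies I Y). F (p z)) \<in> C_G (copies I Y)"
    by (rule C_G_comp[OF gspace(3) p F]) auto
  let ?q = "\<lambda>z\<in>points (copies I Y). (\<lambda>z\<in>points (copies I Y). F (p z)) z * copy_indicator I Y P z"
  have q: "?q \<in> C_G (copies I Y)"
    by (rule C_G_mult[OF gspace(3) Fp copy_indicator_C_G[OF gspace(2)]])
  have "?q z = 0" if z: "z \<in> trace D" for z
  proof -
    obtain i y where iy: "z = (i, y)"
      by (cases z)
    have "i \<in> I" "y \<in> points Y"
      using trace_points z iy by auto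
    then show ?thesis
      using z by (auto simp: iy P_def F_def)
  qed
  then have "\<phi> ?q = 0"
    using x D q unfolding related_def by blast
  moreover have "\<phi> ?q = F (\<phi> p) * \<phi> (copy_indicator I Y P)"
    by (simp only: char_mult[OF gspace(3) ch Fp copy_indicator_C_G[OF gspace(2)]] char_comp[OF gspace(3) ch p F])
  moreover have "\<phi> (copy_indicator I Y P) = 1"
    using \<phi> ev unfolding mem_ultracopower_iff[OF gspace(2) U] P_def by blast
  ultimately have "infdist (\<phi> p) C = 0"
    by (simp add: F_def)
  then show ?thesis
    using in_closed_iff_infdist_zero[OF C] by blast
qed

lemma unrelated_compact:
  assumes K: "compactin (gtop X) K" and \<phi>: "\<phi> \<in> points (gelfand (copies I Y))"
    and un: "\<forall>x\<in>K. \<not> related x \<phi>"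
  shows "\<exists>D q. openin (gtop X) D \<and> K \<subseteq> D \<and> q \<in> C_G (copies I Y) \<and> (\<forall>z\<in>trace D. q z = 0) \<and> \<phi> q \<noteq> 0"
proof -
  note ch = gelfandD[OF \<phi>]
  define \<D> where "\<D> = {D. openin (gtop X) D \<and> (\<exists>q\<in>C_G (copies I Y). (\<forall>z\<in>trace D. q z = 0) \<and> \<phi> q \<noteq> 0)}"
  have "\<forall>D\<in>\<D>. openin (gtop X) D"
    by (simp add: \<D>_def)
  moreover have "K \<subseteq> \<Union>\<D>"
  proof
    fix x assume x: "x \<in> K"
    then have "x \<in> points X"
      using compactin_subset_topspace[OF K] by blast
    then obtain D where "openin (gtop X) D" "x \<in> D" "\<exists>q\<in>C_G (copies I Y). (\<forall>z\<in>trace D. q z = 0) \<and> \<phi> q \<noteq> 0"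
      using un[rule_format, OF x] unfolding related_def by blast
    then show "x \<in> \<Union>\<D>"
      unfolding \<D>_def by blast
  qed
  ultimately obtain \<F> where F: "finite \<F>" "\<F> \<subseteq> \<D>" "K \<subseteq> \<Union>\<F>"
    using K unfolding compactin_def by meson
  have "\<Union>\<F> \<in> \<D>"
    using F(1,2)
  proof (induction \<F>)
    case empty
    have "\<phi> (\<lambda>z\<in>points (copies I Y). 1) \<noteq> 0"
      unfolding char_one[OF gspace(3) ch] by simp
    then show ?case
      using C_G_const[OF gspace(3), of 1] by (auto simp: \<D>_def trace_def)
  next
    case (insert D \<F>)
    then obtain q q' where q: "openin (gtop X) D" "q \<in> C_G (copies I Y)" "\<forall>z\<in>trace D. q z = 0" "\<phi> q \<noteq> 0"
        and q': "openin (gtop X) (\<Union>\<F>)" "q' \<in> C_G (copies I Y)" "\<forall>z\<in>trace (\<Union>\<F>). q' z = 0" "\<phi> q' \<noteq> 0"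
      by (auto simp: \<D>_def)
    let ?q = "\<lambda>z\<in>points (copies I Y). q z * q' z"
    have "\<phi> ?q \<noteq> 0"
      unfolding char_mult[OF gspace(3) ch q(2) q'(2)] using q(4) q'(4) by simp
    moreover have "\<forall>z\<in>trace (D \<union> \<Union>\<F>). ?q z = 0"
    proof
      fix z assume z: "z \<in> trace (D \<union> \<Union>\<F>)"
      then have "z \<in> trace D \<or> z \<in> trace (\<Union>\<F>)"
        unfolding trace_def by blast
      then have "q z * q' z = 0"
        using q(3) q'(3) by auto
      then show "?q z = 0"
        by (simp only: restrict_apply'[OF subsetD[OF trace_points z]])
    qed
    ultimately show ?case
      using openin_Un[OF q(1) q'(1)] C_G_mult[OF gspace(3) q(2) q'(2)] unfolding \<D>_def Union_insert by blast
  qed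
  with F(3) show ?thesis
    unfolding \<D>_def by blast
qed

lemma ex_related:
  assumes \<phi>: "\<phi> \<in> points (gelfand (copies I Y))"
  shows "\<exists>x. related x \<phi>"
proof (rule ccontr)
  assume "\<not> ?thesis"
  moreover have "compactin (gtop X) (points X)"
    using X by (simp add: is_flow_def compact_space_def)
  ultimately obtain D q where D: "points X \<subseteq> D" and q: "q \<in> C_G (copies I Y)" "\<forall>z\<in>trace D. q z = 0" "\<phi> q \<noteq> 0"
    using unrelated_compact[OF _ \<phi>, of "points X"] by blast
  have "q = (\<lambda>z\<in>points (copies I Y). 0)"
  proof (rule C_G_ext[OF q(1) C_G_const[OF gspace(3)]])
    fix z assume z: "z \<in> points (copies I Y)"
    then obtain i y where iy: "z = (i, y)" "i \<in> I" "y \<in> points Y"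
      by auto
    then obtain A where A: "A \<in> \<O> i" "y \<in> s i A"
      using cover'[OF iy(2)] by blast
    have "A \<inter> D \<noteq> {}"
      using A(1) nonempty[OF iy(2)] cover[OF iy(2)] D by blast
    with A iy have "z \<in> trace D"
      by (auto simp: trace_def)
    with q(2) z show "q z = (\<lambda>z\<in>points (copies I Y). 0) z"
      by simp
  qed
  then have "\<phi> q = 0"
    using char_const[OF gspace(3) gelfandD[OF \<phi>], of 0] by (simp only:)
  with q(3) show False
    by simp
qed

lemma related_surj:
  assumes x: "x \<in> points X"
  shows "\<exists>\<phi>\<in>points (ultracopower I \<U> Y). related x \<phi>"
proof -
  have "\<forall>i\<in>I. \<exists>y. \<exists>A\<in>\<O> i. x \<in> A \<and> y \<in> s i A"
    using cover nonempty x by (metis UnionE equals0I)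
  then obtain y where y: "\<And>i. i \<in> I \<Longrightarrow> \<exists>A\<in>\<O> i. x \<in> A \<and> y i \<in> s i A"
    by metis
  have "eventually (\<lambda>i. y i \<in> points Y) \<U>"
    using ultrafilters_onD(2)[OF U]
  proof eventually_elim
    case (elim i)
    then show ?case
      using y[OF elim] cover'[OF elim] by blast
  qed
  note Z = limit_char_ultracopower[OF gspace(2) U this]
  have "related x (limit_char \<U> (copies I Y) (\<lambda>i. (i, y i)))"
    unfolding related_def
  proof (intro conjI x allI impI ballI)
    fix D q assume D: "openin (gtop X) D \<and> x \<in> D" and q: "q \<in> C_G (copies I Y)" "\<forall>z\<in>trace D. q z = 0"
    have "eventually (\<lambda>i. 0 = q (i, y i)) \<U>"
      using ultrafilters_onD(2)[OF U]
    proof eventually_elim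
      case (elim i)
      then have "(i, y i) \<in> trace D"
        using y[OF elim] D by (auto simp: trace_def)
      then show ?case
        using q(2) by simp
    qed
    with tendsto_const show "limit_char \<U> (copies I Y) (\<lambda>i. (i, y i)) q = 0"
      by (intro limit_char_eq[OF U q(1)]) (rule Lim_transform_eventually)
  qed
  with Z show ?thesis
    by blast
qed

lemma factor_of_ultracopower:
  assumes eq: "\<And>x x' g \<phi>. \<phi> \<in> points (ultracopower I \<U> Y) \<Longrightarrow> related x \<phi>
      \<Longrightarrow> related x' (gact (ultracopower I \<U> Y) g \<phi>) \<Longrightarrow> x' = gact X g x"
  shows "is_factor_of X (ultracopower I \<U> Y)"
proof -
  let ?Z = "ultracopower I \<U> Y"
  define f where "f \<phi> = (SOME x. related x \<phi>)" for \<phi>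
  have f: "related (f \<phi>) \<phi>" if "\<phi> \<in> points ?Z" for \<phi>
  proof -
    have "\<exists>x. related x \<phi>"
      using ex_related that points_ultracopower_subset by blast
    then show ?thesis
      unfolding f_def by (rule someI_ex)
  qed
  then have fX: "f \<phi> \<in> points X" if "\<phi> \<in> points ?Z" for \<phi>
    using that by (simp add: related_def)
  have zero: "gact ?Z 0 \<phi> = \<phi>" if "\<phi> \<in> points ?Z" for \<phi>
  proof (rule extensionalityI[where A = "C_G (copies I Y)"])
    have W: "\<phi> \<in> points (gelfand (copies I Y))"
      using that points_ultracopower_subset by blast
    then show "\<phi> \<in> extensional (C_G (copies I Y))"
      by (simp add: points_gelfand)
    show "gact ?Z 0 \<phi> \<in> extensional (C_G (copies I Y))"
      by (simp add: gact_ultracopower gelfand_def)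
    fix p assume p: "p \<in> C_G (copies I Y)"
    have "translate (copies I Y) p 0 = p"
      by (rule C_G_ext[OF C_G_translate[OF gspace(3) p] p]) (simp add: gact_zero[OF gspace(3)] del: points_copies)
    then show "gact ?Z 0 \<phi> p = \<phi> p"
      by (simp add: gact_ultracopower gact_gelfand[OF p])
  qed
  have unique: "x = f \<phi>" if "\<phi> \<in> points ?Z" "related x \<phi>" for x \<phi>
    using eq[OF that(1) f[OF that(1)], of x 0] that(2) zero[OF that(1)] gact_zero[OF gspace(1) fX[OF that(1)]]
    by simp
  have "is_factor_map ?Z X f"
    unfolding is_factor_map_def
  proof (intro conjI allI ballI)
    show "f (gact ?Z g \<phi>) = gact X g (f \<phi>)" if "\<phi> \<in> points ?Z" for g \<phi>
      by (rule eq[OF that f[OF that] f[OF gact_ultracopower_closed[OF gspace(2) U that]]])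
    show "f ` points ?Z = points X"
    proof
      show "f ` points ?Z \<subseteq> points X"
        using fX by blast
      show "points X \<subseteq> f ` points ?Z"
      proof
        fix x assume "x \<in> points X"
        then obtain \<phi> where "\<phi> \<in> points ?Z" "related x \<phi>"
          using related_surj by blast
        with unique show "x \<in> f ` points ?Z"
          by (intro image_eqI)
      qed
    qed
    show "continuous_map (gtop ?Z) (gtop X) f"
      unfolding continuous_map_def
    proof (intro conjI allI impI)
      show "f \<in> points ?Z \<rightarrow> points X"
        using fX by blast
      fix E assume E: "openin (gtop X) E"
      show "openin (gtop ?Z) {\<phi> \<in> points ?Z. f \<phi> \<in> E}"
      proof (subst openin_subopen, intro ballI)
        fix \<phi> assume \<phi>: "\<phi> \<in> {\<phi> \<in> points ?Z. f \<phi> \<in> E}"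
        have "closedin (gtop X) (points X - E)"
          using E by blast
        then have K: "compactin (gtop X) (points X - E)"
          using X by (simp add: is_flow_def closedin_compact_space)
        have W: "\<phi> \<in> points (gelfand (copies I Y))"
          using \<phi> points_ultracopower_subset by blast
        have un: "\<forall>x\<in>points X - E. \<not> related x \<phi>"
          using unique[of \<phi>] \<phi> by auto
        obtain D q where D: "openin (gtop X) D" "points X - E \<subseteq> D"
            and q: "q \<in> C_G (copies I Y)" "\<forall>z\<in>trace D. q z = 0" "\<phi> q \<noteq> 0"
          using unrelated_compact[OF K W un] by (elim exE conjE) (rule that)
        have "continuous_map (gtop ?Z) euclidean (\<lambda>\<phi>. \<phi> q)"
          by (subst gtop_ultracopower) (rule continuous_map_from_subtopology[OF continuous_map_gelfand_apply[OF q(1)]])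
        then have "openin (gtop ?Z) {\<psi> \<in> points ?Z. \<psi> q \<in> - {0}}"
          by (rule openin_continuous_map_preimage) (simp add: open_Compl)
        moreover have "{\<psi> \<in> points ?Z. \<psi> q \<in> - {0}} \<subseteq> {\<psi> \<in> points ?Z. f \<psi> \<in> E}"
        proof clarify
          fix \<psi> assume \<psi>: "\<psi> \<in> points ?Z" "\<psi> q \<noteq> 0"
          have "f \<psi> \<notin> D"
            using f[OF \<psi>(1)] D(1) q(1,2) \<psi>(2) unfolding related_def by blast
          then show "f \<psi> \<in> E"
            using D(2) fX[OF \<psi>(1)] by blast
        qed
        ultimately show "\<exists>T. openin (gtop ?Z) T \<and> \<phi> \<in> T \<and> T \<subseteq> {\<phi> \<in> points ?Z. f \<phi> \<in> E}"
          using \<phi> q(3) by (intro exI[of _ "{\<psi> \<in> points ?Z. \<psi> q \<in> - {0}}"]) blast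
      qed
    qed
  qed
  then show ?thesis
    unfolding is_factor_of_def by blast
qed

end

section \<open>Weak containment from weak types\<close>

lemma separated_by_function:
  assumes X: "is_gspace X" and \<psi>: "continuous_map (gtop X) euclideanreal \<psi>"
    and V: "\<And>v x. v \<in> V \<Longrightarrow> x \<in> points X \<Longrightarrow> dist (\<psi> (gact X v x)) (\<psi> x) \<le> d"
    and A: "A \<subseteq> points X" "\<And>a. a \<in> A \<Longrightarrow> \<psi> (gact X h a) \<le> r"
    and B: "B \<subseteq> points X" "\<And>b. b \<in> B \<Longrightarrow> r' \<le> \<psi> b" and "r + d < r'"
  shows "separated X V h A B"
  unfolding separated_def
proof (intro equals0I, elim IntE SigmaE)
  fix p a b
  assume ab: "a \<in> gtop X closure_of (gact X h ` A)" "b \<in> gtop X closure_of B" "p \<in> R_rel X V" "p = (a, b)"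
  have "a \<in> {x \<in> points X. \<psi> x \<in> {..r}}"
    by (rule subsetD[OF closure_of_minimal[OF _ closedin_continuous_map_preimage[OF \<psi>]] ab(1)])
       (use A gact_closed[OF X] in auto)
  moreover have "b \<in> {x \<in> points X. \<psi> x \<in> {r'..}}"
    by (rule subsetD[OF closure_of_minimal[OF _ closedin_continuous_map_preimage[OF \<psi>]] ab(2)])
       (use B in auto)
  moreover have "(a, b) \<in> {z \<in> topspace (prod_topology (gtop X) (gtop X)). dist (\<psi> (snd z)) (\<psi> (fst z)) \<in> {..d}}"
  proof (rule subsetD[OF closure_of_minimal[OF _ closedin_continuous_map_preimage]])
    show "(a, b) \<in> prod_topology (gtop X) (gtop X) closure_of {(x, gact X g x) |x g. x \<in> points X \<and> g \<in> V}"
      using ab(3,4) by (simp add: R_rel_def)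
    show "{(x, gact X g x) |x g. x \<in> points X \<and> g \<in> V}
        \<subseteq> {z \<in> topspace (prod_topology (gtop X) (gtop X)). dist (\<psi> (snd z)) (\<psi> (fst z)) \<in> {..d}}"
      using V gact_closed[OF X] by auto
    have "continuous_map (prod_topology (gtop X) (gtop X)) euclideanreal (\<lambda>z. \<psi> (snd z))"
      "continuous_map (prod_topology (gtop X) (gtop X)) euclideanreal (\<lambda>z. \<psi> (fst z))"
      using continuous_map_compose[OF continuous_map_snd \<psi>] continuous_map_compose[OF continuous_map_fst \<psi>]
      by (simp_all add: o_def)
    then show "continuous_map (prod_topology (gtop X) (gtop X)) euclideanreal (\<lambda>z. dist (\<psi> (snd z)) (\<psi> (fst z)))"
      by (simp add: continuous_map_atin tendsto_dist)
  qed simp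
  ultimately show False
    using \<open>r + d < r'\<close> by (auto simp: dist_real_def abs_le_iff)
qed

lemma Urysohn_for_families:
  fixes Y :: "('g::{topological_group_add, t2_space}, 'y) gspace"
  assumes Y: "is_gspace Y" and Ur: "Urysohn_for W \<sigma> Y"
    and S: "finite \<S>" "\<S> \<noteq> {}" "\<And>A. A \<in> \<S> \<Longrightarrow> A \<noteq> {} \<and> A \<subseteq> points Y"
    and T: "finite \<T>" "\<T> \<noteq> {}" "\<And>A. A \<in> \<T> \<Longrightarrow> A \<noteq> {} \<and> A \<subseteq> points Y"
    and sep: "\<And>A B. A \<in> \<S> \<Longrightarrow> B \<in> \<T> \<Longrightarrow> separated Y W h A B" and c: "0 < c" "c < 1"
  shows "\<exists>p. continuous_map (gtop Y) (top_of_set {0..1::real}) p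
     \<and> (\<forall>g. \<forall>y\<in>points Y. \<bar>p (gact Y g y) - p y\<bar> \<le> \<sigma> g)
     \<and> (\<forall>A\<in>\<S>. \<forall>y\<in>A. p (gact Y h y) = 0) \<and> (\<forall>A\<in>\<T>. \<forall>y\<in>A. p y = c)"
proof -
  let ?K = "\<Union>A\<in>\<S>. gtop Y closure_of (gact Y h ` A)" and ?L = "\<Union>A\<in>\<T>. gtop Y closure_of A"
  have K: "gact Y h y \<in> ?K" if "A \<in> \<S>" "y \<in> A" for A y
  proof -
    have "gact Y h ` A \<subseteq> points Y"
      using S(3)[OF that(1)] gact_closed[OF Y] by blast
    from subsetD[OF closure_of_subset[OF this]] that show ?thesis
      by blast
  qed
  have L: "y \<in> ?L" if "A \<in> \<T>" "y \<in> A" for A y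
  proof -
    have "A \<subseteq> points Y"
      using T(3)[OF that(1)] by blast
    from subsetD[OF closure_of_subset[OF this]] that show ?thesis
      by blast
  qed
  have cl: "closedin (gtop Y) ?K" "closedin (gtop Y) ?L"
    using S(1) T(1) by (auto intro!: closedin_Union)
  have K0: "?K \<noteq> {}"
  proof -
    obtain A y where "A \<in> \<S>" "y \<in> A"
      using S(2,3) by blast
    from K[OF this] show ?thesis
      by (intro notI) (simp only: empty_iff)
  qed
  have L0: "?L \<noteq> {}"
  proof -
    obtain A y where "A \<in> \<T>" "y \<in> A"
      using T(2,3) by blast
    from L[OF this] show ?thesis
      by (intro notI) (simp only: empty_iff)
  qed
  have KL: "?K \<times> ?L \<inter> R_rel Y W = {}"
  proof (intro equals0I, elim IntE SigmaE UN_E)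
    fix q a b A B
    assume *: "q \<in> R_rel Y W" "q = (a, b)" "A \<in> \<S>" "a \<in> gtop Y closure_of (gact Y h ` A)"
      "B \<in> \<T>" "b \<in> gtop Y closure_of B"
    then have "q \<in> (gtop Y closure_of (gact Y h ` A)) \<times> (gtop Y closure_of B) \<inter> R_rel Y W"
      by simp
    then show False
      unfolding sep[OF *(3,5), unfolded separated_def] by simp
  qed
  obtain p where p: "continuous_map (gtop Y) (top_of_set {0..1}) p"
      "\<forall>g. \<forall>y\<in>points Y. \<bar>p (gact Y g y) - p y\<bar> \<le> \<sigma> g" "\<forall>y\<in>?K. p y = 0" "\<forall>y\<in>?L. p y = c"
    using Ur[unfolded Urysohn_for_def, rule_format,
        OF conjI[OF cl(1) conjI[OF cl(2) conjI[OF K0 conjI[OF L0 KL]]]] conjI[OF c]]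
    by (elim exE conjE) (rule that)
  show ?thesis
    by (intro exI[of _ p] conjI p(1,2) ballI)
       (rule p(3)[rule_format, OF K], assumption+, rule p(4)[rule_format, OF L], assumption+)
qed

lemma (in compatible_covers) related_equivariant:
  assumes Ur: "Urysohn \<N> Y" and H: "closure H = UNIV"
    and B: "\<B> \<subseteq> RPC_nbhds \<N>" "base_at_identity \<B>" and \<zeta>: "\<zeta> ` \<B> \<subseteq> \<B>"
    and osc: "\<And>p :: 'x \<Rightarrow> complex. continuous_map (gtop X) euclidean p \<Longrightarrow>
      eventually (\<lambda>i. \<forall>A\<in>\<O> i. \<forall>a\<in>A. \<forall>b\<in>A. dist (p a) (p b) < 1 / 4) \<U>"
    and sep: "\<And>h V. h \<in> H \<Longrightarrow> V \<in> \<B> \<Longrightarrow> eventually (\<lambda>i. \<forall>A\<in>\<O> i. \<forall>B\<in>\<O> i.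
      separated X V h A B \<longrightarrow> separated Y (\<zeta> V) h (s i A) (s i B)) \<U>"
    and \<phi>: "\<phi> \<in> points (ultracopower I \<U> Y)" and x: "related x \<phi>"
    and x': "related x' (gact (ultracopower I \<U> Y) g \<phi>)"
  shows "x' = gact X g x"
proof (rule ccontr)
  assume ne: "x' \<noteq> gact X g x"
  let ?Z = "ultracopower I \<U> Y"
  have xX: "x \<in> points X" "x' \<in> points X" "gact X g x \<in> points X"
    using x x' gact_closed[OF gspace(1)] by (auto simp: related_def)
  have "Hausdorff_space (gtop X)" "compact_space (gtop X)"
    using X by (auto simp: is_flow_def is_gspace_def)
  then have "completely_regular_space (gtop X)" "closedin (gtop X) {x'}"
    using xX(2) compact_Hausdorff_or_regular_imp_normal_space[of "gtop X"]
    by (simp_all add: normal_imp_completely_regular_space closedin_Hausdorff_singleton)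
  then obtain \<psi> :: "'x \<Rightarrow> real" where "continuous_map (gtop X) (top_of_set {0..1}) \<psi>"
      and \<psi>0: "\<psi> (gact X g x) = 0" and \<psi>1: "\<psi> x' = 1"
    using ne xX unfolding completely_regular_space_def by (auto dest!: spec[of _ "{x'}"])
  then have \<psi>: "continuous_map (gtop X) euclideanreal \<psi>"
    by (simp add: continuous_map_in_subtopology)
  have \<psi>g: "continuous_map (gtop X) euclideanreal (\<lambda>y. \<psi> (gact X g y))"
    using continuous_map_compose[OF gact_continuous[OF gspace(1)] \<psi>] by (simp add: o_def)
  obtain V where V: "open V" "0 \<in> V" "\<And>v y. v \<in> V \<Longrightarrow> y \<in> points X \<Longrightarrow> dist (\<psi> (gact X v y)) (\<psi> y) < 1 / 16"
    using flow_uniform[OF X \<psi>, of "1/16"] by auto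
  obtain W where W: "W \<in> \<B>" "W \<subseteq> V"
    using B(2) V(1,2) unfolding base_at_identity_def by blast
  obtain \<sigma> where \<sigma>: "seminorm \<sigma>" "Urysohn_for (\<zeta> W) \<sigma> Y"
    using Ur W(1) \<zeta> B(1) unfolding Urysohn_def SN_RPC_def by blast
  have "continuous_on UNIV \<sigma>"
    using \<sigma>(1) by (simp add: seminorm_def)
  have cont_diff: "continuous_on UNIV (\<lambda>h. h - g)"
    by (intro continuous_intros)
  have "open {h. h - g \<in> V}"
    using open_vimage[OF V(1) cont_diff] by (simp add: vimage_def)
  moreover have "open {h. \<sigma> (h - g) < 1 / 8}"
    by (intro open_Collect_less continuous_on_compose2[OF \<open>continuous_on UNIV \<sigma>\<close>] continuous_intros) auto
  ultimately have "open ({h. h - g \<in> V} \<inter> {h. \<sigma> (h - g) < 1 / 8})"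
    by (rule open_Int)
  moreover have "g \<in> {h. h - g \<in> V} \<inter> {h. \<sigma> (h - g) < 1 / 8}"
    using V(2) \<sigma>(1) by (simp add: seminorm_def)
  ultimately have "({h. h - g \<in> V} \<inter> {h. \<sigma> (h - g) < 1 / 8}) \<inter> H \<noteq> {}"
    using open_Int_closure_eq_empty[of _ H] H by blast
  then obtain h where h: "h \<in> H" "h - g \<in> V" "\<sigma> (h - g) < 1 / 8"
    by blast
  define D where "D = {y \<in> points X. \<psi> (gact X g y) \<in> {..<1/8}}"
  define D' where "D' = {y \<in> points X. \<psi> y \<in> {7/8<..}}"
  have "openin (gtop X) D"
    unfolding D_def by (rule openin_continuous_map_preimage[OF \<psi>g]) simp
  moreover have "openin (gtop X) D'"
    unfolding D'_def by (rule openin_continuous_map_preimage[OF \<psi>]) simp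
  ultimately have D: "openin (gtop X) D" "x \<in> D" "openin (gtop X) D'" "x' \<in> D'"
    using xX \<psi>0 \<psi>1 by (simp_all add: D_def D'_def)
  have \<psi>_h: "\<psi> (gact X h y) < \<psi> (gact X g y) + 1 / 16" if "y \<in> points X" for y
  proof -
    have *: "gact X h y = gact X (h - g) (gact X g y)"
      using gact_add[OF gspace(1) that, of "h - g" g] by simp
    show ?thesis
      using V(3)[OF h(2) gact_closed[OF gspace(1) that, of g]] unfolding * dist_real_def by linarith
  qed
  define G where "G i \<longleftrightarrow> i \<in> I \<and> (\<forall>A\<in>\<O> i. \<forall>a\<in>A. \<forall>b\<in>A. dist (\<psi> a) (\<psi> b) < 1 / 4)
     \<and> (\<forall>A\<in>\<O> i. \<forall>a\<in>A. \<forall>b\<in>A. dist (\<psi> (gact X g a)) (\<psi> (gact X g b)) < 1 / 4)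
     \<and> (\<forall>A\<in>\<O> i. \<forall>B\<in>\<O> i. separated X W h A B \<longrightarrow> separated Y (\<zeta> W) h (s i A) (s i B))" for i
  have osc_real: "eventually (\<lambda>i. \<forall>A\<in>\<O> i. \<forall>a\<in>A. \<forall>b\<in>A. dist (p a) (p b) < 1 / 4) \<U>"
    if "continuous_map (gtop X) euclideanreal p" for p
  proof -
    have "continuous_map (gtop X) euclidean (\<lambda>x. complex_of_real (p x))"
      using continuous_map_compose[OF that, of euclidean complex_of_real]
      by (simp add: o_def continuous_on_of_real_id)
    from osc[OF this] show ?thesis
      by (simp add: dist_of_real)
  qed
  have G: "eventually G \<U>"
    unfolding G_def
    by (intro eventually_conj ultrafilters_onD(2)[OF U] osc_real \<psi> \<psi>g sep h(1) W(1))
  define good where "good i p \<longleftrightarrow> continuous_map (gtop Y) (top_of_set {0..1::real}) p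
     \<and> (\<forall>g. \<forall>y\<in>points Y. \<bar>p (gact Y g y) - p y\<bar> \<le> \<sigma> g)
     \<and> (\<forall>A\<in>{A \<in> \<O> i. A \<inter> D \<noteq> {}}. \<forall>y\<in>s i A. p (gact Y h y) = 0)
     \<and> (\<forall>A\<in>{A \<in> \<O> i. A \<inter> D' \<noteq> {}}. \<forall>y\<in>s i A. p y = 1 / 2)" for i p
  have ex_good: "\<exists>p. good i p" if "G i" for i
  proof -
    have i: "i \<in> I"
      using that by (simp add: G_def)
    have OX: "A \<subseteq> points X" and OY: "s i A \<subseteq> points Y" if "A \<in> \<O> i" for A
      using cover[OF i] cover'[OF i] that by blast+
    have small: "\<psi> (gact X h a) \<le> 7 / 16" if A: "A \<in> \<O> i" "A \<inter> D \<noteq> {}" and a: "a \<in> A" for A a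
    proof -
      obtain b where b: "b \<in> A" "\<psi> (gact X g b) < 1 / 8"
        using A(2) by (auto simp: D_def)
      have "dist (\<psi> (gact X g a)) (\<psi> (gact X g b)) < 1 / 4"
        using \<open>G i\<close> A(1) a b(1) unfolding G_def by blast
      moreover have "\<psi> (gact X h a) < \<psi> (gact X g a) + 1 / 16"
        using \<psi>_h OX[OF A(1)] a by blast
      ultimately show ?thesis
        using b(2) unfolding dist_real_def by linarith
    qed
    have large: "5 / 8 \<le> \<psi> a" if A: "A \<in> \<O> i" "A \<inter> D' \<noteq> {}" and a: "a \<in> A" for A a
    proof -
      obtain b where b: "b \<in> A" "7 / 8 < \<psi> b"
        using A(2) by (auto simp: D'_def)
      have "dist (\<psi> a) (\<psi> b) < 1 / 4"
        using \<open>G i\<close> A(1) a b(1) unfolding G_def by blast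
      then show ?thesis
        using b(2) unfolding dist_real_def by linarith
    qed
    have sepY: "separated Y (\<zeta> W) h (s i A) (s i B)"
      if A: "A \<in> \<O> i" "A \<inter> D \<noteq> {}" and B: "B \<in> \<O> i" "B \<inter> D' \<noteq> {}" for A B
    proof -
      have "separated X W h A B"
        by (rule separated_by_function[OF gspace(1) \<psi> _ OX[OF A(1)] small[OF A] OX[OF B(1)] large[OF B], of W "1/16"])
           (use V(3) W(2) in \<open>auto intro: less_imp_le\<close>)
      then show ?thesis
        using \<open>G i\<close> A(1) B(1) unfolding G_def by blast
    qed
    have meets: "\<exists>A\<in>\<O> i. A \<inter> E \<noteq> {}" if "y \<in> E" "y \<in> points X" for y E
      using cover[OF i] that by blast
    have "\<exists>p. continuous_map (gtop Y) (top_of_set {0..1::real}) p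
       \<and> (\<forall>g. \<forall>y\<in>points Y. \<bar>p (gact Y g y) - p y\<bar> \<le> \<sigma> g)
       \<and> (\<forall>A\<in>s i ` {A \<in> \<O> i. A \<inter> D \<noteq> {}}. \<forall>y\<in>A. p (gact Y h y) = 0)
       \<and> (\<forall>A\<in>s i ` {A \<in> \<O> i. A \<inter> D' \<noteq> {}}. \<forall>y\<in>A. p y = 1 / 2)"
    proof (rule Urysohn_for_families[OF gspace(2) \<sigma>(2)])
      show "s i ` {A \<in> \<O> i. A \<inter> D \<noteq> {}} \<noteq> {}" "s i ` {A \<in> \<O> i. A \<inter> D' \<noteq> {}} \<noteq> {}"
        using meets[OF D(2) xX(1)] meets[OF D(4) xX(2)] by auto
      show "separated Y (\<zeta> W) h A B"
        if "A \<in> s i ` {A \<in> \<O> i. A \<inter> D \<noteq> {}}" "B \<in> s i ` {A \<in> \<O> i. A \<inter> D' \<noteq> {}}" for A B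
        using that by (elim imageE CollectE conjE) (simp only:, rule sepY)
    qed (use finite_cover[OF i] nonempty[OF i] OY in auto)
    then show ?thesis
      unfolding good_def by (simp only: ball_simps)
  qed
  define p where "p i = (if G i then SOME p. good i p else (\<lambda>_. 0))" for i
  have good: "good i (p i)" if "G i" for i
    using someI_ex[OF ex_good[OF that]] that by (simp add: p_def)
  have p_bad: "p i = (\<lambda>_. 0)" if "\<not> G i" for i
    using that by (simp add: p_def)
  have cont_p: "continuous_map (gtop Y) (top_of_set {0..1}) (p i)" for i
    by (cases "G i") (use good[of i] p_bad[of i] in \<open>auto simp: good_def\<close>)
  have lip_p: "\<bar>p i (gact Y k y) - p i y\<bar> \<le> \<sigma> k" if "y \<in> points Y" for i k y
    by (cases "G i") (use good[of i] p_bad[of i] that \<sigma>(1) in \<open>auto simp: good_def seminorm_def\<close>)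
  let ?p = "\<lambda>z\<in>points (copies I Y). complex_of_real (p (fst z) (snd z))"
  have pC: "?p \<in> C_G (copies I Y)"
  proof (rule C_G_modulus[OF gspace(3) _ _ \<sigma>(1)])
    have "continuous_map (gtop Y) euclidean (\<lambda>y. complex_of_real (p i y))" for i
      using continuous_map_compose[OF conjunct1[OF cont_p[unfolded continuous_map_in_subtopology]], of euclidean complex_of_real]
      by (simp add: o_def continuous_on_of_real_id)
    then show "continuous_map (gtop (copies I Y)) euclidean (\<lambda>z. complex_of_real (p (fst z) (snd z)))"
      by (simp add: continuous_map_copies)
    have "norm (complex_of_real (p i y)) \<le> 1" if "y \<in> points Y" for i y
    proof -
      have "p i y \<in> {0..1}"
        using continuous_map_image_subset_topspace[OF cont_p[of i]] that by auto
      then show ?thesis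
        by simp
    qed
    then show "bounded ((\<lambda>z. complex_of_real (p (fst z) (snd z))) ` points (copies I Y))"
      unfolding bounded_iff by (intro exI[of _ 1]) auto
    fix k z assume "z \<in> points (copies I Y)"
    then show "dist (complex_of_real (p (fst (gact (copies I Y) k z)) (snd (gact (copies I Y) k z))))
        (complex_of_real (p (fst z) (snd z))) \<le> \<sigma> k"
      using lip_p by (auto simp: dist_of_real dist_real_def)
  qed
  have "gact ?Z g \<phi> ?p \<in> {complex_of_real (1 / 2)}"
  proof (rule related_closed[OF gact_ultracopower_closed[OF gspace(2) U \<phi>] x' D(3,4) pC])
    show "eventually (\<lambda>i. \<forall>y. (i, y) \<in> trace D' \<longrightarrow> ?p (i, y) \<in> {complex_of_real (1 / 2)}) \<U>"
      using G
    proof eventually_elim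
      case (elim i)
      show ?case
      proof (intro allI impI)
        fix y assume y: "(i, y) \<in> trace D'"
        then have "p i y = 1 / 2"
          using good[OF elim] unfolding good_def trace_def by blast
        then show "?p (i, y) \<in> {complex_of_real (1 / 2)}"
          unfolding restrict_apply'[OF subsetD[OF trace_points y]] by (simp only: fst_conv snd_conv singleton_iff)
      qed
    qed
  qed simp_all
  moreover have "\<phi> (translate (copies I Y) ?p g) \<in> cball 0 (1 / 8)"
  proof (rule related_closed[OF \<phi> x D(1,2) C_G_translate[OF gspace(3) pC]])
    show "eventually (\<lambda>i. \<forall>y. (i, y) \<in> trace D \<longrightarrow> translate (copies I Y) ?p g (i, y) \<in> cball 0 (1 / 8)) \<U>"
      using G
    proof eventually_elim
      case (elim i)
      show ?case
      proof (intro allI impI)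
        fix y assume y: "(i, y) \<in> trace D"
        then have iy: "i \<in> I" "y \<in> points Y"
          using trace_points by auto
        have "p i (gact Y h y) = 0"
          using y good[OF elim] unfolding good_def trace_def by blast
        moreover have "gact Y g y = gact Y (g - h) (gact Y h y)"
          using gact_add[OF gspace(2) iy(2), of "g - h" h] by simp
        moreover have "\<sigma> (g - h) = \<sigma> (h - g)"
          using \<sigma>(1) minus_diff_eq[of h g] unfolding seminorm_def by metis
        ultimately have "\<bar>p i (gact Y g y)\<bar> \<le> 1 / 8"
          using lip_p[OF gact_closed[OF gspace(2) iy(2), of h], of i "g - h"] h(3) by simp
        then show "translate (copies I Y) ?p g (i, y) \<in> cball 0 (1 / 8)"
          using iy gact_closed[OF gspace(2) iy(2)] by simp
      qed
    qed
  qed simp_all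
  ultimately have "complex_of_real (1 / 2) \<in> cball 0 (1 / 8)"
    unfolding gact_ultracopower gact_gelfand[OF pC] by (simp only: singleton_iff)
  then show False
    by (simp add: norm_divide)
qed

theorem weakly_contained_if_push_subset:
  fixes X :: "('g::{topological_group_add, t2_space}, 'x) gspace" and Y :: "('g, 'y) gspace"
  assumes flow: "is_flow X" "is_flow Y" and ne: "points X \<noteq> {}" and Ur: "Urysohn \<N> Y" and H: "closure H = UNIV"
    and B: "\<B> \<subseteq> RPC_nbhds \<N>" "base_at_identity \<B>" and \<zeta>: "\<zeta> ` \<B> \<subseteq> \<B>"
    and sub: "push_struct \<zeta> ` tp_over H \<B> X \<subseteq> tp_over H \<B> Y"
  shows "X \<preceq>\<^sub>G Y"
proof -
  define I :: "('g, 'x) index set" where "I = {(\<Phi>, F, N, n). finite \<Phi>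
      \<and> (\<forall>p\<in>\<Phi>. continuous_map (gtop X) euclidean p) \<and> finite F \<and> F \<subseteq> H \<and> finite N \<and> N \<subseteq> \<B>}"
  define R :: "('g, 'x) index \<Rightarrow> ('g, 'x) index \<Rightarrow> bool" where
    "R = (\<lambda>(\<Phi>, F, N, n) (\<Phi>', F', N', n'). \<Phi> \<subseteq> \<Phi>' \<and> F \<subseteq> F' \<and> N \<subseteq> N')"
  have "inj (\<lambda>n. ({}, {}, {}, n) :: ('g, 'x) index)" "range (\<lambda>n. ({}, {}, {}, n)) \<subseteq> I"
    by (auto simp: I_def inj_on_def)
  then have "infinite I"
    using range_inj_infinite infinite_super by blast
  then have "I \<noteq> {}"
    by auto
  moreover have "\<exists>k\<in>I. \<forall>l. R k l \<longrightarrow> R i l \<and> R j l" if "i \<in> I" "j \<in> I" for i j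
  proof -
    obtain \<Phi> F N n \<Phi>' F' N' n' where "i = (\<Phi>, F, N, n)" "j = (\<Phi>', F', N', n')"
      by (cases i, cases j) auto
    with that show ?thesis
      by (intro bexI[of _ "(\<Phi> \<union> \<Phi>', F \<union> F', N \<union> N', 0)"]) (auto simp: I_def R_def)
  qed
  moreover have "R i i" for i
    by (auto simp: R_def)
  ultimately obtain \<U> where U: "\<U> \<in> ultrafilters_on I" and RU: "\<And>i. i \<in> I \<Longrightarrow> eventually (R i) \<U>"
    using ultrafilter_directed[of I R] by blast
  have "\<forall>i\<in>I. \<exists>\<O>. finite \<O> \<and> (\<forall>A\<in>\<O>. openin (gtop X) A \<and> A \<noteq> {}) \<and> \<Union>\<O> = points X
    \<and> (\<forall>A\<in>\<O>. \<forall>p\<in>fst i. \<forall>a\<in>A. \<forall>b\<in>A. dist (p a) (p b) < 1 / 4)"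
  proof
    fix i assume "i \<in> I"
    then show "\<exists>\<O>. finite \<O> \<and> (\<forall>A\<in>\<O>. openin (gtop X) A \<and> A \<noteq> {}) \<and> \<Union>\<O> = points X
      \<and> (\<forall>A\<in>\<O>. \<forall>p\<in>fst i. \<forall>a\<in>A. \<forall>b\<in>A. dist (p a) (p b) < 1 / 4)"
      using flow(1) by (intro finite_cover_small_oscillation) (auto simp: I_def is_flow_def)
  qed
  from bchoice[OF this] obtain \<O> where O: "\<forall>i\<in>I. finite (\<O> i) \<and> (\<forall>A\<in>\<O> i. openin (gtop X) A \<and> A \<noteq> {})
    \<and> \<Union> (\<O> i) = points X \<and> (\<forall>A\<in>\<O> i. \<forall>p\<in>fst i. \<forall>a\<in>A. \<forall>b\<in>A. dist (p a) (p b) < 1 / 4)"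
    by (rule exE)
  have "\<forall>i\<in>I. \<exists>s. (\<forall>A\<in>\<O> i. openin (gtop Y) (s A) \<and> s A \<noteq> {})
    \<and> (\<forall>\<S>\<subseteq>\<O> i. \<S> \<noteq> {} \<longrightarrow> \<Union>\<S> = points X \<longrightarrow> \<Union> (s ` \<S>) = points Y)
    \<and> (\<forall>g\<in>fst (snd i). \<forall>V\<in>fst (snd (snd i)). \<forall>A\<in>\<O> i. \<forall>B\<in>\<O> i.
         separated X V g A B \<longrightarrow> separated Y (\<zeta> V) g (s A) (s B))"
  proof
    fix i assume i: "i \<in> I"
    have "finite (fst (snd i))" "fst (snd i) \<subseteq> H" "finite (fst (snd (snd i)))" "fst (snd (snd i)) \<subseteq> \<B>"
      using i by (auto simp: I_def)
    then show "\<exists>s. (\<forall>A\<in>\<O> i. openin (gtop Y) (s A) \<and> s A \<noteq> {})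
      \<and> (\<forall>\<S>\<subseteq>\<O> i. \<S> \<noteq> {} \<longrightarrow> \<Union>\<S> = points X \<longrightarrow> \<Union> (s ` \<S>) = points Y)
      \<and> (\<forall>g\<in>fst (snd i). \<forall>V\<in>fst (snd (snd i)). \<forall>A\<in>\<O> i. \<forall>B\<in>\<O> i.
           separated X V g A B \<longrightarrow> separated Y (\<zeta> V) g (s A) (s B))"
      using bspec[OF O i] by (intro tp_over_transfer[OF sub]) simp_all
  qed
  from bchoice[OF this] obtain s where s: "\<forall>i\<in>I. (\<forall>A\<in>\<O> i. openin (gtop Y) (s i A) \<and> s i A \<noteq> {})
    \<and> (\<forall>\<S>\<subseteq>\<O> i. \<S> \<noteq> {} \<longrightarrow> \<Union>\<S> = points X \<longrightarrow> \<Union> (s i ` \<S>) = points Y)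
    \<and> (\<forall>g\<in>fst (snd i). \<forall>V\<in>fst (snd (snd i)). \<forall>A\<in>\<O> i. \<forall>B\<in>\<O> i.
         separated X V g A B \<longrightarrow> separated Y (\<zeta> V) g (s i A) (s i B))"
    by (rule exE)
  interpret compatible_covers I \<U> X Y \<O> s
  proof
    fix i assume i: "i \<in> I"
    show "\<Union> (s i ` \<O> i) = points Y"
      using bspec[OF s i, THEN conjunct2, THEN conjunct1, THEN spec[of _ "\<O> i"]] bspec[OF O i] ne by fastforce
  qed (use flow U O s in auto)
  have "is_factor_of X (ultracopower I \<U> Y)"
  proof (rule factor_of_ultracopower)
    fix x x' g \<phi>
    assume \<phi>: "\<phi> \<in> points (ultracopower I \<U> Y)" "related x \<phi>" "related x' (gact (ultracopower I \<U> Y) g \<phi>)"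
    show "x' = gact X g x"
    proof (rule related_equivariant[OF Ur H B \<zeta> _ _ \<phi>])
      fix p :: "'x \<Rightarrow> complex" assume p: "continuous_map (gtop X) euclidean p"
      then have "({p}, {}, {}, 0) \<in> I"
        by (simp add: I_def)
      from RU[OF this] ultrafilters_onD(2)[OF U]
      show "eventually (\<lambda>i. \<forall>A\<in>\<O> i. \<forall>a\<in>A. \<forall>b\<in>A. dist (p a) (p b) < 1 / 4) \<U>"
      proof eventually_elim
        case (elim i)
        then have "p \<in> fst i"
          by (auto simp: R_def split: prod.splits)
        with bspec[OF O elim(2)] show ?case
          by blast
      qed
    next
      fix h V assume hV: "h \<in> H" "V \<in> \<B>"
      then have "({}, {h}, {V}, 0) \<in> I"
        by (simp add: I_def)
      from RU[OF this] ultrafilters_onD(2)[OF U]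
      show "eventually (\<lambda>i. \<forall>A\<in>\<O> i. \<forall>B\<in>\<O> i. separated X V h A B \<longrightarrow> separated Y (\<zeta> V) h (s i A) (s i B)) \<U>"
      proof eventually_elim
        case (elim i)
        then have "h \<in> fst (snd i)" "V \<in> fst (snd (snd i))"
          by (auto simp: R_def split: prod.splits)
        from bspec[OF bspec[OF bspec[OF s elim(2), THEN conjunct2, THEN conjunct2] this(1)] this(2)]
        show ?case .
      qed
    qed
  qed
  with \<open>infinite I\<close> U show ?thesis
    unfolding weakly_contained_def weakly_contained_over_def by blast
qed

lemma weakly_contained_empty:
  fixes X :: "('g::{topological_group_add, t2_space}, 'x) gspace" and Y :: "('g, 'y) gspace"
  assumes "points X = {}" and Y: "is_flow Y" "points Y = {}"
  shows "X \<preceq>\<^sub>G Y"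
proof -
  define I :: "('g, 'x) index set" where "I = range (\<lambda>n. ({}, {}, {}, n))"
  have "infinite I"
    unfolding I_def by (rule range_inj_infinite) (simp add: inj_on_def)
  then have "principal I \<noteq> bot"
    by (auto simp: principal_eq_bot_iff)
  then obtain \<U> where U: "\<U> \<in> ultrafilters_on I"
    using ultrafilter_below[of "principal I" I] by auto
  have "is_gspace (copies I Y)"
    using Y(1) by (simp add: is_flow_def is_gspace_copies)
  then have "points (gelfand (copies I Y)) = {}"
    using char_approx[OF _ gelfandD, of "copies I Y" _ "{}" 1] Y(2) by fastforce
  then have "points (ultracopower I \<U> Y) = {}"
    using points_ultracopower_subset by blast
  then have "is_factor_map (ultracopower I \<U> Y) X undefined"
    using assms(1) by (simp add: is_factor_map_def continuous_map_def)
  with \<open>infinite I\<close> U show ?thesis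
    unfolding weakly_contained_def weakly_contained_over_def is_factor_of_def by blast
qed

lemma points_empty_iff_tp_over:
  "points X = {} \<longleftrightarrow>
    \<lparr>verts = {..<1}, lgrp = {}, lnbh = {}, relE = \<lambda>_ _. {}, relC = \<lambda>_. {}\<rparr> \<notin> tp_over H \<B> X"
  (is "_ \<longleftrightarrow> ?M \<notin> _")
proof -
  have "realizes X ?M \<longleftrightarrow> points X \<noteq> {}"
  proof
    assume "realizes X ?M"
    then obtain \<O> e where "\<forall>A\<in>\<O>. openin (gtop X) A \<and> A \<noteq> {}" "bij_betw e {..<1::nat} \<O>"
      by (auto simp: realizes_def bij_morphism_def open_struct_def)
    then have "openin (gtop X) (e 0)" "e 0 \<noteq> {}"
      by (auto dest: bij_betwE)
    then show "points X \<noteq> {}"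
      using openin_subset by blast
  next
    assume ne: "points X \<noteq> {}"
    have "bij_betw (\<lambda>_. points X) {..<1::nat} {points X}"
      by (auto simp: bij_betw_def inj_on_def)
    with ne show "realizes X ?M"
      unfolding realizes_def bij_morphism_def
      by (intro exI[of _ "{points X}"]) (auto simp: open_struct_def intro!: exI[of _ "\<lambda>_. points X"])
  qed
  moreover have "?M \<in> Str_over H \<B>"
    by (auto simp: Str_over_def Str_def is_lstruct_def intro!: exI[of _ "{}"])
  ultimately show ?thesis
    by (simp add: tp_over_def)
qed

lemma push_struct_id:
  assumes "M \<in> Str_over H \<B>"
  shows "push_struct id M = M"
proof -
  have "relE M g U = {}" if "U \<notin> lnbh M" for g U
    using assms that by (auto simp: Str_over_def Str_def is_lstruct_def)
  then have "(\<lambda>g V. \<Union>U\<in>{U \<in> lnbh M. id U = V}. relE M g U) = relE M"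
    by (auto simp: fun_eq_iff)
  then show ?thesis
    by (simp add: push_struct_def)
qed

lemma weakly_contained_if_tp_over_eq:
  assumes X: "is_flow X" and Y: "is_flow Y" "Urysohn \<N> Y" and H: "closure H = UNIV"
    and B: "\<B> \<subseteq> RPC_nbhds \<N>" "base_at_identity \<B>" and eq: "tp_over H \<B> X = tp_over H \<B> Y"
  shows "X \<preceq>\<^sub>G Y"
proof (cases "points X = {}")
  case True
  then have "points Y = {}"
    unfolding points_empty_iff_tp_over[of _ H \<B>] eq .
  from weakly_contained_empty[OF True Y(1) this] show ?thesis .
next
  case False
  have "push_struct id ` tp_over H \<B> X \<subseteq> tp_over H \<B> Y"
    unfolding eq
  proof (rule image_subsetI)
    fix M assume M: "M \<in> tp_over H \<B> Y"
    then have "M \<in> Str_over H \<B>"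
      by (simp add: tp_over_def)
    with M show "push_struct id M \<in> tp_over H \<B> Y"
      by (simp add: push_struct_id)
  qed
  from weakly_contained_if_push_subset[OF X Y(1) False Y(2) H B _ this] show ?thesis
    by simp
qed

lemma base_RPC_nbhds:
  assumes N: "symmetric_base \<N>" and L: "LRPC \<N>"
  shows "base_at_identity (RPC_nbhds \<N>)"
proof -
  obtain U where U: "U \<in> \<N>" "RPC \<N> U"
    using L by (auto simp: LRPC_def)
  have B: "base_at_identity \<N>"
    using N by (simp add: symmetric_base_def)
  have "\<exists>V\<in>RPC_nbhds \<N>. V \<subseteq> W" if W: "open W" "0 \<in> W" for W
  proof -
    have "open (U \<inter> W)" "0 \<in> U \<inter> W"
      using B U(1) W by (auto simp: base_at_identity_def)
    then obtain V where V: "V \<in> \<N>" "V \<subseteq> U \<inter> W"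
      using B unfolding base_at_identity_def by blast
    have "RPC \<N> V"
      unfolding RPC_def
    proof
      fix S assume "S \<in> \<N>"
      then obtain F where F: "finite F" "U \<subseteq> {v + f + w |v f w. v \<in> S \<and> f \<in> F \<and> w \<in> S}"
        using U(2) unfolding RPC_def by blast
      show "\<exists>F. finite F \<and> V \<subseteq> {v + f + w |v f w. v \<in> S \<and> f \<in> F \<and> w \<in> S}"
        using V(2) F(2) by (intro exI[of _ F] conjI F(1)) (rule order_trans, auto)
    qed
    with V show ?thesis
      by (auto simp: RPC_nbhds_def)
  qed
  with B show ?thesis
    by (auto simp: base_at_identity_def RPC_nbhds_def)
qed

theorem theorem8p5:
  fixes \<N> :: "'g::{topological_group_add, t2_space} set set"
    and X :: "('g, 'x) gspace"
    and Y :: "('g, 'y) gspace"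
  assumes "symmetric_base \<N>"
    and "LRPC \<N>"
    and "is_flow X"
    and "is_flow Y"
  shows
    "(weakly_contained_over TYPE('i) X Y \<longrightarrow> weak_type \<N> X \<subseteq> weak_type \<N> Y)
   \<and> (X \<preceq>\<^sub>G Y \<longrightarrow> weak_type \<N> X \<subseteq> weak_type \<N> Y)
   \<and> (X \<sim>\<^sub>G Y \<longrightarrow> weak_type \<N> X = weak_type \<N> Y)
   \<and> (\<forall>H \<B> \<zeta>. topspace (gtop X) \<noteq> {} \<and> Urysohn \<N> Y \<and> closure H = UNIV
        \<and> \<B> \<subseteq> RPC_nbhds \<N> \<and> base_at_identity \<B>
        \<and> \<zeta> ` \<B> \<subseteq> \<B> \<and> nonexpansive \<B> \<zeta>
        \<and> push_struct \<zeta> ` tp_over H \<B> X \<subseteq> tp_over H \<B> Y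
        \<longrightarrow> X \<preceq>\<^sub>G Y)
   \<and> (Urysohn \<N> X \<and> Urysohn \<N> Y \<longrightarrow>
        (X \<sim>\<^sub>G Y \<longleftrightarrow> weak_type \<N> X = weak_type \<N> Y)
      \<and> (\<forall>H \<B>. closure H = UNIV \<and> \<B> \<subseteq> RPC_nbhds \<N> \<and> base_at_identity \<B>
            \<and> tp_over H \<B> X = tp_over H \<B> Y
            \<longrightarrow> weak_type \<N> X = weak_type \<N> Y))"
proof -
  note N = assms(1) and X = assms(3) and Y = assms(4)
  have XY: "X \<preceq>\<^sub>G Y \<Longrightarrow> weak_type \<N> X \<subseteq> weak_type \<N> Y" and YX: "Y \<preceq>\<^sub>G X \<Longrightarrow> weak_type \<N> Y \<subseteq> weak_type \<N> X"
    unfolding weakly_contained_def by (rule weak_type_mono[OF N Y], assumption) (rule weak_type_mono[OF N X])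
  then have eq: "X \<sim>\<^sub>G Y \<Longrightarrow> weak_type \<N> X = weak_type \<N> Y"
    unfolding weakly_equivalent_def by blast
  have conv: "X \<sim>\<^sub>G Y"
    if "Urysohn \<N> X" "Urysohn \<N> Y" "closure H = UNIV" "\<B> \<subseteq> RPC_nbhds \<N>" "base_at_identity \<B>"
      "tp_over H \<B> X = tp_over H \<B> Y" for H \<B>
    unfolding weakly_equivalent_def
    using weakly_contained_if_tp_over_eq[OF X Y that(2-6)]
      weakly_contained_if_tp_over_eq[OF Y X that(1,3-5) that(6)[symmetric]] ..
  have iff: "X \<sim>\<^sub>G Y \<longleftrightarrow> weak_type \<N> X = weak_type \<N> Y" if "Urysohn \<N> X" "Urysohn \<N> Y"
    using eq conv[OF that closure_UNIV order_refl base_RPC_nbhds[OF N assms(2)]]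
    unfolding weak_type_def by (rule iffI)
  show ?thesis
  proof (intro conjI impI allI; (elim conjE)?)
    show "weak_type \<N> X \<subseteq> weak_type \<N> Y" if "weakly_contained_over TYPE('i) X Y"
      by (rule weak_type_mono[OF N Y that])
    show "X \<preceq>\<^sub>G Y" if "points X \<noteq> {}" "Urysohn \<N> Y" "closure H = UNIV" "\<B> \<subseteq> RPC_nbhds \<N>"
        "base_at_identity \<B>" "\<zeta> ` \<B> \<subseteq> \<B>" "push_struct \<zeta> ` tp_over H \<B> X \<subseteq> tp_over H \<B> Y"
      for H \<B> \<zeta>
      by (rule weakly_contained_if_push_subset[OF X Y that])
    show "weak_type \<N> X = weak_type \<N> Y"
      if "Urysohn \<N> X" "Urysohn \<N> Y" "closure H = UNIV" "\<B> \<subseteq> RPC_nbhds \<N>" "base_at_identity \<B>"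
        "tp_over H \<B> X = tp_over H \<B> Y" for H \<B>
      by (rule eq[OF conv[OF that]])
  qed (fact XY eq iff)+
qed


end
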